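(* Let $T>0$. Let $b:[0,T]\times\mathcal H\to\mathcal H$ be measurable, with $b(t,\cdot)$ globally Lipschitz uniformly in $t\in[0,T]$ and $\sup_{t\le T}\|b(t,0)\|<\infty$; let $\beta\in C([0,T])$ with $0<\beta_-\le\beta(t)\le\beta_+$; let $\sigma(x)=D(x)^{1/2}Q^{1/2}$ be Lipschitz from $\mathcal H$ into the Hilbert–Schmidt operators $\mathcal L_2(\mathcal H)$; and let $X_0\in L^2(\Omega;\mathcal H)$ be $\mathcal F_0$-measurable. Let $X$ be the strong solution of $$dX_t=b(t,X_t)\,dt+\sqrt{\beta(t)}\,\sigma(X_t)\,dW_t$$ with initial value $X_0$, and, for $n\ge1$, let $X^n$ be the solution of the Galerkin system $$dX^n_t=P_nb(t,X^n_t)\,dt+\sqrt{\beta(t)}\,P_n\sigma(X^n_t)\,dW_t,\qquad X^n_0=P_nX_0 .$$ Assume there exist $C,\gamma>0$ such that for all $n$ $$\mathbb E\|(I-P_n)X_0\|^2+\mathbb E\int_0^T\|(I-P_n)b(t,X_t)\|^2\,dt+\mathbb E\int_0^T\|(I-P_n)\sigma(X_t)\|_{\mathcal L_2}^2\,dt\le Cn^{-\gamma}.$$ Then there is a constant $C_T$ independent of $n$ with $$\mathbb E\sup_{t\le T}\|X^n_t-X_t\|^2\le C_Tn^{-\gamma}$$ for all $n$. Consequently (with a possibly different constant $C_T$), for all $t\in[0,T]$ and all $n$, $$W_2(\operatorname{Law}(X^n_t),\operatorname{Law}(X_t))\le C_Tn^{-\gamma/2}.$$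
   Context: $\mathcal H$ is a separable real Hilbert space; $Q$ is self-adjoint, trace class, $Qe_k=q_ke_k$ for an orthonormal basis $(e_k)$, $q_k>0$, $\sum_kq_k<\infty$. For each $x\in\mathcal H$, $D(x)$ is self-adjoint, positive and bounded, $d_-I\le D(x)\le d_+I$ with $0<d_-\le d_+<\infty$, and $x\mapsto D(x)^{1/2}$ is globally Lipschitz in operator norm. $P_n$ is the orthogonal projection onto $\operatorname{span}\{e_1,\dots,e_n\}$. $W$ is a cylindrical Wiener process in $\mathcal H$ on a filtered probability space; the same $W$ and $X_0$ are used for $X$ and all $X^n$. $W_2$ is the 2-Wasserstein distance on probability measures on $\mathcal H$ with finite second moment. *)

theory Defs
  imports "HOL-Probability.Probability"
begin

text \<open>
  The Hilbert space is a type of sort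
  \<open>{real_inner, banach, second_countable_topology}\<close>: a separable real Hilbert space of arbitrary
  (finite or countably infinite) dimension. Bounded operators are elements of \<open>'h \<Rightarrow>\<^sub>L 'h\<close>.
\<close>

section \<open>Operators on a Hilbert space\<close>

definition orthonormal_basis :: "nat set \<Rightarrow> (nat \<Rightarrow> 'h::real_inner) \<Rightarrow> bool" where
  "orthonormal_basis K e \<longleftrightarrow>
     (\<forall>j\<in>K. \<forall>k\<in>K. e j \<bullet> e k = (if j = k then 1 else 0)) \<and> closure (span (e ` K)) = UNIV"

definition self_adjoint :: "('h::real_inner \<Rightarrow>\<^sub>L 'h) \<Rightarrow> bool" where
  "self_adjoint A \<longleftrightarrow> (\<forall>x y. A x \<bullet> y = x \<bullet> A y)"

definition positive_op :: "('h::real_inner \<Rightarrow>\<^sub>L 'h) \<Rightarrow> bool" where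
  "positive_op A \<longleftrightarrow> (\<forall>x. 0 \<le> A x \<bullet> x)"

text \<open>The description below is proper whenever \<open>A\<close> is self-adjoint and positive on a Hilbert space.\<close>

definition op_sqrt :: "('h::real_inner \<Rightarrow>\<^sub>L 'h) \<Rightarrow> ('h \<Rightarrow>\<^sub>L 'h)" where
  "op_sqrt A = (THE B. self_adjoint B \<and> positive_op B \<and> B o\<^sub>L B = A)"

text \<open>Trace class operators in their nuclear form, with absolutely convergent rank-one expansions.\<close>

definition trace_class :: "('h::real_inner \<Rightarrow>\<^sub>L 'h) \<Rightarrow> bool" where
  "trace_class A \<longleftrightarrow> (\<exists>a b :: nat \<Rightarrow> 'h. summable (\<lambda>k. norm (a k) * norm (b k)) \<and>
     (\<forall>x. (\<lambda>k. (a k \<bullet> x) *\<^sub>R b k) sums A x))"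

definition is_orth_proj :: "'h::real_inner set \<Rightarrow> ('h \<Rightarrow>\<^sub>L 'h) \<Rightarrow> bool" where
  "is_orth_proj S P \<longleftrightarrow> (\<forall>x. P x \<in> S \<and> (\<forall>y\<in>S. (x - P x) \<bullet> y = 0))"

text \<open>
  The square of the Hilbert--Schmidt norm, with values in \<open>[0, \<infinity>]\<close>; it does not depend on the
  orthonormal basis \<open>(e k)\<close>, \<open>k \<in> K\<close>.
\<close>

definition hs_sq :: "nat set \<Rightarrow> (nat \<Rightarrow> 'h::real_inner) \<Rightarrow> ('h \<Rightarrow>\<^sub>L 'h) \<Rightarrow> ennreal" where
  "hs_sq K e A = (\<Sum>\<^sub>\<infinity>k\<in>K. ennreal ((norm (A (e k)))\<^sup>2))"

definition hilbert_schmidt :: "nat set \<Rightarrow> (nat \<Rightarrow> 'h::real_inner) \<Rightarrow> ('h \<Rightarrow>\<^sub>L 'h) \<Rightarrow> bool" where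
  "hilbert_schmidt K e A \<longleftrightarrow> hs_sq K e A < \<infinity>"

definition hs_norm :: "nat set \<Rightarrow> (nat \<Rightarrow> 'h::real_inner) \<Rightarrow> ('h \<Rightarrow>\<^sub>L 'h) \<Rightarrow> real" where
  "hs_norm K e A = sqrt (enn2real (hs_sq K e A))"

text \<open>The operator \<open>x \<mapsto> \<langle>h, x\<rangle> g\<close>.\<close>

definition rank_one :: "'h::real_inner \<Rightarrow> 'h \<Rightarrow> ('h \<Rightarrow>\<^sub>L 'h)" where
  "rank_one h g = blinfun_scaleR_left g o\<^sub>L blinfun_inner_right h"


section \<open>Cylindrical Wiener processes\<close>

text \<open>
  Time is the type of reals. Only times \<open>t \<ge> 0\<close> matter; a filtration indexed by \<open>t \<ge> 0\<close> is
  extended by \<open>F t = F 0\<close> for \<open>t < 0\<close>. No completeness or right-continuity is required.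
\<close>

locale filtered_prob_space = prob_space M + filtration "space M" F
  for M :: "'w measure" and F :: "real \<Rightarrow> 'w measure" +
  assumes subalgebra_F: "subalgebra M (F t)"

definition progressive ::
  "(real \<Rightarrow> 'w measure) \<Rightarrow> real \<Rightarrow> (real \<Rightarrow> 'w \<Rightarrow> 'b::topological_space) \<Rightarrow> bool" where
  "progressive F T Y \<longleftrightarrow> (\<forall>t\<in>{0..T}.
     (\<lambda>(s, \<omega>). Y s \<omega>) \<in> borel_measurable (restrict_space borel {0..t} \<Otimes>\<^sub>M F t))"

text \<open>
  \<open>W t h\<close> plays the role of the formal pairing of \<open>W\<^sub>t\<close> with \<open>h\<close>.
\<close>

definition cylindrical_wiener ::
  "'w measure \<Rightarrow> (real \<Rightarrow> 'w measure) \<Rightarrow> (real \<Rightarrow> 'h::real_inner \<Rightarrow> 'w \<Rightarrow> real) \<Rightarrow> bool" where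
  "cylindrical_wiener M F W \<longleftrightarrow>
     (\<forall>t\<ge>0. \<forall>h. W t h \<in> borel_measurable (F t)) \<and>
     (\<forall>h. AE \<omega> in M. W 0 h \<omega> = 0) \<and>
     (\<forall>h. AE \<omega> in M. continuous_on {0..} (\<lambda>t. W t h \<omega>)) \<and>
     (\<forall>t\<ge>0. \<forall>a b g h. AE \<omega> in M. W t (a *\<^sub>R g + b *\<^sub>R h) \<omega> = a * W t g \<omega> + b * W t h \<omega>) \<and>
     (\<forall>s t h. 0 \<le> s \<longrightarrow> s < t \<longrightarrow> h \<noteq> 0 \<longrightarrow>
        distributed M lborel (\<lambda>\<omega>. W t h \<omega> - W s h \<omega>) (normal_density 0 (norm h * sqrt (t - s)))) \<and>
     (\<forall>s t h. 0 \<le> s \<longrightarrow> s < t \<longrightarrow>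
        prob_space.indep_set M (sets (F s))
          (sets (vimage_algebra (space M) (\<lambda>\<omega>. W t h \<omega> - W s h \<omega>) borel)))"


section \<open>The stochastic integral\<close>

text \<open>
  An elementary process is a finite sum of terms
  \<open>1\<^bsub>(s, u]\<^esub>(r) \<xi>(\<omega>) (h \<otimes> g)\<close> with \<open>\<xi>\<close> bounded and \<open>F s\<close>-measurable, represented by
  the list of its tuples \<open>(s, u, \<xi>, h, g)\<close>. Its integral up to time \<open>t\<close> is the sum of
  the terms \<open>\<xi> (W\<^bsub>u \<and> t\<^esub> h - W\<^bsub>s \<and> t\<^esub> h) g\<close>.
\<close>

type_synonym ('w, 'h) elem = "(real \<times> real \<times> ('w \<Rightarrow> real) \<times> 'h \<times> 'h) list"

definition elementary :: "(real \<Rightarrow> 'w measure) \<Rightarrow> ('w, 'h) elem \<Rightarrow> bool" where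
  "elementary F \<phi> \<longleftrightarrow> (\<forall>(s, u, \<xi>, h, g) \<in> set \<phi>.
     0 \<le> s \<and> s \<le> u \<and> \<xi> \<in> borel_measurable (F s) \<and> bounded (\<xi> ` space (F s)))"

definition elem_process :: "('w, 'h::real_inner) elem \<Rightarrow> real \<Rightarrow> 'w \<Rightarrow> ('h \<Rightarrow>\<^sub>L 'h)" where
  "elem_process \<phi> r \<omega> =
     (\<Sum>(s, u, \<xi>, h, g) \<leftarrow> \<phi>. (indicator {s<..u} r * \<xi> \<omega>) *\<^sub>R rank_one h g)"

definition elem_integral ::
  "(real \<Rightarrow> 'h::real_inner \<Rightarrow> 'w \<Rightarrow> real) \<Rightarrow> ('w, 'h) elem \<Rightarrow> real \<Rightarrow> 'w \<Rightarrow> 'h" where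
  "elem_integral W \<phi> t \<omega> =
     (\<Sum>(s, u, \<xi>, h, g) \<leftarrow> \<phi>. (\<xi> \<omega> * (W (min u t) h \<omega> - W (min s t) h \<omega>)) *\<^sub>R g)"

text \<open>
  \<open>Y t\<close> is the Ito integral of \<open>\<Phi>\<close> over \<open>[0, t]\<close>, for \<open>t \<le> T\<close>, as the mean-square limit of
  integrals of elementary processes that approximate \<open>\<Phi>\<close> in \<open>L\<^sup>2([0, T] \<times> \<Omega>; L\<^sub>2)\<close>.
  Such approximations exist for progressively measurable \<open>\<Phi>\<close> with
  \<open>E \<integral> \<parallel>\<Phi>\<parallel>\<^sup>2 < \<infinity>\<close>, and only for those (up to null sets).
\<close>

definition ito_integral_L2 ::
  "'w measure \<Rightarrow> (real \<Rightarrow> 'w measure) \<Rightarrow> (real \<Rightarrow> 'h::real_inner \<Rightarrow> 'w \<Rightarrow> real) \<Rightarrow>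
   nat set \<Rightarrow> (nat \<Rightarrow> 'h) \<Rightarrow> real \<Rightarrow> (real \<Rightarrow> 'w \<Rightarrow> ('h \<Rightarrow>\<^sub>L 'h)) \<Rightarrow> (real \<Rightarrow> 'w \<Rightarrow> 'h) \<Rightarrow> bool" where
  "ito_integral_L2 M F W K e T \<Phi> Y \<longleftrightarrow>
     (\<exists>\<phi> :: nat \<Rightarrow> ('w, 'h) elem. (\<forall>m. elementary F (\<phi> m)) \<and>
        (\<lambda>m. \<integral>\<^sup>+\<omega>. (\<integral>\<^sup>+r\<in>{0..T}. hs_sq K e (elem_process (\<phi> m) r \<omega> - \<Phi> r \<omega>) \<partial>lborel) \<partial>M)
          \<longlonglongrightarrow> 0 \<and>
        (\<forall>t\<in>{0..T}.
          (\<lambda>m. \<integral>\<^sup>+\<omega>. ennreal ((norm (elem_integral W (\<phi> m) t \<omega> - Y t \<omega>))\<^sup>2) \<partial>M) \<longlonglongrightarrow> 0))"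

text \<open>
  The Ito integral as a continuous process, localized along stopping times that eventually
  reach \<open>T\<close>, hence for progressively measurable \<open>\<Phi>\<close> with \<open>\<integral> \<parallel>\<Phi>\<parallel>\<^sup>2 < \<infinity>\<close> almost surely.
\<close>

definition ito_integral ::
  "'w measure \<Rightarrow> (real \<Rightarrow> 'w measure) \<Rightarrow> (real \<Rightarrow> 'h::real_inner \<Rightarrow> 'w \<Rightarrow> real) \<Rightarrow>
   nat set \<Rightarrow> (nat \<Rightarrow> 'h) \<Rightarrow> real \<Rightarrow> (real \<Rightarrow> 'w \<Rightarrow> ('h \<Rightarrow>\<^sub>L 'h)) \<Rightarrow> (real \<Rightarrow> 'w \<Rightarrow> 'h) \<Rightarrow> bool" where
  "ito_integral M F W K e T \<Phi> Y \<longleftrightarrow>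
     (\<forall>h. progressive F T (\<lambda>s \<omega>. \<Phi> s \<omega> h)) \<and>
     progressive F T Y \<and>
     (AE \<omega> in M. continuous_on {0..T} (\<lambda>t. Y t \<omega>)) \<and>
     (\<exists>\<tau> :: nat \<Rightarrow> 'w \<Rightarrow> real.
        (\<forall>m. stopping_time F (\<tau> m)) \<and>
        (\<forall>\<omega>\<in>space M. incseq (\<lambda>m. \<tau> m \<omega>) \<and> 0 \<le> \<tau> 0 \<omega>) \<and>
        (AE \<omega> in M. \<exists>m. T \<le> \<tau> m \<omega>) \<and>
        (\<forall>m. ito_integral_L2 M F W K e T
               (\<lambda>s \<omega>. indicator {0..\<tau> m \<omega>} s *\<^sub>R \<Phi> s \<omega>) (\<lambda>t \<omega>. Y (min t (\<tau> m \<omega>)) \<omega>)))"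

text \<open>
  Strong solutions on \<open>[0, T]\<close> of \<open>dX\<^sub>t = f(t, X\<^sub>t) dt + S(t, X\<^sub>t) dW\<^sub>t\<close> with initial
  value \<open>X0\<close>, on the given filtered probability space and for the given \<open>W\<close>.
\<close>

definition strong_solution ::
  "'w measure \<Rightarrow> (real \<Rightarrow> 'w measure) \<Rightarrow>
   (real \<Rightarrow> 'h::{real_inner, banach, second_countable_topology} \<Rightarrow> 'w \<Rightarrow> real) \<Rightarrow>
   nat set \<Rightarrow> (nat \<Rightarrow> 'h) \<Rightarrow> real \<Rightarrow> (real \<Rightarrow> 'h \<Rightarrow> 'h) \<Rightarrow> (real \<Rightarrow> 'h \<Rightarrow> ('h \<Rightarrow>\<^sub>L 'h)) \<Rightarrow>
   ('w \<Rightarrow> 'h) \<Rightarrow> (real \<Rightarrow> 'w \<Rightarrow> 'h) \<Rightarrow> bool" where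
  "strong_solution M F W K e T f S X0 X \<longleftrightarrow>
     progressive F T X \<and>
     (AE \<omega> in M. continuous_on {0..T} (\<lambda>t. X t \<omega>)) \<and>
     (AE \<omega> in M. set_integrable lborel {0..T} (\<lambda>s. f s (X s \<omega>))) \<and>
     (\<exists>Y. ito_integral M F W K e T (\<lambda>s \<omega>. S s (X s \<omega>)) Y \<and>
        (AE \<omega> in M. \<forall>t\<in>{0..T}.
           X t \<omega> = X0 \<omega> + set_lebesgue_integral lborel {0..t} (\<lambda>s. f s (X s \<omega>)) + Y t \<omega>))"


section \<open>Wasserstein distance\<close>

definition law :: "'w measure \<Rightarrow> ('w \<Rightarrow> 'h::topological_space) \<Rightarrow> 'h measure" where
  "law M X = distr M borel X"

definition finite_second_moment :: "'h::real_normed_vector measure \<Rightarrow> bool" where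
  "finite_second_moment \<mu> \<longleftrightarrow> (\<integral>\<^sup>+x. ennreal ((norm x)\<^sup>2) \<partial>\<mu>) < \<infinity>"

definition couplings :: "'h::topological_space measure \<Rightarrow> 'h measure \<Rightarrow> ('h \<times> 'h) measure set" where
  "couplings \<mu> \<nu> = {\<pi>. prob_space \<pi> \<and> sets \<pi> = sets (borel \<Otimes>\<^sub>M borel) \<and>
     distr \<pi> borel fst = \<mu> \<and> distr \<pi> borel snd = \<nu>}"

text \<open>Meaningful for Borel probability measures with finite second moment, where the infimum is finite.\<close>

definition wasserstein2 :: "'h::metric_space measure \<Rightarrow> 'h measure \<Rightarrow> real" where
  "wasserstein2 \<mu> \<nu> =
     sqrt (enn2real (INF \<pi>\<in>couplings \<mu> \<nu>. \<integral>\<^sup>+(x, y). ennreal ((dist x y)\<^sup>2) \<partial>\<pi>))"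

end

theory Submission
  imports Defs
begin

text \<open>
  The difference \<open>\<Delta> = X\<^sup>n - X\<close> solves an equation whose coefficients split into a part that is
  Lipschitz in \<open>\<Delta>\<close> and a part \<open>(I - P\<^sub>n) b(X)\<close>, \<open>(I - P\<^sub>n) \<sigma>(X)\<close> that is small by hypothesis.
  The Ito isometry and Gronwall's inequality bound \<open>E \<integral> \<parallel>\<Delta>\<parallel>\<^sup>2\<close> by the small part, and Doob's
  inequality then bounds \<open>E sup \<parallel>\<Delta>\<parallel>\<^sup>2\<close>. The joint law of \<open>X\<^sup>n\<^sub>t\<close> and \<open>X\<^sub>t\<close> is a coupling, which gives
  the Wasserstein estimate.

  The isometry and Doob's inequality are proved for elementary integrals and pass, up to constants,
  to mean-square limits and to the localized integral by Fatou's lemma. Gronwall's inequality in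
  expectation needs a finite second moment; along the localizing times this follows from Gronwall's
  inequality for each path, since continuous paths are bounded, and the resulting bound does not
  depend on the localization. No exit times are used, so the filtration can be arbitrary.
\<close>

section \<open>Orthonormal bases and the Hilbert--Schmidt norm\<close>

text \<open>The splitting of the coefficients is \<open>P\<^sub>n b(X\<^sup>n) - b(X) = P\<^sub>n
  (b(X\<^sup>n) - b(X)) - (I - P\<^sub>n) b(X)\<close>, and likewise for \<sigma>. The residual is
  evaluated along X, which is where the hypothesis controls it, and the contraction
  \<open>P\<^sub>n\<close> keeps Lipschitz and growth constants independent of n. Only the rate in n
  matters, so squares of sums are split crudely, at the cost of factors 2 and 3. Doob's inequality
  is derived from an inequality for single paths; it requires no conditional expectations, only that
  increments have mean zero when paired with variables from the past. Almost all estimates live in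
  \<open>ennreal\<close>, where integrals always exist; finiteness matters when Gronwall's
  inequality absorbs a term and when dominated convergence removes the localization. The supremum
  over \<open>[0, T]\<close> is uncountable and need not be measurable, so it is bounded by a
  measurable majorant built from finite time grids.\<close>

lemma norm_add_sq_le: "(norm (x + y))\<^sup>2 \<le> 2 * (norm x)\<^sup>2 + 2 * (norm (y::'a::real_inner))\<^sup>2"
proof -
  have "0 \<le> (norm (x - y))\<^sup>2" by simp
  then show ?thesis by (simp add: power2_norm_eq_inner algebra_simps inner_commute)
qed

lemma norm_diff_sq_le: "(norm (x - y))\<^sup>2 \<le> 2 * (norm x)\<^sup>2 + 2 * (norm (y::'a::real_inner))\<^sup>2"
  using norm_add_sq_le[of x "- y"] by simp

lemma norm_add3_sq_le:
  "(norm (x + y + z))\<^sup>2 \<le> 3 * (norm x)\<^sup>2 + 3 * (norm y)\<^sup>2 + 3 * (norm (z::'a::real_inner))\<^sup>2"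
proof -
  have "0 \<le> (norm (x - y))\<^sup>2 + (norm (y - z))\<^sup>2 + (norm (x - z))\<^sup>2" by simp
  then show ?thesis by (simp add: power2_norm_eq_inner algebra_simps inner_commute)
qed

lemma ennreal_le_2_add:
  "a \<le> 2 * b + 2 * c \<Longrightarrow> 0 \<le> b \<Longrightarrow> 0 \<le> c \<Longrightarrow> ennreal a \<le> 2 * ennreal b + 2 * ennreal c"
  by (metis ennreal_leI ennreal_mult ennreal_numeral ennreal_plus mult_nonneg_nonneg zero_le_numeral)

lemma ennreal_le_3_add:
  assumes "a \<le> 3 * b + 3 * c + 3 * d" "0 \<le> b" "0 \<le> c" "0 \<le> d"
  shows "ennreal a \<le> 3 * ennreal b + 3 * ennreal c + 3 * ennreal d"
proof -
  have "ennreal a \<le> ennreal (3 * b + 3 * c + 3 * d)" using assms by (intro ennreal_leI)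
  also have "\<dots> = 3 * ennreal b + 3 * ennreal c + 3 * ennreal d"
    using assms by (simp add: ennreal_mult)
  finally show ?thesis .
qed

section \<open>Fourier expansions in an orthonormal family and Parseval's identity\<close>

context
  fixes K :: "nat set" and e :: "nat \<Rightarrow> 'h::real_inner"
  assumes ons: "\<And>j k. j \<in> K \<Longrightarrow> k \<in> K \<Longrightarrow> e j \<bullet> e k = (if j = k then 1 else 0)"
begin

lemma inner_proj_eq:
  assumes J: "finite J" "J \<subseteq> K" "k \<in> J"
  shows "(x - (\<Sum>j\<in>J. (x \<bullet> e j) *\<^sub>R e j)) \<bullet> e k = 0"
proof -
  have "(\<Sum>j\<in>J. (x \<bullet> e j) *\<^sub>R e j) \<bullet> e k = (\<Sum>j\<in>J. (x \<bullet> e j) * (if j = k then 1 else 0))"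
    unfolding inner_sum_left using J by (intro sum.cong) (auto simp: ons subset_iff)
  also have "\<dots> = x \<bullet> e k" using J by (simp add: if_distrib cong: if_cong)
  finally show ?thesis by (simp add: inner_diff_left)
qed

lemma norm_proj_eq:
  assumes J: "finite J" "J \<subseteq> K"
  shows "(norm (x - (\<Sum>j\<in>J. (x \<bullet> e j) *\<^sub>R e j)))\<^sup>2 = (norm x)\<^sup>2 - (\<Sum>j\<in>J. (x \<bullet> e j)\<^sup>2)"
proof -
  let ?p = "\<Sum>j\<in>J. (x \<bullet> e j) *\<^sub>R e j"
  have "(x - ?p) \<bullet> ?p = 0"
    unfolding inner_sum_right using inner_proj_eq[OF J] by simp
  then have "(norm (x - ?p))\<^sup>2 = (x - ?p) \<bullet> x"
    by (simp add: power2_norm_eq_inner inner_diff_right)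
  also have "\<dots> = (norm x)\<^sup>2 - (\<Sum>j\<in>J. (x \<bullet> e j)\<^sup>2)"
    by (simp add: inner_diff_left inner_sum_left power2_eq_square
        inner_commute[of "e _" x] power2_norm_eq_inner[unfolded power2_eq_square])
  finally show ?thesis .
qed

text \<open>The residual is orthogonal to the span of the chosen vectors, so by Pythagoras the
  partial Fourier sum is the best approximation from that span.\<close>

lemma norm_proj_le:
  assumes J: "finite J" "J \<subseteq> K" and y: "y \<in> span (e ` J)"
  shows "norm (x - (\<Sum>j\<in>J. (x \<bullet> e j) *\<^sub>R e j)) \<le> norm (x - y)"
proof -
  let ?p = "\<Sum>j\<in>J. (x \<bullet> e j) *\<^sub>R e j"
  have sp: "?p - y \<in> span (e ` J)"
    by (intro span_diff span_sum span_scale span_base y) auto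
  have "orthogonal (x - ?p) (?p - y)"
    by (rule orthogonal_to_span[OF sp]) (auto simp: orthogonal_def inner_proj_eq[OF J])
  then have "(norm (x - y))\<^sup>2 = (norm (x - ?p))\<^sup>2 + (norm (?p - y))\<^sup>2"
    using norm_add_Pythagorean[of "x - ?p" "?p - y"] by simp
  then have "(norm (x - ?p))\<^sup>2 \<le> (norm (x - y))\<^sup>2" by simp
  then show ?thesis by (rule power2_le_imp_le) simp
qed

text \<open>Density gives an approximation of \<open>x\<close> in the span of finitely many
  \<open>e k\<close>. By best approximation the Fourier residual is no worse for any larger finite
  set, which is convergence along the finite subsets of \<open>K\<close>.\<close>

lemma parseval_has_sum:
  assumes dense: "closure (span (e ` K)) = UNIV"
  shows "((\<lambda>k. (x \<bullet> e k)\<^sup>2) has_sum (norm x)\<^sup>2) K"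
  unfolding has_sum_def tendsto_iff eventually_finite_subsets_at_top
proof (intro allI impI)
  fix \<epsilon> :: real assume \<epsilon>: "\<epsilon> > 0"
  have "x \<in> closure (span (e ` K))" by (simp add: dense)
  \<comment> \<open>The tolerance is the root of \<epsilon> because the defect in Parseval's
    identity is the square of the residual.\<close>
  then obtain y where y: "y \<in> span (e ` K)" "dist y x < sqrt \<epsilon>"
    using \<epsilon> unfolding closure_approachable by (meson real_sqrt_gt_zero)
  obtain S where S: "finite S" "S \<subseteq> e ` K" "y \<in> span S"
  proof -
    from y(1) obtain t r where "finite t" "t \<subseteq> e ` K" "y = (\<Sum>a\<in>t. r a *\<^sub>R a)"
      unfolding span_explicit by auto
    then show thesis using that[of t] by (simp add: span_sum span_scale span_base)
  qed
  obtain J where J: "finite J" "J \<subseteq> K" "S = e ` J"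
    using S(1,2) by (metis finite_subset_image)
  show "\<exists>X. finite X \<and> X \<subseteq> K \<and>
      (\<forall>Y. finite Y \<and> X \<subseteq> Y \<and> Y \<subseteq> K \<longrightarrow> dist (\<Sum>k\<in>Y. (x \<bullet> e k)\<^sup>2) ((norm x)\<^sup>2) < \<epsilon>)"
  proof (intro exI[of _ J] conjI allI impI)
    fix Y assume Y: "finite Y \<and> J \<subseteq> Y \<and> Y \<subseteq> K"
    have "y \<in> span (e ` Y)" using S(3) J(3) Y span_mono[of "e ` J" "e ` Y"] by auto
    then have "norm (x - (\<Sum>j\<in>Y. (x \<bullet> e j) *\<^sub>R e j)) \<le> norm (x - y)"
      using Y by (intro norm_proj_le) auto
    also have "\<dots> < sqrt \<epsilon>" using y(2) by (simp add: dist_norm norm_minus_commute)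
    finally have "(norm (x - (\<Sum>j\<in>Y. (x \<bullet> e j) *\<^sub>R e j)))\<^sup>2 < (sqrt \<epsilon>)\<^sup>2"
      by (intro power_strict_mono) auto
    moreover have "0 \<le> (norm (x - (\<Sum>j\<in>Y. (x \<bullet> e j) *\<^sub>R e j)))\<^sup>2" by simp
    ultimately show "dist (\<Sum>k\<in>Y. (x \<bullet> e k)\<^sup>2) ((norm x)\<^sup>2) < \<epsilon>"
      using norm_proj_eq[of Y x] Y \<epsilon> by (simp add: dist_real_def)
  qed (use J in auto)
qed

end

text \<open>Polarization of Parseval's identity.\<close>

lemma parseval_inner_has_sum:
  assumes "orthonormal_basis K e"
  shows "((\<lambda>k. (x \<bullet> e k) * (y \<bullet> e k)) has_sum (x \<bullet> y)) K"
proof -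
  have ons: "\<And>j k. j \<in> K \<Longrightarrow> k \<in> K \<Longrightarrow> e j \<bullet> e k = (if j = k then 1 else 0)"
    and dense: "closure (span (e ` K)) = UNIV"
    using assms by (auto simp: orthonormal_basis_def)
  have "((\<lambda>k. (((x + y) \<bullet> e k)\<^sup>2 - ((x - y) \<bullet> e k)\<^sup>2) / 4) has_sum
      (((norm (x + y))\<^sup>2 - (norm (x - y))\<^sup>2) / 4)) K"
    unfolding diff_conv_add_uminus
    by (intro has_sum_divide_const has_sum_add has_sum_uminusI parseval_has_sum ons dense)
  moreover have "(((x + y) \<bullet> e k)\<^sup>2 - ((x - y) \<bullet> e k)\<^sup>2) / 4 = (x \<bullet> e k) * (y \<bullet> e k)" for k
    by (simp add: inner_add_left inner_diff_left power2_eq_square algebra_simps)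
  moreover have "((norm (x + y))\<^sup>2 - (norm (x - y))\<^sup>2) / 4 = x \<bullet> y"
    by (simp add: power2_norm_eq_inner algebra_simps inner_commute)
  ultimately show ?thesis by simp
qed

section \<open>The Hilbert--Schmidt norm as a series, its algebra and its measurability\<close>

lemma infsum_ennreal_eq_suminf:
  fixes f :: "nat \<Rightarrow> ennreal"
  shows "(\<Sum>\<^sub>\<infinity>k\<in>K. f k) = (\<Sum>k. f k * indicator K k)"
proof -
  have "(\<Sum>\<^sub>\<infinity>k\<in>K. f k) = (\<Sum>\<^sub>\<infinity>k\<in>UNIV. f k * indicator K k)"
    by (rule infsum_cong_neutral) (auto simp: indicator_def)
  also have "\<dots> = (\<Sum>k. f k * indicator K k)"
    by (intro sums_unique has_sum_imp_sums has_sum_infsum nonneg_summable_on_complete) auto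
  finally show ?thesis .
qed

text \<open>Writing the sum over \<open>K\<close> as a series with an indicator makes monotonicity,
  linearity and measurability those of \<open>suminf\<close> in \<open>ennreal\<close>.\<close>

lemma hs_sq_suminf: "hs_sq K e A = (\<Sum>k. ennreal ((norm (A (e k)))\<^sup>2) * indicator K k)"
  by (simp add: hs_sq_def infsum_ennreal_eq_suminf)

lemma hs_sq_mono:
  fixes A B :: "'h::real_inner \<Rightarrow>\<^sub>L 'h"
  assumes "\<And>k. k \<in> K \<Longrightarrow> norm (A (e k)) \<le> norm (B (e k))"
  shows "hs_sq K e A \<le> hs_sq K e B"
  unfolding hs_sq_suminf using assms
  by (intro suminf_le) (auto simp: indicator_def intro!: ennreal_leI power_mono)

lemma hs_sq_add_le: "hs_sq K e (A + B) \<le> 2 * hs_sq K e A + 2 * hs_sq K e B"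
proof -
  have "hs_sq K e (A + B) \<le> (\<Sum>k. 2 * (ennreal ((norm (A (e k)))\<^sup>2) * indicator K k)
      + 2 * (ennreal ((norm (B (e k)))\<^sup>2) * indicator K k))"
    unfolding hs_sq_suminf
    by (intro suminf_le)
       (auto simp: indicator_def blinfun.add_left intro!: ennreal_le_2_add norm_add_sq_le)
  also have "\<dots> = 2 * hs_sq K e A + 2 * hs_sq K e B"
    by (simp add: hs_sq_suminf suminf_add[symmetric])
  finally show ?thesis .
qed

lemma hs_sq_uminus: "hs_sq K e (- A) = hs_sq K e A"
  by (simp add: hs_sq_suminf blinfun.minus_left)

lemma hs_sq_diff_le: "hs_sq K e (A - B) \<le> 2 * hs_sq K e A + 2 * hs_sq K e B"
  using hs_sq_add_le[of K e A "- B"] by (simp add: hs_sq_uminus)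

lemma hs_sq_scaleR: "hs_sq K e (c *\<^sub>R A) = ennreal (c\<^sup>2) * hs_sq K e A"
proof -
  have "hs_sq K e (c *\<^sub>R A) = (\<Sum>k. ennreal (c\<^sup>2) * (ennreal ((norm (A (e k)))\<^sup>2) * indicator K k))"
    unfolding hs_sq_suminf
    by (simp add: blinfun.scaleR_left power_mult_distrib ennreal_mult mult.assoc)
  then show ?thesis by (simp add: hs_sq_suminf)
qed

lemma hs_sq_zero [simp]: "hs_sq K e 0 = 0"
  by (simp add: hs_sq_suminf)

text \<open>\<open>hs_norm\<close> passes through \<open>enn2real\<close>, which sends \<infinity>
  to 0, so the Lipschitz bound alone does not control \<open>hs_sq\<close>. Finiteness for the
  difference comes from that of the two operators.\<close>

lemma hs_sq_le_dist:
  assumes lip: "\<And>x y. hs_norm K e (\<sigma> x - \<sigma> y) \<le> L * dist x y"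
    and hs: "\<And>x. hilbert_schmidt K e (\<sigma> x)"
  shows "hs_sq K e (\<sigma> x - \<sigma> y) \<le> ennreal (L\<^sup>2 * (norm (x - y))\<^sup>2)"
proof -
  have "hs_sq K e (\<sigma> x - \<sigma> y) < \<top>"
    using hs[of x] hs[of y] unfolding hilbert_schmidt_def
    by (intro order.strict_trans1[OF hs_sq_diff_le]) (simp add: ennreal_mult_less_top)
  then obtain r where r: "hs_sq K e (\<sigma> x - \<sigma> y) = ennreal r" "r \<ge> 0"
    using less_top_ennreal by blast
  have "sqrt r \<le> L * dist x y"
    using lip[of x y] r by (simp add: hs_norm_def)
  then have "(sqrt r)\<^sup>2 \<le> (L * dist x y)\<^sup>2" using r(2) by (intro power_mono) auto
  then show ?thesis using r by (simp add: power_mult_distrib dist_norm ennreal_leI)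
qed

text \<open>Measurability is asked of the images of basis vectors, which lie in a separable space;
  the space of bounded operators is in general not separable.\<close>

lemma measurable_hs_sq:
  assumes "\<And>k. k \<in> K \<Longrightarrow> (\<lambda>x. blinfun_apply (\<Phi> x) (e k)) \<in> borel_measurable N"
  shows "(\<lambda>x. hs_sq K e (\<Phi> x)) \<in> borel_measurable N"
  unfolding hs_sq_suminf
proof (rule borel_measurable_suminf_order)
  fix k
  show "(\<lambda>x. ennreal ((norm (blinfun_apply (\<Phi> x) (e k)))\<^sup>2) * indicator K k) \<in> borel_measurable N"
    using assms[of k] by (cases "k \<in> K") simp_all
qed

lemma hs_sq_term_le:
  assumes "k \<in> K"
  shows "ennreal ((norm (blinfun_apply A (e k)))\<^sup>2) \<le> hs_sq K e A"
  using sum_le_suminf[of "\<lambda>k. ennreal ((norm (A (e k)))\<^sup>2) * indicator K k" "{k}"] assms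
  by (simp add: hs_sq_suminf)

lemma rank_one_apply [simp]: "rank_one h g x = (h \<bullet> x) *\<^sub>R g"
  by (simp add: rank_one_def)

lemma has_sum_finite_sum:
  assumes "\<And>i. i \<in> I \<Longrightarrow> (f i has_sum s i) A"
  shows "((\<lambda>k. \<Sum>i\<in>I. f i k) has_sum (\<Sum>i\<in>I. s i :: real)) A"
  using assms by (induction I rule: infinite_finite_induct) (auto intro!: has_sum_add)

text \<open>Expanding the squared norm at \<open>e k\<close> gives products
  \<open>(h i \<bullet> e k) * (h j \<bullet> e k)\<close>, and summing over k is Parseval's
  identity for inner products. The resulting finite double sum no longer mentions the basis, so it
  can be compared with the second moment of an elementary integral.\<close>

lemma hs_sq_sum_rank_one:
  assumes basis: "orthonormal_basis K e"
  shows "hs_sq K e (\<Sum>i\<in>I. c i *\<^sub>R rank_one (h i) (g i))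
    = ennreal (\<Sum>i\<in>I. \<Sum>j\<in>I. c i * c j * (h i \<bullet> h j) * (g i \<bullet> g j))"
    and "0 \<le> (\<Sum>i\<in>I. \<Sum>j\<in>I. c i * c j * (h i \<bullet> h j) * (g i \<bullet> g j))"
proof -
  let ?A = "\<Sum>i\<in>I. c i *\<^sub>R rank_one (h i) (g i)"
  have "((\<lambda>k. \<Sum>i\<in>I. \<Sum>j\<in>I. c i * c j * (g i \<bullet> g j) * ((h i \<bullet> e k) * (h j \<bullet> e k))) has_sum
      (\<Sum>i\<in>I. \<Sum>j\<in>I. c i * c j * (g i \<bullet> g j) * (h i \<bullet> h j))) K"
    by (intro has_sum_finite_sum has_sum_cmult_right parseval_inner_has_sum basis)
  moreover have "(\<Sum>i\<in>I. \<Sum>j\<in>I. c i * c j * (g i \<bullet> g j) * ((h i \<bullet> e k) * (h j \<bullet> e k)))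
      = (norm (?A (e k)))\<^sup>2" for k
    by (simp add: power2_norm_eq_inner blinfun.sum_left blinfun.scaleR_left inner_sum_left
        inner_sum_right sum_distrib_left mult_ac)
       (subst sum.swap, simp add: inner_commute mult_ac)
  ultimately have hs: "((\<lambda>k. (norm (?A (e k)))\<^sup>2) has_sum
      (\<Sum>i\<in>I. \<Sum>j\<in>I. c i * c j * (h i \<bullet> h j) * (g i \<bullet> g j))) K"
    by (simp add: mult_ac)
  then have "((\<lambda>k. (norm (?A (e k)))\<^sup>2 * indicator K k) has_sum
      (\<Sum>i\<in>I. \<Sum>j\<in>I. c i * c j * (h i \<bullet> h j) * (g i \<bullet> g j))) UNIV"
    by (subst has_sum_cong_neutral[where T = K]) (auto simp: indicator_def)
  then have "(\<lambda>k. (norm (?A (e k)))\<^sup>2 * indicator K k) sums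
      (\<Sum>i\<in>I. \<Sum>j\<in>I. c i * c j * (h i \<bullet> h j) * (g i \<bullet> g j))"
    by (rule has_sum_imp_sums)
  then have "(\<Sum>k. ennreal ((norm (?A (e k)))\<^sup>2 * indicator K k)) =
      ennreal (\<Sum>i\<in>I. \<Sum>j\<in>I. c i * c j * (h i \<bullet> h j) * (g i \<bullet> g j))"
    by (intro suminf_ennreal_eq) auto
  then show "hs_sq K e ?A
    = ennreal (\<Sum>i\<in>I. \<Sum>j\<in>I. c i * c j * (h i \<bullet> h j) * (g i \<bullet> g j))"
    unfolding hs_sq_suminf by (simp add: ennreal_mult ennreal_indicator)
  show "0 \<le> (\<Sum>i\<in>I. \<Sum>j\<in>I. c i * c j * (h i \<bullet> h j) * (g i \<bullet> g j))"
    using hs by (rule has_sum_nonneg) simp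
qed

lemma orth_proj_norm_le:
  assumes "is_orth_proj S P"
  shows "norm (blinfun_apply P x) \<le> norm x"
proof -
  have "(x - P x) \<bullet> P x = 0" using assms by (auto simp: is_orth_proj_def)
  then have "(norm x)\<^sup>2 = (norm (x - P x))\<^sup>2 + (norm (P x))\<^sup>2"
    using norm_add_Pythagorean[of "x - P x" "P x"] by (simp add: orthogonal_def)
  then have "(norm (P x))\<^sup>2 \<le> (norm x)\<^sup>2" by simp
  then show ?thesis by (rule power2_le_imp_le) simp
qed

section \<open>Increments of a cylindrical Wiener process\<close>

context filtered_prob_space
begin

lemma space_F_eq: "space (F t) = space M"
  using subalgebra_F by (simp add: subalgebra_def)

lemma measurable_F_M: "f \<in> measurable (F t) N \<Longrightarrow> f \<in> measurable M N"
  using subalgebra_F by (rule measurable_from_subalg)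

lemma measurable_F_mono: "f \<in> measurable (F s) N \<Longrightarrow> s \<le> t \<Longrightarrow> f \<in> measurable (F t) N"
  using sets_F_mono[of s t] by (auto simp: measurable_def space_F_eq)

lemma integrable_bounded:
  fixes f :: "'w \<Rightarrow> real"
  assumes "f \<in> borel_measurable M" "bounded (f ` space M)"
  shows "integrable M f"
proof -
  obtain B where "\<And>x. x \<in> space M \<Longrightarrow> norm (f x) \<le> B"
    using assms(2) by (auto simp: bounded_iff)
  then show ?thesis using assms(1) by (intro integrable_const_bound[of _ B]) auto
qed

lemma integrable_bounded_mult:
  fixes f g :: "'w \<Rightarrow> real"
  assumes "f \<in> borel_measurable M" "bounded (f ` space M)" "integrable M g"
  shows "integrable M (\<lambda>x. f x * g x)"
proof -
  obtain B where B: "B > 0" "\<And>x. x \<in> space M \<Longrightarrow> \<bar>f x\<bar> \<le> B"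
    using assms(2) by (auto simp: bounded_pos)
  show ?thesis
  proof (rule Bochner_Integration.integrable_bound)
    show "integrable M (\<lambda>x. B * g x)" using assms(3) by simp
    show "AE x in M. norm (f x * g x) \<le> norm (B * g x)"
      using B by (intro AE_I2) (auto simp: abs_mult intro!: mult_right_mono)
  qed (use assms in auto)
qed

end

lemma bounded_mult_image:
  fixes f g :: "'a \<Rightarrow> real"
  assumes "bounded (f ` A)" "bounded (g ` A)"
  shows "bounded ((\<lambda>x. f x * g x) ` A)"
proof -
  obtain a b where "a > 0" "\<And>x. x \<in> A \<Longrightarrow> \<bar>f x\<bar> \<le> a" "b > 0" "\<And>x. x \<in> A \<Longrightarrow> \<bar>g x\<bar> \<le> b"
    using assms by (auto simp: bounded_pos)
  then have "\<forall>x\<in>A. norm (f x * g x) \<le> a * b"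
    by (auto simp: abs_mult intro!: mult_mono)
  then show ?thesis unfolding bounded_iff by auto
qed

locale wiener_space = filtered_prob_space M F
  for M :: "'w measure" and F :: "real \<Rightarrow> 'w measure" +
  fixes W :: "real \<Rightarrow> 'h::{real_inner, banach, second_countable_topology} \<Rightarrow> 'w \<Rightarrow> real"
  assumes wiener: "cylindrical_wiener M F W"
begin

definition dW :: "real \<Rightarrow> real \<Rightarrow> 'h \<Rightarrow> 'w \<Rightarrow> real" where
  "dW s t h \<omega> = W t h \<omega> - W s h \<omega>"

lemma dW_add: "dW s t h \<omega> + dW t u h \<omega> = dW s u h \<omega>"
  by (simp add: dW_def)

lemma dW_same [simp]: "dW s s h \<omega> = 0"
  by (simp add: dW_def)

lemma measurable_dW_F:
  assumes "0 \<le> s" "s \<le> t" "t \<le> u"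
  shows "dW s t h \<in> borel_measurable (F u)"
proof -
  have "W r h \<in> borel_measurable (F u)" if "0 \<le> r" "r \<le> u" for r
    using wiener that measurable_F_mono[of "W r h" r borel u] by (auto simp: cylindrical_wiener_def)
  then show ?thesis using assms unfolding dW_def[abs_def] by (intro borel_measurable_diff) auto
qed

lemma measurable_dW: "0 \<le> s \<Longrightarrow> s \<le> t \<Longrightarrow> dW s t h \<in> borel_measurable M"
  using measurable_dW_F measurable_F_M by blast

text \<open>The exceptional null set may depend on the times, coefficients and directions, so
  linearity is only ever used for finitely many of them at once.\<close>

lemma dW_linear_AE:
  assumes "0 \<le> s" "s \<le> t"
  shows "AE \<omega> in M. dW s t (a *\<^sub>R g + b *\<^sub>R h) \<omega> = a * dW s t g \<omega> + b * dW s t h \<omega>"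
proof -
  have "AE \<omega> in M. W r (a *\<^sub>R g + b *\<^sub>R h) \<omega> = a * W r g \<omega> + b * W r h \<omega>" if "0 \<le> r" for r
    using that by (rule wiener[unfolded cylindrical_wiener_def, THEN conjunct2, THEN conjunct2, THEN conjunct2, THEN conjunct1, rule_format])
  from this[of s] this[of t] assms show ?thesis
    by (auto simp: dW_def algebra_simps)
qed

lemma dW_zero_AE: "0 \<le> s \<Longrightarrow> s \<le> t \<Longrightarrow> AE \<omega> in M. dW s t 0 \<omega> = 0"
  using dW_linear_AE[of s t 0 0 0 0] by simp

text \<open>For \<open>s < t\<close> and \<open>h \<noteq> 0\<close> these are the moments of a
  normal density. The degenerate case is separate because an increment that vanishes almost surely
  has no density.\<close>

lemma
  assumes "0 \<le> s" "s \<le> t"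
  shows integrable_dW: "integrable M (dW s t h)"
    and expectation_dW: "expectation (dW s t h) = 0"
    and integrable_dW_sq: "integrable M (\<lambda>\<omega>. (dW s t h \<omega>)\<^sup>2)"
    and expectation_dW_sq: "expectation (\<lambda>\<omega>. (dW s t h \<omega>)\<^sup>2) = (t - s) * (norm h)\<^sup>2"
proof -
  have "integrable M (dW s t h) \<and> expectation (dW s t h) = 0 \<and>
    integrable M (\<lambda>\<omega>. (dW s t h \<omega>)\<^sup>2) \<and>
    expectation (\<lambda>\<omega>. (dW s t h \<omega>)\<^sup>2) = (t - s) * (norm h)\<^sup>2"
  proof (cases "s = t \<or> h = 0")
    case True
    then have z: "AE \<omega> in M. dW s t h \<omega> = 0" using assms dW_zero_AE by auto
    have m: "dW s t h \<in> borel_measurable M" using assms by (rule measurable_dW)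
    have 1: "integrable M (dW s t h) \<longleftrightarrow> integrable M (\<lambda>_. 0::real)"
      using z m by (intro integrable_cong_AE) auto
    have 2: "expectation (dW s t h) = expectation (\<lambda>_. 0::real)"
      using z m by (intro integral_cong_AE) auto
    have 3: "integrable M (\<lambda>\<omega>. (dW s t h \<omega>)\<^sup>2) \<longleftrightarrow> integrable M (\<lambda>_. 0::real)"
      using z m by (intro integrable_cong_AE) auto
    have 4: "expectation (\<lambda>\<omega>. (dW s t h \<omega>)\<^sup>2) = expectation (\<lambda>_. 0::real)"
      using z m by (intro integral_cong_AE) auto
    show ?thesis using 1 2 3 4 True by auto
  next
    case False
    then have st: "s < t" "h \<noteq> 0" using assms by auto
    let ?\<sigma> = "norm h * sqrt (t - s)"
    have \<sigma>: "?\<sigma> > 0" using st by simp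
    have D: "distributed M lborel (dW s t h) (normal_density 0 ?\<sigma>)"
      unfolding dW_def[abs_def]
      by (rule wiener[unfolded cylindrical_wiener_def, THEN conjunct2, THEN conjunct2, THEN conjunct2, THEN conjunct2, THEN conjunct1, rule_format, OF assms(1) st])
    have i1: "integrable M (dW s t h)"
      using integrable_normal_moment[OF \<sigma>, of 0 1]
      by (intro distributed_integrable_var[OF D]) auto
    have e1: "expectation (dW s t h) = 0"
      by (rule normal_distributed_expectation[OF \<sigma> D])
    have i2: "integrable M (\<lambda>\<omega>. (dW s t h \<omega>)\<^sup>2)"
      using integrable_normal_moment[OF \<sigma>, of 0 2]
      by (subst distributed_integrable[OF D, of "\<lambda>x. x\<^sup>2", symmetric]) auto
    have "variance (dW s t h) = ?\<sigma>\<^sup>2"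
      by (rule normal_distributed_variance[OF \<sigma> D])
    then have "expectation (\<lambda>\<omega>. (dW s t h \<omega>)\<^sup>2) = (t - s) * (norm h)\<^sup>2"
      using e1 st by (simp add: power_mult_distrib)
    then show ?thesis using i1 e1 i2 by blast
  qed
  then show "integrable M (dW s t h)" "expectation (dW s t h) = 0"
    "integrable M (\<lambda>\<omega>. (dW s t h \<omega>)\<^sup>2)"
    "expectation (\<lambda>\<omega>. (dW s t h \<omega>)\<^sup>2) = (t - s) * (norm h)\<^sup>2" by auto
qed

text \<open>The \<sigma>-algebra generated by \<open>G\<close> lies in \<open>F s\<close>, so the
  independence of \<open>F s\<close> from the increment passes to \<open>G\<close>.\<close>

lemma indep_var_dW:
  assumes st: "0 \<le> s" "s < t" and G: "G \<in> borel_measurable (F s)"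
  shows "indep_var borel (G :: 'w \<Rightarrow> real) borel (dW s t h)"
proof -
  have I: "indep_set (sets (F s)) (sets (vimage_algebra (space M) (dW s t h) borel))"
    unfolding dW_def[abs_def]
    by (rule wiener[unfolded cylindrical_wiener_def, THEN conjunct2, THEN conjunct2, THEN conjunct2, THEN conjunct2, THEN conjunct2, rule_format, OF st])
  have 1: "sigma_sets (space M) {G -` A \<inter> space M |A. A \<in> sets borel} \<subseteq> sets (F s)"
    using G sets.sigma_sets_subset[of "{G -` A \<inter> space M |A. A \<in> sets borel}" "F s"]
    by (auto simp: space_F_eq measurable_def)
  have 2: "sigma_sets (space M) {dW s t h -` A \<inter> space M |A. A \<in> sets borel}
      = sets (vimage_algebra (space M) (dW s t h) borel)"
    by (simp add: sets_vimage_algebra)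
  show ?thesis
    unfolding indep_var_eq 2 using I 1 G st
    by (auto simp: indep_sets2_eq intro: measurable_F_M measurable_dW)
qed

text \<open>Independence factors the expectations and also yields integrability of the products, so
  \<open>G\<close> may be unbounded. This matters because \<open>G\<close> is later itself a
  coefficient times an earlier increment.\<close>

lemma
  assumes st: "0 \<le> s" "s \<le> t" and G: "G \<in> borel_measurable (F s)" "integrable M G"
  shows integrable_mult_dW: "integrable M (\<lambda>\<omega>. G \<omega> * dW s t h \<omega>)"
    and expectation_mult_dW: "expectation (\<lambda>\<omega>. G \<omega> * dW s t h \<omega>) = 0"
    and integrable_mult_dW_sq: "integrable M (\<lambda>\<omega>. G \<omega> * (dW s t h \<omega>)\<^sup>2)"
    and expectation_mult_dW_sq:
      "expectation (\<lambda>\<omega>. G \<omega> * (dW s t h \<omega>)\<^sup>2) = expectation G * ((t - s) * (norm h)\<^sup>2)"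
proof -
  have "integrable M (\<lambda>\<omega>. G \<omega> * dW s t h \<omega>) \<and> expectation (\<lambda>\<omega>. G \<omega> * dW s t h \<omega>) = 0 \<and>
    integrable M (\<lambda>\<omega>. G \<omega> * (dW s t h \<omega>)\<^sup>2) \<and>
    expectation (\<lambda>\<omega>. G \<omega> * (dW s t h \<omega>)\<^sup>2) = expectation G * ((t - s) * (norm h)\<^sup>2)"
  proof (cases "s = t")
    case False
    then have st': "0 \<le> s" "s < t" using st by auto
    have i1: "indep_var borel G borel (dW s t h)" using st' G(1) by (rule indep_var_dW)
    have i2: "indep_var borel G borel (\<lambda>\<omega>. (dW s t h \<omega>)\<^sup>2)"
      using indep_var_compose[OF i1, of id borel "\<lambda>x. x\<^sup>2" borel] by (simp add: o_def)
    show ?thesis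
      using indep_var_integrable[OF i1 G(2) integrable_dW[OF st]]
        indep_var_lebesgue_integral[OF i1 G(2) integrable_dW[OF st]]
        indep_var_integrable[OF i2 G(2) integrable_dW_sq[OF st]]
        indep_var_lebesgue_integral[OF i2 G(2) integrable_dW_sq[OF st]]
        expectation_dW[OF st] expectation_dW_sq[OF st] by simp
  qed simp
  then show "integrable M (\<lambda>\<omega>. G \<omega> * dW s t h \<omega>)" "expectation (\<lambda>\<omega>. G \<omega> * dW s t h \<omega>) = 0"
    "integrable M (\<lambda>\<omega>. G \<omega> * (dW s t h \<omega>)\<^sup>2)"
    "expectation (\<lambda>\<omega>. G \<omega> * (dW s t h \<omega>)\<^sup>2) = expectation G * ((t - s) * (norm h)\<^sup>2)" by auto
qed

text \<open>Independence from the past is postulated for the increment in one direction at a time,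
  not jointly for two. The mixed product is therefore obtained by polarization from the directions
  \<open>g + h\<close> and \<open>g - h\<close>, using linearity almost surely.\<close>

lemma has_integral_mult_dW_dW:
  assumes st: "0 \<le> s" "s \<le> t" and G: "G \<in> borel_measurable (F s)" "integrable M G"
  shows "has_bochner_integral M (\<lambda>\<omega>. G \<omega> * dW s t g \<omega> * dW s t h \<omega>)
    (expectation G * ((t - s) * (g \<bullet> h)))"
proof -
  have hb: "has_bochner_integral M (\<lambda>\<omega>. G \<omega> * (dW s t h \<omega>)\<^sup>2) (expectation G * ((t - s) * (norm h)\<^sup>2))" for h
    using integrable_mult_dW_sq[OF st G, of h] expectation_mult_dW_sq[OF st G, of h]
    by (simp add: has_bochner_integral_iff)
  have [measurable]: "dW s t h \<in> borel_measurable M" for h using st by (rule measurable_dW)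
  have [measurable]: "G \<in> borel_measurable M" using G by auto
  have hb4: "has_bochner_integral M
     (\<lambda>\<omega>. (G \<omega> * (dW s t (g + h) \<omega>)\<^sup>2 - G \<omega> * (dW s t (g - h) \<omega>)\<^sup>2) / 4)
     ((expectation G * ((t - s) * (norm (g + h))\<^sup>2) - expectation G * ((t - s) * (norm (g - h))\<^sup>2)) / 4)"
    by (intro has_bochner_integral_divide_zero has_bochner_integral_diff hb)
  have eq: "(expectation G * ((t - s) * (norm (g + h))\<^sup>2) - expectation G * ((t - s) * (norm (g - h))\<^sup>2)) / 4
     = expectation G * ((t - s) * (g \<bullet> h))"
  proof -
    have "(norm (g + h))\<^sup>2 - (norm (g - h))\<^sup>2 = 4 * (g \<bullet> h)"
      by (simp add: power2_norm_eq_inner algebra_simps inner_commute)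
    then show ?thesis by (simp add: right_diff_distrib[symmetric])
  qed
  have "AE \<omega> in M. dW s t (g + h) \<omega> = dW s t g \<omega> + dW s t h \<omega>"
    "AE \<omega> in M. dW s t (g - h) \<omega> = dW s t g \<omega> - dW s t h \<omega>"
    using dW_linear_AE[OF st, of 1 g 1 h] dW_linear_AE[OF st, of 1 g "-1" h] by auto
  then have "AE \<omega> in M. (G \<omega> * (dW s t (g + h) \<omega>)\<^sup>2 - G \<omega> * (dW s t (g - h) \<omega>)\<^sup>2) / 4
      = G \<omega> * dW s t g \<omega> * dW s t h \<omega>"
  proof eventually_elim
    case (elim \<omega>)
    show ?case unfolding elim by (simp add: power2_eq_square algebra_simps)
  qed
  then show ?thesis
    using hb4 unfolding eq
    by (subst (asm) has_bochner_integral_cong_AE) auto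
qed

text \<open>The longer increment is cut where the shorter one ends; the remainder has mean zero
  against everything known by then.\<close>

lemma has_integral_mult_dW_dW_start:
  assumes st: "0 \<le> s" "s \<le> x" "s \<le> y" and G: "G \<in> borel_measurable (F s)" "integrable M G"
  shows "has_bochner_integral M (\<lambda>\<omega>. G \<omega> * dW s x g \<omega> * dW s y h \<omega>)
    (expectation G * ((min x y - s) * (g \<bullet> h)))"
proof -
  have le: "has_bochner_integral M (\<lambda>\<omega>. G \<omega> * dW s x g \<omega> * dW s y h \<omega>)
    (expectation G * ((x - s) * (g \<bullet> h)))" if x: "s \<le> x" "x \<le> y" for x y g h
  proof -
    have m: "(\<lambda>\<omega>. G \<omega> * dW s x g \<omega>) \<in> borel_measurable (F x)"
      using st x G by (intro borel_measurable_times measurable_dW_F measurable_F_mono[OF G(1)]) auto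
    have i: "integrable M (\<lambda>\<omega>. G \<omega> * dW s x g \<omega>)"
      using st x G by (intro integrable_mult_dW) auto
    have "has_bochner_integral M (\<lambda>\<omega>. G \<omega> * dW s x g \<omega> * dW x y h \<omega>) 0"
      using integrable_mult_dW[OF _ _ m i, of y h] expectation_mult_dW[OF _ _ m i, of y h] st x
      by (simp add: has_bochner_integral_iff)
    from has_bochner_integral_add[OF has_integral_mult_dW_dW[OF st(1) x(1) G, of g h] this]
    show ?thesis by (simp add: distrib_left[symmetric] dW_add)
  qed
  show ?thesis
  proof (cases "x \<le> y")
    case True
    then show ?thesis using le[OF st(2) True] by (simp add: min_def)
  next
    case False
    then show ?thesis using le[OF st(3), of x h g] by (simp add: min_def inner_commute mult_ac)
  qed
qed

text \<open>The interval that starts earlier is cut at \<open>a'\<close>. Its first part is known at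
  time \<open>a'\<close> and pairs to zero with the later increment; its second part starts together
  with the other interval.\<close>

lemma has_integral_mult_dW_cross:
  assumes ab: "0 \<le> a" "a \<le> b" "a \<le> a'" "a' \<le> b'"
    and G: "G \<in> borel_measurable (F a')" "bounded (G ` space M)"
  shows "has_bochner_integral M (\<lambda>\<omega>. G \<omega> * dW a b g \<omega> * dW a' b' h \<omega>)
    (expectation G * (max 0 (min b b' - a') * (g \<bullet> h)))"
proof -
  have GM: "G \<in> borel_measurable M" using G(1) by (rule measurable_F_M)
  have Gi: "integrable M G" using GM G(2) by (rule integrable_bounded)
  \<comment> \<open>Used with \<open>c = b\<close> when the first interval ends before the second
    begins, and with \<open>c = a'\<close> for the part before the overlap.\<close>
  have zero: "has_bochner_integral M (\<lambda>\<omega>. G \<omega> * dW a c g \<omega> * dW a' b' h \<omega>) 0"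
    if c: "a \<le> c" "c \<le> a'" for c
  proof -
    have m: "(\<lambda>\<omega>. G \<omega> * dW a c g \<omega>) \<in> borel_measurable (F a')"
      using ab c G by (intro borel_measurable_times measurable_dW_F) auto
    have i: "integrable M (\<lambda>\<omega>. G \<omega> * dW a c g \<omega>)"
      using ab c GM G by (intro integrable_bounded_mult integrable_dW) auto
    show ?thesis
      using integrable_mult_dW[OF _ _ m i, of b' h] expectation_mult_dW[OF _ _ m i, of b' h] ab
      by (simp add: has_bochner_integral_iff)
  qed
  show ?thesis
  proof (cases "b \<le> a'")
    case True
    then have "max 0 (min b b' - a') = 0" by (simp add: max_def)
    then show ?thesis using zero[of b] True ab by simp
  next
    case False
    have "has_bochner_integral M (\<lambda>\<omega>. G \<omega> * dW a' b g \<omega> * dW a' b' h \<omega>)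
      (expectation G * ((min b b' - a') * (g \<bullet> h)))"
      using False ab G Gi by (intro has_integral_mult_dW_dW_start) auto
    from has_bochner_integral_add[OF zero[of a'] this]
    have "has_bochner_integral M (\<lambda>\<omega>. G \<omega> * dW a a' g \<omega> * dW a' b' h \<omega> + G \<omega> * dW a' b g \<omega> * dW a' b' h \<omega>)
      (expectation G * ((min b b' - a') * (g \<bullet> h)))" using ab by simp
    moreover have "G \<omega> * dW a a' g \<omega> * dW a' b' h \<omega> + G \<omega> * dW a' b g \<omega> * dW a' b' h \<omega>
      = G \<omega> * dW a b g \<omega> * dW a' b' h \<omega>" for \<omega>
      by (simp add: distrib_left[symmetric] distrib_right[symmetric] dW_add)
    ultimately show ?thesis using False ab by (simp add: max_def min_def)
  qed
qed

text \<open>The factor \<open>max 0 (...)\<close> is the length of the common part of both intervals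
  up to time t. The product of the coefficients is measurable at the later starting time, which is
  why the cases are split by that order; a term that starts after t has both truncated ends equal to
  t and vanishes.\<close>

lemma has_integral_term_product:
  assumes t: "0 \<le> t" and s: "0 \<le> s" "s \<le> u" and s': "0 \<le> s'" "s' \<le> u'"
    and \<xi>: "\<xi> \<in> borel_measurable (F s)" "bounded (\<xi> ` space M)"
    and \<xi>': "\<xi>' \<in> borel_measurable (F s')" "bounded (\<xi>' ` space M)"
  shows "has_bochner_integral M
    (\<lambda>\<omega>. (\<xi> \<omega> * dW (min s t) (min u t) g \<omega>) * (\<xi>' \<omega> * dW (min s' t) (min u' t) h \<omega>))
    (expectation (\<lambda>\<omega>. \<xi> \<omega> * \<xi>' \<omega>) * (max 0 (min (min u u') t - max s s') * (g \<bullet> h)))"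
proof (cases "s > t \<or> s' > t")
  case True
  then have "dW (min s t) (min u t) g \<omega> = 0 \<or> dW (min s' t) (min u' t) h \<omega> = 0" for \<omega>
    using s s' by (auto simp: min_def)
  then have z: "(\<xi> \<omega> * dW (min s t) (min u t) g \<omega>) * (\<xi>' \<omega> * dW (min s' t) (min u' t) h \<omega>) = 0" for \<omega>
    by (metis mult_zero_left mult_zero_right)
  have "max 0 (min (min u u') t - max s s') = 0" using True by auto
  then show ?thesis unfolding z by (simp add: has_bochner_integral_zero)
next
  case False
  then have eq: "min s t = s" "min s' t = s'" by auto
  have bd: "bounded ((\<lambda>\<omega>. \<xi> \<omega> * \<xi>' \<omega>) ` space M)" using \<xi> \<xi>' by (intro bounded_mult_image)
  have *: "has_bochner_integral M
    (\<lambda>\<omega>. \<xi> \<omega> * \<xi>' \<omega> * dW s (min u t) g \<omega> * dW s' (min u' t) h \<omega>)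
    (expectation (\<lambda>\<omega>. \<xi> \<omega> * \<xi>' \<omega>) * (max 0 (min (min u t) (min u' t) - s') * (g \<bullet> h)))"
    if "s \<le> s'" "0 \<le> s" "s \<le> u" "s' \<le> u'" "s' \<le> t"
     "\<xi> \<in> borel_measurable (F s)" "\<xi>' \<in> borel_measurable (F s')" "bounded ((\<lambda>\<omega>. \<xi> \<omega> * \<xi>' \<omega>) ` space M)"
    for s s' u u' g h \<xi> \<xi>'
  proof (rule has_integral_mult_dW_cross)
    show "(\<lambda>\<omega>. \<xi> \<omega> * \<xi>' \<omega>) \<in> borel_measurable (F s')"
      using that by (intro borel_measurable_times measurable_F_mono[OF that(6)]) auto
  qed (use that in auto)
  show ?thesis
  proof (cases "s \<le> s'")
    case True
    have mm: "min (min u u') t - max s s' = min (min u t) (min u' t) - s'"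
      using True by auto
    have "has_bochner_integral M
      (\<lambda>\<omega>. \<xi> \<omega> * \<xi>' \<omega> * dW s (min u t) g \<omega> * dW s' (min u' t) h \<omega>)
      (expectation (\<lambda>\<omega>. \<xi> \<omega> * \<xi>' \<omega>) * (max 0 (min (min u t) (min u' t) - s') * (g \<bullet> h)))"
      by (rule *) (use True False s s' \<xi> \<xi>' bd in auto)
    then show ?thesis unfolding eq mm by (simp only: mult_ac)
  next
    case c: False
    have mm: "min (min u u') t - max s s' = min (min u' t) (min u t) - s"
      using c by auto
    have "has_bochner_integral M
      (\<lambda>\<omega>. \<xi>' \<omega> * \<xi> \<omega> * dW s' (min u' t) h \<omega> * dW s (min u t) g \<omega>)
      (expectation (\<lambda>\<omega>. \<xi>' \<omega> * \<xi> \<omega>) * (max 0 (min (min u' t) (min u t) - s) * (h \<bullet> g)))"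
      by (rule *) (use c False s s' \<xi> \<xi>' bd in \<open>auto simp: mult.commute\<close>)
    then show ?thesis unfolding eq mm by (simp only: mult_ac inner_commute)
  qed
qed

end

section \<open>Integrals of elementary processes\<close>

text \<open>
  The pathwise form of Doob's inequality. When \<open>x\<close> is a path of a martingale, the sum on the right
  is a martingale transform and has mean zero.
\<close>

lemma max_norm_sq_le_martingale_transform:
  fixes x :: "nat \<Rightarrow> 'a::real_inner"
  defines "m \<equiv> \<lambda>k. Max ((\<lambda>j. norm (x j)) ` {..k})"
  shows "(m N)\<^sup>2 \<le> 4 * (norm (x N))\<^sup>2 - 4 * (\<Sum>j<N. (m j *\<^sub>R sgn (x j)) \<bullet> (x (Suc j) - x j))"
proof -
  have m_Suc: "m (Suc k) = max (norm (x (Suc k))) (m k)" for k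
    by (simp add: m_def atMost_Suc)
  have m_ge: "norm (x k) \<le> m k" for k by (simp add: m_def)
  then have m_nn: "0 \<le> m k" for k using norm_ge_zero order.trans by blast
  \<comment> \<open>The vector \<open>sgn (x k)\<close> is a subgradient of the norm at
    \<open>x k\<close>; at the origin this remains true because \<open>sgn 0 = 0\<close>.\<close>
  have step: "(m k *\<^sub>R sgn (x k)) \<bullet> (x (Suc k) - x k) \<le> m k * (norm (x (Suc k)) - norm (x k))" for k
  proof -
    have "sgn (x k) \<bullet> x k = norm (x k)"
      by (cases "x k = 0") (simp_all add: sgn_div_norm power2_norm_eq_inner[symmetric] power2_eq_square)
    moreover have "sgn (x k) \<bullet> x (Suc k) \<le> norm (x (Suc k))"
      using norm_cauchy_schwarz[of "sgn (x k)" "x (Suc k)"] by (cases "x k = 0") (simp_all add: norm_sgn)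
    ultimately have "sgn (x k) \<bullet> (x (Suc k) - x k) \<le> norm (x (Suc k)) - norm (x k)"
      by (simp add: inner_diff_right)
    then show ?thesis using m_nn[of k] by (simp add: mult_left_mono)
  qed
  \<comment> \<open>This invariant survives a new maximum: there the norm equals the maximum, and
    the right-hand side grows by twice the square of the jump.\<close>
  have "4 * (\<Sum>j<k. (m j *\<^sub>R sgn (x j)) \<bullet> (x (Suc j) - x j)) \<le> 4 * (m k * norm (x k)) - 2 * (m k)\<^sup>2" for k
  proof (induction k)
    case 0
    show ?case by (simp add: m_def power2_eq_square)
  next
    case (Suc k)
    let ?S = "\<lambda>k. \<Sum>j<k. (m j *\<^sub>R sgn (x j)) \<bullet> (x (Suc j) - x j)"
    have "4 * ?S (Suc k) \<le> 4 * (m k * norm (x k)) - 2 * (m k)\<^sup>2 + 4 * (m k * (norm (x (Suc k)) - norm (x k)))"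
      using Suc.IH step[of k] by simp
    also have "\<dots> = 4 * (m k * norm (x (Suc k))) - 2 * (m k)\<^sup>2" by (simp add: algebra_simps)
    also have "\<dots> \<le> 4 * (m (Suc k) * norm (x (Suc k))) - 2 * (m (Suc k))\<^sup>2"
    proof (cases "norm (x (Suc k)) \<le> m k")
      case True
      then show ?thesis by (simp add: m_Suc max_def)
    next
      case False
      then have eq: "m (Suc k) = norm (x (Suc k))" by (simp add: m_Suc)
      have "0 \<le> 2 * (norm (x (Suc k)) - m k)\<^sup>2" by simp
      then show ?thesis unfolding eq by (simp add: power2_eq_square algebra_simps)
    qed
    finally show ?case .
  qed
  from this[of N] have "4 * (\<Sum>j<N. (m j *\<^sub>R sgn (x j)) \<bullet> (x (Suc j) - x j)) + (m N)\<^sup>2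
      \<le> 4 * (m N * norm (x N)) - (m N)\<^sup>2" by simp
  \<comment> \<open>Completing the square in the maximum gives the constant 4 of Doob's
    inequality.\<close>
  also have "\<dots> \<le> 4 * (norm (x N))\<^sup>2"
  proof -
    have "0 \<le> (m N - 2 * norm (x N))\<^sup>2" by simp
    then show ?thesis by (simp add: power2_eq_square algebra_simps)
  qed
  finally show ?thesis by simp
qed

lemma has_bochner_integral_nn_integral_eq:
  fixes f :: "'a \<Rightarrow> real"
  assumes "has_bochner_integral M f v" "\<And>x. 0 \<le> f x"
  shows "(\<integral>\<^sup>+x. ennreal (f x) \<partial>M) = ennreal v"
  using nn_integral_eq_integral[of M f] assms by (auto simp: has_bochner_integral_iff)

text \<open>The Lebesgue counterpart of the product formula for increments: the same overlap length
  appears, which is what makes the isometry hold term by term.\<close>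

lemma has_integral_indicator_product:
  fixes s s' t :: real
  assumes "0 \<le> s" "0 \<le> s'"
  shows "has_bochner_integral lborel
    (\<lambda>r. indicator {s<..u} r * indicator {s'<..u'} r * indicator {0..t} r * c)
    (max 0 (min (min u u') t - max s s') * c)"
proof -
  have eq: "indicator {s<..u} r * indicator {s'<..u'} r * indicator {0..t} r =
      (indicator {max s s'<..min (min u u') t} r :: real)" for r
    using assms by (auto simp: indicator_def)
  have "measure lborel {a<..b} = max 0 (b - a)" for a b :: real
    by (cases "a \<le> b") (auto simp: max_def)
  moreover have "emeasure lborel {a<..b} < \<infinity>" for a b :: real
    by (cases "a \<le> b") auto
  then have "has_bochner_integral lborel (\<lambda>r. indicator {max s s'<..min (min u u') t} r * c)
     (measure lborel {max s s'<..min (min u u') t} * c)"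
    by (intro has_bochner_integral_mult_left has_bochner_integral_real_indicator) simp_all
  ultimately show ?thesis unfolding eq by simp
qed

text \<open>Access by index turns the list sums into sums over \<open>{..<length \<phi>}\<close>, so
  that their squares become double sums over pairs of indices.\<close>

definition elem_s :: "('w, 'h) elem \<Rightarrow> nat \<Rightarrow> real" where "elem_s \<phi> i = fst (\<phi> ! i)"
definition elem_u :: "('w, 'h) elem \<Rightarrow> nat \<Rightarrow> real" where "elem_u \<phi> i = fst (snd (\<phi> ! i))"
definition elem_x :: "('w, 'h) elem \<Rightarrow> nat \<Rightarrow> 'w \<Rightarrow> real" where "elem_x \<phi> i = fst (snd (snd (\<phi> ! i)))"
definition elem_h :: "('w, 'h) elem \<Rightarrow> nat \<Rightarrow> 'h" where "elem_h \<phi> i = fst (snd (snd (snd (\<phi> ! i))))"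
definition elem_g :: "('w, 'h) elem \<Rightarrow> nat \<Rightarrow> 'h" where "elem_g \<phi> i = snd (snd (snd (snd (\<phi> ! i))))"

lemmas elem_defs = elem_s_def elem_u_def elem_x_def elem_h_def elem_g_def

lemma elem_process_eq_sum:
  "elem_process \<phi> r \<omega> = (\<Sum>i<length \<phi>.
     (indicator {elem_s \<phi> i<..elem_u \<phi> i} r * elem_x \<phi> i \<omega>) *\<^sub>R rank_one (elem_h \<phi> i) (elem_g \<phi> i))"
  unfolding elem_process_def sum_list_sum_nth elem_defs
  by (auto simp: case_prod_unfold atLeast0LessThan)

context wiener_space
begin

lemma elementaryD:
  assumes "elementary F \<phi>" "i < length \<phi>"
  shows "0 \<le> elem_s \<phi> i" "elem_s \<phi> i \<le> elem_u \<phi> i"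
    "elem_x \<phi> i \<in> borel_measurable (F (elem_s \<phi> i))" "bounded (elem_x \<phi> i ` space M)"
  using assms nth_mem[OF assms(2)] unfolding elementary_def elem_defs space_F_eq
  by (auto simp: case_prod_unfold)

lemma elem_integral_eq_sum:
  "elem_integral W \<phi> t \<omega> = (\<Sum>i<length \<phi>.
     (elem_x \<phi> i \<omega> * dW (min (elem_s \<phi> i) t) (min (elem_u \<phi> i) t) (elem_h \<phi> i) \<omega>) *\<^sub>R elem_g \<phi> i)"
  unfolding elem_integral_def sum_list_sum_nth elem_defs dW_def
  by (auto simp: case_prod_unfold atLeast0LessThan)

lemma measurable_elem_integral_F:
  assumes \<phi>: "elementary F \<phi>" and t: "0 \<le> t"
  shows "elem_integral W \<phi> t \<in> borel_measurable (F t)"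
proof -
  have "(\<lambda>\<omega>. elem_x \<phi> i \<omega> * dW (min (elem_s \<phi> i) t) (min (elem_u \<phi> i) t) (elem_h \<phi> i) \<omega>)
      \<in> borel_measurable (F t)" if i: "i < length \<phi>" for i
  proof (cases "elem_s \<phi> i \<le> t")
    case True
    with elementaryD[OF \<phi> i] t show ?thesis
      by (intro borel_measurable_times measurable_dW_F measurable_F_mono[OF elementaryD(3)[OF \<phi> i]]) auto
  next
    \<comment> \<open>The term starts after t, so its coefficient need not be
      \<open>F t\<close>-measurable; truncation makes both ends of the increment equal and the term
      zero.\<close>
    case False
    then have "min (elem_s \<phi> i) t = t" "min (elem_u \<phi> i) t = t"
      using elementaryD(2)[OF \<phi> i] by auto
    then show ?thesis by simp
  qed
  then show ?thesis
    unfolding elem_integral_eq_sum[abs_def]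
    by (intro borel_measurable_sum borel_measurable_scaleR borel_measurable_const) auto
qed

lemma measurable_elem_integral:
  "elementary F \<phi> \<Longrightarrow> 0 \<le> t \<Longrightarrow> elem_integral W \<phi> t \<in> borel_measurable M"
  using measurable_elem_integral_F measurable_F_M by blast

section \<open>Isometry, martingale property and maximal inequality for elementary integrals\<close>

lemma has_integral_elem_integral_sq:
  assumes \<phi>: "elementary F \<phi>" and t: "0 \<le> t"
  shows "has_bochner_integral M (\<lambda>\<omega>. (norm (elem_integral W \<phi> t \<omega>))\<^sup>2)
    (\<Sum>i<length \<phi>. \<Sum>j<length \<phi>. expectation (\<lambda>\<omega>. elem_x \<phi> i \<omega> * elem_x \<phi> j \<omega>) *
      (max 0 (min (min (elem_u \<phi> i) (elem_u \<phi> j)) t - max (elem_s \<phi> i) (elem_s \<phi> j)) *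
        (elem_h \<phi> i \<bullet> elem_h \<phi> j)) * (elem_g \<phi> i \<bullet> elem_g \<phi> j))"
    (is "has_bochner_integral M _ ?V")
proof -
  let ?d = "\<lambda>i \<omega>. elem_x \<phi> i \<omega> * dW (min (elem_s \<phi> i) t) (min (elem_u \<phi> i) t) (elem_h \<phi> i) \<omega>"
  have "has_bochner_integral M (\<lambda>\<omega>. \<Sum>i<length \<phi>. \<Sum>j<length \<phi>.
      ?d i \<omega> * ?d j \<omega> * (elem_g \<phi> i \<bullet> elem_g \<phi> j)) ?V"
    by (intro has_bochner_integral_sum has_bochner_integral_mult_left has_integral_term_product)
       (use t elementaryD[OF \<phi>] in auto)
  moreover have "(\<Sum>i<length \<phi>. \<Sum>j<length \<phi>. ?d i \<omega> * ?d j \<omega> * (elem_g \<phi> i \<bullet> elem_g \<phi> j))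
      = (norm (elem_integral W \<phi> t \<omega>))\<^sup>2" for \<omega>
    unfolding elem_integral_eq_sum power2_norm_eq_inner inner_sum_left inner_sum_right
    by (subst sum.swap) (simp add: mult_ac inner_commute)
  ultimately show ?thesis by simp
qed

text \<open>Both sides expand to the same double sum \<open>V\<close>: the left by the expectations
  of products of increments, the right by the basis-free form of the Hilbert--Schmidt norm
  integrated over the overlaps of the time intervals.\<close>

lemma elem_integral_isometry:
  assumes \<phi>: "elementary F \<phi>" and t: "0 \<le> t" and basis: "orthonormal_basis K e"
  shows "(\<integral>\<^sup>+\<omega>. ennreal ((norm (elem_integral W \<phi> t \<omega>))\<^sup>2) \<partial>M) =
      (\<integral>\<^sup>+\<omega>. (\<integral>\<^sup>+r\<in>{0..t}. hs_sq K e (elem_process \<phi> r \<omega>) \<partial>lborel) \<partial>M)"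
proof -
  define s u x h g where "s = elem_s \<phi>" "u = elem_u \<phi>" "x = elem_x \<phi>" "h = elem_h \<phi>" "g = elem_g \<phi>"
  note D = elementaryD[OF \<phi>, folded s_u_x_h_g_def]
  define n where "n = length \<phi>"
  define l where "l i j = max 0 (min (min (u i) (u j)) t - max (s i) (s j))" for i j
  let ?S = "\<lambda>f. \<Sum>i<n. \<Sum>j<n. (f i j :: real)"
  define V where "V = ?S (\<lambda>i j. expectation (\<lambda>\<omega>. x i \<omega> * x j \<omega>) * (l i j * (h i \<bullet> h j)) * (g i \<bullet> g j))"
  have L: "has_bochner_integral M (\<lambda>\<omega>. (norm (elem_integral W \<phi> t \<omega>))\<^sup>2) V"
    unfolding V_def l_def s_u_x_h_g_def n_def by (rule has_integral_elem_integral_sq[OF \<phi> t])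
  have inner: "(\<integral>\<^sup>+r\<in>{0..t}. hs_sq K e (elem_process \<phi> r \<omega>) \<partial>lborel) =
      ennreal (?S (\<lambda>i j. x i \<omega> * x j \<omega> * (l i j * (h i \<bullet> h j)) * (g i \<bullet> g j)))"
    and nn: "0 \<le> ?S (\<lambda>i j. x i \<omega> * x j \<omega> * (l i j * (h i \<bullet> h j)) * (g i \<bullet> g j))" for \<omega>
  proof -
    let ?c = "\<lambda>i r. indicator {s i<..u i} r * x i \<omega>"
    let ?q = "\<lambda>r. ?S (\<lambda>i j. ?c i r * ?c j r * (h i \<bullet> h j) * (g i \<bullet> g j))"
    have hb: "has_bochner_integral lborel (\<lambda>r. ?S (\<lambda>i j. indicator {s i<..u i} r * indicator {s j<..u j} r *
          indicator {0..t} r * (x i \<omega> * x j \<omega> * (h i \<bullet> h j) * (g i \<bullet> g j))))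
        (?S (\<lambda>i j. l i j * (x i \<omega> * x j \<omega> * (h i \<bullet> h j) * (g i \<bullet> g j))))"
      unfolding l_def
      by (intro has_bochner_integral_sum has_integral_indicator_product) (use D in \<open>auto simp: n_def\<close>)
    have e1: "?S (\<lambda>i j. indicator {s i<..u i} r * indicator {s j<..u j} r *
          indicator {0..t} r * (x i \<omega> * x j \<omega> * (h i \<bullet> h j) * (g i \<bullet> g j))) = indicator {0..t} r * ?q r" for r :: real
      by (simp add: sum_distrib_left mult_ac)
    have e2: "?S (\<lambda>i j. l i j * (x i \<omega> * x j \<omega> * (h i \<bullet> h j) * (g i \<bullet> g j))) =
        ?S (\<lambda>i j. x i \<omega> * x j \<omega> * (l i j * (h i \<bullet> h j)) * (g i \<bullet> g j))"
      by (simp add: mult_ac)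
    have hs: "hs_sq K e (elem_process \<phi> r \<omega>) = ennreal (?q r)" "0 \<le> ?q r" for r
      unfolding elem_process_eq_sum s_u_x_h_g_def n_def
      by (auto intro!: hs_sq_sum_rank_one[OF basis])
    have "(\<integral>\<^sup>+r\<in>{0..t}. hs_sq K e (elem_process \<phi> r \<omega>) \<partial>lborel) =
        (\<integral>\<^sup>+r. ennreal (indicator {0..t} r * ?q r) \<partial>lborel)"
      unfolding hs(1) by (intro nn_integral_cong) (auto simp: indicator_def)
    also have "\<dots> = ennreal (?S (\<lambda>i j. l i j * (x i \<omega> * x j \<omega> * (h i \<bullet> h j) * (g i \<bullet> g j))))"
      using hb hs(2) unfolding e1 by (intro has_bochner_integral_nn_integral_eq) (auto simp: indicator_def)
    finally show "(\<integral>\<^sup>+r\<in>{0..t}. hs_sq K e (elem_process \<phi> r \<omega>) \<partial>lborel) =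
      ennreal (?S (\<lambda>i j. x i \<omega> * x j \<omega> * (l i j * (h i \<bullet> h j)) * (g i \<bullet> g j)))" unfolding e2 .
    \<comment> \<open>Nonnegativity is not visible from the signs of the summands; it is read off
      the integral of a nonnegative function.\<close>
    have "0 \<le> (\<integral>r. indicator {0..t} r * ?q r \<partial>lborel)"
      using hs(2) by (intro integral_nonneg_AE AE_I2) (auto simp: indicator_def)
    then show "0 \<le> ?S (\<lambda>i j. x i \<omega> * x j \<omega> * (l i j * (h i \<bullet> h j)) * (g i \<bullet> g j))"
      using hb unfolding e1 e2 by (simp add: has_bochner_integral_iff)
  qed
  have "integrable M (\<lambda>\<omega>. x i \<omega> * x j \<omega>)" if "i < n" "j < n" for i j
    using D that by (intro integrable_bounded bounded_mult_image borel_measurable_times)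
      (auto simp: n_def intro: measurable_F_M)
  then have R: "has_bochner_integral M
      (\<lambda>\<omega>. ?S (\<lambda>i j. x i \<omega> * x j \<omega> * (l i j * (h i \<bullet> h j)) * (g i \<bullet> g j))) V"
    unfolding V_def
    by (intro has_bochner_integral_sum has_bochner_integral_mult_left has_bochner_integral_integrable) auto
  show "(\<integral>\<^sup>+\<omega>. ennreal ((norm (elem_integral W \<phi> t \<omega>))\<^sup>2) \<partial>M) =
      (\<integral>\<^sup>+\<omega>. (\<integral>\<^sup>+r\<in>{0..t}. hs_sq K e (elem_process \<phi> r \<omega>) \<partial>lborel) \<partial>M)"
    unfolding inner
    using has_bochner_integral_nn_integral_eq[OF L] has_bochner_integral_nn_integral_eq[OF R nn] by simp
qed

text \<open>The martingale property in tested form, with vector-valued test variables known at time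
  r. This is exactly what is needed to discard the transform in the pathwise form of Doob's
  inequality.\<close>

lemma elem_integral_martingale:
  assumes \<phi>: "elementary F \<phi>" and rt: "0 \<le> r" "r \<le> t"
    and V: "V \<in> borel_measurable (F r)" "integrable M (\<lambda>\<omega>. (norm (V \<omega>))\<^sup>2)"
  shows "has_bochner_integral M (\<lambda>\<omega>. V \<omega> \<bullet> (elem_integral W \<phi> t \<omega> - elem_integral W \<phi> r \<omega>)) 0"
proof -
  define s u x h g where "s = elem_s \<phi>" "u = elem_u \<phi>" "x = elem_x \<phi>" "h = elem_h \<phi>" "g = elem_g \<phi>"
  note D = elementaryD[OF \<phi>, folded s_u_x_h_g_def]
  \<comment> \<open>The increment of a term between r and t is again an increment of
    \<open>W\<close>, over the interval with both ends clamped to \<open>[r, t]\<close>; hence it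
    starts no earlier than r.\<close>
  have incr: "dW (min (s i) t) (min (u i) t) (h i) \<omega> - dW (min (s i) r) (min (u i) r) (h i) \<omega>
      = dW (max r (min (s i) t)) (max r (min (u i) t)) (h i) \<omega>" for i \<omega>
    using rt by (auto simp: dW_def min_def max_def)
  have "has_bochner_integral M (\<lambda>\<omega>. \<Sum>i<length \<phi>. x i \<omega> * (V \<omega> \<bullet> g i) *
      dW (max r (min (s i) t)) (max r (min (u i) t)) (h i) \<omega>) (\<Sum>i<length \<phi>. 0)"
  proof (rule has_bochner_integral_sum)
    fix i assume "i \<in> {..<length \<phi>}"
    then have i: "i < length \<phi>" by simp
    have Vi: "integrable M (\<lambda>\<omega>. V \<omega> \<bullet> g i)"
    proof (rule Bochner_Integration.integrable_bound)
      show "integrable M (\<lambda>\<omega>. (1 + (norm (V \<omega>))\<^sup>2) * norm (g i))" using V(2) by simp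
      \<comment> \<open>Dominating the first power by one plus the square is crude but sufficient,
        as only integrability is wanted here.\<close>
      have "\<bar>V \<omega> \<bullet> g i\<bar> \<le> (1 + (norm (V \<omega>))\<^sup>2) * norm (g i)" for \<omega>
      proof -
        have "0 \<le> (norm (V \<omega>) - 1)\<^sup>2" by simp
        then have "norm (V \<omega>) \<le> 1 + (norm (V \<omega>))\<^sup>2"
          unfolding power2_diff by (simp) (smt (verit) norm_ge_zero)
        then show ?thesis
          by (intro order.trans[OF Cauchy_Schwarz_ineq2] mult_right_mono) auto
      qed
      then show "AE \<omega> in M. norm (V \<omega> \<bullet> g i) \<le> norm ((1 + (norm (V \<omega>))\<^sup>2) * norm (g i))"
        by (intro AE_I2) (simp add: abs_mult)
      show "(\<lambda>\<omega>. V \<omega> \<bullet> g i) \<in> borel_measurable M"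
        using measurable_F_M[OF V(1)] by simp
    qed
    show "has_bochner_integral M (\<lambda>\<omega>. x i \<omega> * (V \<omega> \<bullet> g i) *
      dW (max r (min (s i) t)) (max r (min (u i) t)) (h i) \<omega>) 0"
    proof (cases "s i \<le> t")
      case True
      let ?a = "max r (min (s i) t)" and ?b = "max r (min (u i) t)"
      have ab: "0 \<le> ?a" "?a \<le> ?b" using rt D(2)[OF i] by auto
      have m: "(\<lambda>\<omega>. x i \<omega> * (V \<omega> \<bullet> g i)) \<in> borel_measurable (F ?a)"
      proof (intro borel_measurable_times borel_measurable_inner borel_measurable_const)
        show "x i \<in> borel_measurable (F ?a)"
          by (rule measurable_F_mono[OF D(3)[OF i]]) (use True in auto)
        show "V \<in> borel_measurable (F ?a)" by (rule measurable_F_mono[OF V(1)]) auto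
      qed
      have ii: "integrable M (\<lambda>\<omega>. x i \<omega> * (V \<omega> \<bullet> g i))"
        using D[OF i] Vi by (intro integrable_bounded_mult) (auto intro: measurable_F_M)
      show ?thesis
        using integrable_mult_dW[OF ab m ii] expectation_mult_dW[OF ab m ii]
        by (simp add: has_bochner_integral_iff)
    next
      case False
      then have "max r (min (s i) t) = t" "max r (min (u i) t) = t" using rt D(2)[OF i] by auto
      then show ?thesis by (simp add: has_bochner_integral_zero)
    qed
  qed
  moreover have "(\<Sum>i<length \<phi>. x i \<omega> * (V \<omega> \<bullet> g i) *
      dW (max r (min (s i) t)) (max r (min (u i) t)) (h i) \<omega>)
      = V \<omega> \<bullet> (elem_integral W \<phi> t \<omega> - elem_integral W \<phi> r \<omega>)" for \<omega>
    unfolding incr[symmetric]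
    unfolding elem_integral_eq_sum sum_subtractf[symmetric] inner_sum_right s_u_x_h_g_def
    by (intro sum.cong refl) (simp add: inner_diff_right right_diff_distrib mult_ac)
  ultimately show ?thesis by simp
qed

text \<open>The pathwise inequality is integrated. The weight \<open>m j *\<^sub>R sgn (X j)\<close>
  is known at time \<open>t j\<close> and its norm is at most the running maximum, which is square
  integrable because its square is below a finite sum of squares; so every summand of the transform
  has mean zero.\<close>

lemma elem_integral_doob:
  assumes \<phi>: "elementary F \<phi>" and t: "0 \<le> t 0" "mono t"
  shows "(\<integral>\<^sup>+\<omega>. (SUP k\<in>{..N::nat}. ennreal ((norm (elem_integral W \<phi> (t k) \<omega>))\<^sup>2)) \<partial>M)
    \<le> 4 * (\<integral>\<^sup>+\<omega>. ennreal ((norm (elem_integral W \<phi> (t N) \<omega>))\<^sup>2) \<partial>M)"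
proof -
  define X where "X k \<omega> = elem_integral W \<phi> (t k) \<omega>" for k \<omega>
  define m where "m k \<omega> = Max ((\<lambda>j. norm (X j \<omega>)) ` {..k})" for k \<omega>
  have t_nn: "0 \<le> t k" for k using t monoD[OF t(2), of 0 k] by simp
  have X_F: "X j \<in> borel_measurable (F (t k))" if "j \<le> k" for j k
    unfolding X_def[abs_def]
    by (rule measurable_F_mono[OF measurable_elem_integral_F[OF \<phi> t_nn]]) (use that t monoD in auto)
  have m_F: "m k \<in> borel_measurable (F (t k))" for k
  proof -
    have "(\<lambda>\<omega>. norm (X j \<omega>)) \<in> borel_measurable (F (t k))" if "j \<le> k" for j
      using X_F[OF that] by simp
    then show ?thesis unfolding m_def[abs_def] by (intro borel_measurable_Max) auto
  qed
  have X2: "integrable M (\<lambda>\<omega>. (norm (X k \<omega>))\<^sup>2)" for k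
    unfolding X_def using has_integral_elem_integral_sq[OF \<phi> t_nn] by (rule integrable.intros)
  have m2: "integrable M (\<lambda>\<omega>. (m k \<omega>)\<^sup>2)" for k
  proof (rule Bochner_Integration.integrable_bound)
    show "integrable M (\<lambda>\<omega>. \<Sum>j\<le>k. (norm (X j \<omega>))\<^sup>2)" using X2 by auto
    have "(m k \<omega>)\<^sup>2 \<le> (\<Sum>j\<le>k. (norm (X j \<omega>))\<^sup>2)" for \<omega>
    proof -
      have "m k \<omega> \<in> (\<lambda>j. norm (X j \<omega>)) ` {..k}" unfolding m_def by (rule Max_in) auto
      then obtain j where "j \<le> k" "m k \<omega> = norm (X j \<omega>)" by auto
      then show ?thesis by (auto intro!: member_le_sum)
    qed
    then show "AE \<omega> in M. norm ((m k \<omega>)\<^sup>2) \<le> norm (\<Sum>j\<le>k. (norm (X j \<omega>))\<^sup>2)"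
      by (intro AE_I2) (simp add: abs_of_nonneg sum_nonneg)
    show "(\<lambda>\<omega>. (m k \<omega>)\<^sup>2) \<in> borel_measurable M"
      using measurable_F_M[OF m_F] by simp
  qed
  have V: "has_bochner_integral M (\<lambda>\<omega>. (m j \<omega> *\<^sub>R sgn (X j \<omega>)) \<bullet> (X (Suc j) \<omega> - X j \<omega>)) 0" for j
  proof -
    have "has_bochner_integral M (\<lambda>\<omega>. (m j \<omega> *\<^sub>R sgn (X j \<omega>)) \<bullet>
      (elem_integral W \<phi> (t (Suc j)) \<omega> - elem_integral W \<phi> (t j) \<omega>)) 0"
  proof (rule elem_integral_martingale[OF \<phi> t_nn])
    show "t j \<le> t (Suc j)" using t(2) by (simp add: monoD)
    show M: "(\<lambda>\<omega>. m j \<omega> *\<^sub>R sgn (X j \<omega>)) \<in> borel_measurable (F (t j))"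
      unfolding sgn_div_norm using m_F[of j] X_F[of j j] by simp
    show "integrable M (\<lambda>\<omega>. (norm (m j \<omega> *\<^sub>R sgn (X j \<omega>)))\<^sup>2)"
    proof (rule Bochner_Integration.integrable_bound[OF m2[of j]])
      show "AE \<omega> in M. norm ((norm (m j \<omega> *\<^sub>R sgn (X j \<omega>)))\<^sup>2) \<le> norm ((m j \<omega>)\<^sup>2)"
        by (intro AE_I2) (auto simp: norm_sgn power_mult_distrib)
      show "(\<lambda>\<omega>. (norm (m j \<omega> *\<^sub>R sgn (X j \<omega>)))\<^sup>2) \<in> borel_measurable M"
        using measurable_F_M[OF M] by (simp del: norm_scaleR)
    qed
  qed
  then show ?thesis unfolding X_def .
  qed
  have "expectation (\<lambda>\<omega>. (m N \<omega>)\<^sup>2) \<le> expectation (\<lambda>\<omega>. 4 * (norm (X N \<omega>))\<^sup>2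
      - 4 * (\<Sum>j<N. (m j \<omega> *\<^sub>R sgn (X j \<omega>)) \<bullet> (X (Suc j) \<omega> - X j \<omega>)))"
  proof (rule integral_mono)
    show "integrable M (\<lambda>\<omega>. 4 * (norm (X N \<omega>))\<^sup>2
      - 4 * (\<Sum>j<N. (m j \<omega> *\<^sub>R sgn (X j \<omega>)) \<bullet> (X (Suc j) \<omega> - X j \<omega>)))"
      using X2 V by (auto simp: has_bochner_integral_iff)
    show "(m N \<omega>)\<^sup>2 \<le> 4 * (norm (X N \<omega>))\<^sup>2
      - 4 * (\<Sum>j<N. (m j \<omega> *\<^sub>R sgn (X j \<omega>)) \<bullet> (X (Suc j) \<omega> - X j \<omega>))" for \<omega>
      unfolding m_def by (rule max_norm_sq_le_martingale_transform)
  qed (rule m2)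
  also have "\<dots> = 4 * expectation (\<lambda>\<omega>. (norm (X N \<omega>))\<^sup>2)"
    using X2 V by (simp add: has_bochner_integral_iff)
  finally have main: "expectation (\<lambda>\<omega>. (m N \<omega>)\<^sup>2) \<le> 4 * expectation (\<lambda>\<omega>. (norm (X N \<omega>))\<^sup>2)" .
  have "(\<integral>\<^sup>+\<omega>. (SUP k\<in>{..N}. ennreal ((norm (X k \<omega>))\<^sup>2)) \<partial>M) \<le> (\<integral>\<^sup>+\<omega>. ennreal ((m N \<omega>)\<^sup>2) \<partial>M)"
    by (intro nn_integral_mono SUP_least ennreal_leI power_mono) (auto simp: m_def)
  also have "\<dots> = ennreal (expectation (\<lambda>\<omega>. (m N \<omega>)\<^sup>2))"
    using m2 by (intro nn_integral_eq_integral) auto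
  also have "\<dots> \<le> ennreal (4 * expectation (\<lambda>\<omega>. (norm (X N \<omega>))\<^sup>2))" by (rule ennreal_leI[OF main])
  also have "\<dots> = 4 * (\<integral>\<^sup>+\<omega>. ennreal ((norm (X N \<omega>))\<^sup>2) \<partial>M)"
    using X2[of N] by (subst nn_integral_eq_integral) (auto simp: ennreal_mult)
  finally show ?thesis unfolding X_def .
qed

end

section \<open>Time integrals of expectations\<close>

text \<open>Times outside \<open>[0, T]\<close> are cut off in the measurable space itself, since
  progressive measurability constrains a process only there.\<close>

definition jointly_measurable :: "real \<Rightarrow> 'w measure \<Rightarrow> (real \<Rightarrow> 'w \<Rightarrow> 'b::topological_space) \<Rightarrow> bool" where
  "jointly_measurable T M f \<longleftrightarrow> case_prod f \<in> borel_measurable (restrict_space borel {0..T} \<Otimes>\<^sub>M M)"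

text \<open>The order of integration is that of \<open>ito_integral_L2\<close>. Exchanging it is a
  separate step, which uses joint measurability.\<close>

definition time_exp :: "'w measure \<Rightarrow> real \<Rightarrow> (real \<Rightarrow> 'w \<Rightarrow> ennreal) \<Rightarrow> ennreal" where
  "time_exp M t f = (\<integral>\<^sup>+\<omega>. (\<integral>\<^sup>+s\<in>{0..t}. f s \<omega> \<partial>lborel) \<partial>M)"

text \<open>
  Composition with \<open>clamp_time T\<close> extends a function that is measurable on \<open>[0, T] \<times> \<Omega>\<close> only to
  all times.
\<close>

definition clamp_time :: "real \<Rightarrow> real \<Rightarrow> real" where
  "clamp_time T s = max 0 (min T s)"

lemma clamp_time_id [simp]: "0 \<le> s \<Longrightarrow> s \<le> T \<Longrightarrow> clamp_time T s = s"
  by (simp add: clamp_time_def)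

text \<open>One substitution rule serves fixed times, clamped times and random times such as
  \<open>min s (\<tau> \<omega>)\<close>.\<close>

lemma jointly_measurable_compose:
  assumes "jointly_measurable T M f" "g \<in> measurable N borel" "\<And>x. x \<in> space N \<Longrightarrow> g x \<in> {0..T}"
    "h \<in> measurable N M"
  shows "(\<lambda>x. f (g x) (h x)) \<in> borel_measurable N"
proof -
  have "(\<lambda>x. (g x, h x)) \<in> measurable N (restrict_space borel {0..T} \<Otimes>\<^sub>M M)"
    using assms by (intro measurable_Pair measurable_restrict_space2) auto
  from measurable_compose[OF this assms(1)[unfolded jointly_measurable_def]]
  show ?thesis by simp
qed

lemma jointly_measurable_clamp:
  assumes "jointly_measurable T M f" "0 \<le> T"
  shows "(\<lambda>(s, \<omega>). f (clamp_time T s) \<omega>) \<in> borel_measurable (borel \<Otimes>\<^sub>M M)"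
  unfolding case_prod_unfold
  by (rule jointly_measurable_compose[OF assms(1)])
     (use assms(2) in \<open>auto simp: clamp_time_def[abs_def]\<close>)

lemma jointly_measurable_section:
  "jointly_measurable T M f \<Longrightarrow> t \<in> {0..T} \<Longrightarrow> f t \<in> borel_measurable M"
  using jointly_measurable_compose[of T M f "\<lambda>_. t" M "\<lambda>\<omega>. \<omega>"] by simp

lemma jointly_measurableI:
  assumes "case_prod f \<in> borel_measurable (borel \<Otimes>\<^sub>M M)"
  shows "jointly_measurable T M f"
proof -
  have "(\<lambda>x. (fst x, snd x)) \<in> measurable (restrict_space borel {0..T} \<Otimes>\<^sub>M M) (borel \<Otimes>\<^sub>M M)"
    by (intro measurable_Pair measurable_snd
       measurable_compose[OF measurable_fst measurable_restrict_space1[OF measurable_ident_sets[OF refl]]])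
  from measurable_compose[OF this assms] show ?thesis
    by (simp add: jointly_measurable_def)
qed

lemma jointly_measurable_const [simp]: "f \<in> borel_measurable M \<Longrightarrow> jointly_measurable T M (\<lambda>_. f)"
  unfolding jointly_measurable_def case_prod_unfold by simp

lemma measurable_time_set_integrand:
  fixes f :: "real \<Rightarrow> 'w \<Rightarrow> ennreal"
  assumes f: "jointly_measurable T M f" and t: "0 \<le> T" "t \<le> T"
  shows "(\<lambda>(s, \<omega>). f s \<omega> * indicator {0..t} s) \<in> borel_measurable (lborel \<Otimes>\<^sub>M M)"
proof -
  \<comment> \<open>Clamping changes nothing where the indicator is nonzero, so the product is
    measurable for all times.\<close>
  have "(\<lambda>(s, \<omega>). f (clamp_time T s) \<omega> * indicator {0..t} s) \<in> borel_measurable (borel \<Otimes>\<^sub>M M)"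
    using jointly_measurable_clamp[OF f t(1)] unfolding case_prod_unfold by measurable
  also have "(\<lambda>(s, \<omega>). f (clamp_time T s) \<omega> * indicator {0..t} s) = (\<lambda>(s, \<omega>). f s \<omega> * indicator {0..t} s)"
    using t(2) by (auto simp: indicator_def fun_eq_iff)
  finally show ?thesis by (simp cong: measurable_cong_sets sets_pair_measure_cong)
qed

lemma measurable_time_section:
  fixes f :: "real \<Rightarrow> 'w \<Rightarrow> ennreal"
  assumes f: "jointly_measurable T M f" and t: "0 \<le> T" "t \<le> T" and \<omega>: "\<omega> \<in> space M"
  shows "(\<lambda>s. f s \<omega> * indicator {0..t} s) \<in> borel_measurable lborel"
  using measurable_compose[OF measurable_Pair2'[OF \<omega>, of lborel] measurable_time_set_integrand[OF f t]]
  by simp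

context prob_space
begin

lemma measurable_time_integral:
  fixes f :: "real \<Rightarrow> 'a \<Rightarrow> ennreal"
  assumes f: "jointly_measurable T M f" and t: "0 \<le> T" "t \<le> T"
  shows "(\<lambda>\<omega>. \<integral>\<^sup>+s\<in>{0..t}. f s \<omega> \<partial>lborel) \<in> borel_measurable M"
proof -
  have "(\<lambda>(\<omega>, s). f s \<omega> * indicator {0..t} s) \<in> borel_measurable (M \<Otimes>\<^sub>M lborel)"
    using measurable_pair_swap[OF measurable_time_set_integrand[OF f t]] by simp
  from lborel.borel_measurable_nn_integral_fst[OF this] show ?thesis by simp
qed

lemma measurable_expectation_time:
  fixes f :: "real \<Rightarrow> 'a \<Rightarrow> ennreal"
  assumes f: "jointly_measurable T M f" and t: "0 \<le> T" "t \<le> T"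
  shows "(\<lambda>s. (\<integral>\<^sup>+\<omega>. f s \<omega> \<partial>M) * indicator {0..t} s) \<in> borel_measurable lborel"
proof -
  have "(\<lambda>s. \<integral>\<^sup>+\<omega>. f s \<omega> * indicator {0..t} s \<partial>M) \<in> borel_measurable lborel"
    using borel_measurable_nn_integral_fst[OF measurable_time_set_integrand[OF f t]] by simp
  also have "(\<lambda>s. \<integral>\<^sup>+\<omega>. f s \<omega> * indicator {0..t} s \<partial>M) = (\<lambda>s. (\<integral>\<^sup>+\<omega>. f s \<omega> \<partial>M) * indicator {0..t} s)"
    by (auto simp: indicator_def fun_eq_iff)
  finally show ?thesis .
qed

lemma time_exp_swap:
  fixes f :: "real \<Rightarrow> 'a \<Rightarrow> ennreal"
  assumes f: "jointly_measurable T M f" and t: "0 \<le> T" "t \<le> T"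
  shows "time_exp M t f = (\<integral>\<^sup>+s\<in>{0..t}. (\<integral>\<^sup>+\<omega>. f s \<omega> \<partial>M) \<partial>lborel)"
proof -
  interpret P: pair_sigma_finite lborel M ..
  have "time_exp M t f = (\<integral>\<^sup>+s. (\<integral>\<^sup>+\<omega>. f s \<omega> * indicator {0..t} s \<partial>M) \<partial>lborel)"
    unfolding time_exp_def using measurable_time_set_integrand[OF f t] by (rule P.Fubini')
  also have "\<dots> = (\<integral>\<^sup>+s\<in>{0..t}. (\<integral>\<^sup>+\<omega>. f s \<omega> \<partial>M) \<partial>lborel)"
    by (intro nn_integral_cong) (auto simp: indicator_def)
  finally show ?thesis .
qed

lemma time_exp_add:
  assumes f: "jointly_measurable T M f" and g: "jointly_measurable T M g" and t: "0 \<le> T" "t \<le> T"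
  shows "time_exp M t (\<lambda>s \<omega>. f s \<omega> + g s \<omega>) = time_exp M t f + time_exp M t g"
proof -
  have "time_exp M t (\<lambda>s \<omega>. f s \<omega> + g s \<omega>) =
      (\<integral>\<^sup>+\<omega>. (\<integral>\<^sup>+s\<in>{0..t}. f s \<omega> \<partial>lborel) + (\<integral>\<^sup>+s\<in>{0..t}. g s \<omega> \<partial>lborel) \<partial>M)"
    unfolding time_exp_def distrib_right
    by (intro nn_integral_cong nn_integral_add measurable_time_section[OF f t] measurable_time_section[OF g t])
  also have "\<dots> = time_exp M t f + time_exp M t g"
    unfolding time_exp_def
    by (intro nn_integral_add measurable_time_integral[OF f t] measurable_time_integral[OF g t])
  finally show ?thesis .
qed

lemma time_exp_cmult:
  assumes f: "jointly_measurable T M f" and t: "0 \<le> T" "t \<le> T"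
  shows "time_exp M t (\<lambda>s \<omega>. c * f s \<omega>) = c * time_exp M t f"
proof -
  have "time_exp M t (\<lambda>s \<omega>. c * f s \<omega>) = (\<integral>\<^sup>+\<omega>. c * (\<integral>\<^sup>+s\<in>{0..t}. f s \<omega> \<partial>lborel) \<partial>M)"
    unfolding time_exp_def mult.assoc
    by (intro nn_integral_cong nn_integral_cmult measurable_time_section[OF f t])
  also have "\<dots> = c * time_exp M t f"
    unfolding time_exp_def by (intro nn_integral_cmult measurable_time_integral[OF f t])
  finally show ?thesis .
qed

lemma time_exp_mono_AE:
  assumes "AE \<omega> in M. \<forall>s\<in>{0..t}. f s \<omega> \<le> g s \<omega>"
  shows "time_exp M t f \<le> time_exp M t g"
  unfolding time_exp_def
  using assms by (intro nn_integral_mono_AE) (auto elim!: eventually_mono intro!: nn_integral_mono simp: indicator_def)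

lemma time_exp_mono:
  "(\<And>s \<omega>. s \<in> {0..t} \<Longrightarrow> \<omega> \<in> space M \<Longrightarrow> f s \<omega> \<le> g s \<omega>) \<Longrightarrow> time_exp M t f \<le> time_exp M t g"
  by (rule time_exp_mono_AE) auto

lemma time_exp_mono_time: "t \<le> t' \<Longrightarrow> time_exp M t f \<le> time_exp M t' f"
  unfolding time_exp_def by (intro nn_integral_mono) (auto simp: indicator_def)

lemma time_exp_le_2_add:
  assumes le: "\<And>s \<omega>. s \<in> {0..t} \<Longrightarrow> \<omega> \<in> space M \<Longrightarrow> f s \<omega> \<le> 2 * g s \<omega> + 2 * h s \<omega>"
    and g: "jointly_measurable T M g" and h: "jointly_measurable T M h" and t: "0 \<le> T" "t \<le> T"
  shows "time_exp M t f \<le> 2 * time_exp M t g + 2 * time_exp M t h"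
proof -
  have m: "jointly_measurable T M (\<lambda>s \<omega>. 2 * f s \<omega>)" if "jointly_measurable T M f"
    for f :: "real \<Rightarrow> 'a \<Rightarrow> ennreal"
    using that unfolding jointly_measurable_def case_prod_unfold by measurable
  have "time_exp M t f \<le> time_exp M t (\<lambda>s \<omega>. 2 * g s \<omega> + 2 * h s \<omega>)"
    using le by (rule time_exp_mono)
  also have "\<dots> = 2 * time_exp M t g + 2 * time_exp M t h"
    using time_exp_add[OF m[OF g] m[OF h] t] time_exp_cmult[OF g t] time_exp_cmult[OF h t] by simp
  finally show ?thesis .
qed

end

section \<open>The Ito integral\<close>

text \<open>Strong measurability, one vector at a time: it matches the progressive measurability
  demanded in \<open>ito_integral\<close> and suffices for the Hilbert--Schmidt norm.\<close>

definition op_measurable :: "real \<Rightarrow> 'w measure \<Rightarrow> (real \<Rightarrow> 'w \<Rightarrow> ('h::real_inner \<Rightarrow>\<^sub>L 'h)) \<Rightarrow> bool" where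
  "op_measurable T M \<Phi> \<longleftrightarrow> (\<forall>h. jointly_measurable T M (\<lambda>s \<omega>. blinfun_apply (\<Phi> s \<omega>) h))"

abbreviation energy :: "nat set \<Rightarrow> (nat \<Rightarrow> 'h::real_inner) \<Rightarrow> 'w measure \<Rightarrow> real \<Rightarrow> (real \<Rightarrow> 'w \<Rightarrow> ('h \<Rightarrow>\<^sub>L 'h)) \<Rightarrow> ennreal" where
  "energy K e M t \<Phi> \<equiv> time_exp M t (\<lambda>s \<omega>. hs_sq K e (\<Phi> s \<omega>))"

lemma op_measurable_hs_sq:
  "op_measurable T M \<Phi> \<Longrightarrow> jointly_measurable T M (\<lambda>s \<omega>. hs_sq K e (\<Phi> s \<omega>))"
  unfolding op_measurable_def jointly_measurable_def case_prod_unfold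
  by (intro measurable_hs_sq) auto

lemma op_measurable_diff:
  fixes \<Phi> \<Psi> :: "real \<Rightarrow> 'w \<Rightarrow> ('h::{real_inner, second_countable_topology} \<Rightarrow>\<^sub>L 'h)"
  shows "op_measurable T M \<Phi> \<Longrightarrow> op_measurable T M \<Psi> \<Longrightarrow> op_measurable T M (\<lambda>s \<omega>. \<Phi> s \<omega> - \<Psi> s \<omega>)"
  unfolding op_measurable_def jointly_measurable_def case_prod_unfold blinfun.diff_left
  by (auto intro!: borel_measurable_diff)

section \<open>Differences of elementary processes\<close>

lemma elem_process_append:
  "elem_process (\<phi> @ \<psi>) r \<omega> = elem_process \<phi> r \<omega> + elem_process \<psi> r \<omega>"
  by (simp add: elem_process_def)

lemma elem_integral_append:
  "elem_integral W (\<phi> @ \<psi>) r \<omega> = elem_integral W \<phi> r \<omega> + elem_integral W \<psi> r \<omega>"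
  by (simp add: elem_integral_def)

text \<open>The sign is put on the target vector \<open>g\<close>, so the times and the random
  coefficients are unchanged and the process stays elementary. Concatenation with a negated list
  represents a difference.\<close>

definition elem_neg :: "('w, 'h::real_inner) elem \<Rightarrow> ('w, 'h) elem" where
  "elem_neg = map (\<lambda>(s, u, \<xi>, h, g). (s, u, \<xi>, h, - g))"

lemma rank_one_minus: "rank_one h (- g) = - rank_one h g"
  by (rule blinfun_eqI) (simp add: blinfun.minus_left)

lemma elem_process_neg: "elem_process (elem_neg \<phi>) r \<omega> = - elem_process \<phi> r \<omega>"
  by (induction \<phi>) (auto simp: elem_process_def elem_neg_def rank_one_minus)

lemma elem_integral_neg: "elem_integral W (elem_neg \<phi>) r \<omega> = - elem_integral W \<phi> r \<omega>"
  by (induction \<phi>) (auto simp: elem_integral_def elem_neg_def)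

lemma elementary_neg: "elementary F \<phi> \<Longrightarrow> elementary F (elem_neg \<phi>)"
  unfolding elementary_def elem_neg_def by fastforce

lemma elementary_append: "elementary F \<phi> \<Longrightarrow> elementary F \<psi> \<Longrightarrow> elementary F (\<phi> @ \<psi>)"
  unfolding elementary_def by auto

context wiener_space
begin

lemma op_measurable_elem_process:
  fixes \<phi> :: "('w, 'h) elem"
  assumes "elementary F \<phi>"
  shows "op_measurable T M (elem_process \<phi>)"
  unfolding op_measurable_def
proof (intro allI jointly_measurableI)
  fix h
  have [measurable]: "elem_x \<phi> i \<in> borel_measurable M" if "i < length \<phi>" for i
    using elementaryD(3)[OF assms that] by (rule measurable_F_M)
  show "(\<lambda>(s, \<omega>). blinfun_apply (elem_process \<phi> s \<omega>) h) \<in> borel_measurable (borel \<Otimes>\<^sub>M M)"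
    unfolding elem_process_eq_sum blinfun.sum_left blinfun.scaleR_left case_prod_unfold
    by (intro borel_measurable_sum borel_measurable_scaleR borel_measurable_const borel_measurable_times)
       (auto intro!: measurable_compose[OF measurable_snd])
qed

text \<open>
  The factor 16 is the constant 4 of Doob's inequality times 2 for passing from \<open>Z\<close> to the elementary
  integrals and 2 for passing from the elementary processes back to \<open>\<Psi>\<close>.
\<close>

lemma ito_integral_L2_doob:
  assumes I: "ito_integral_L2 M F W K e T \<Psi> Z" and basis: "orthonormal_basis K e"
    and \<Psi>: "op_measurable T M \<Psi>"
    and t: "0 \<le> t 0" "mono t" "t N \<le> T"
    and Z: "\<And>s. s \<in> {0..T} \<Longrightarrow> Z s \<in> borel_measurable M"
  shows "(\<integral>\<^sup>+\<omega>. (SUP k\<in>{..N::nat}. ennreal ((norm (Z (t k) \<omega>))\<^sup>2)) \<partial>M) \<le> 16 * energy K e M (t N) \<Psi>"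
proof -
  obtain \<phi> where \<phi>: "\<And>m. elementary F (\<phi> m)"
    and lim\<phi>: "(\<lambda>m. energy K e M T (\<lambda>s \<omega>. elem_process (\<phi> m) s \<omega> - \<Psi> s \<omega>)) \<longlonglongrightarrow> 0"
    and limI: "\<And>s. s \<in> {0..T} \<Longrightarrow>
      (\<lambda>m. \<integral>\<^sup>+\<omega>. ennreal ((norm (elem_integral W (\<phi> m) s \<omega> - Z s \<omega>))\<^sup>2) \<partial>M) \<longlonglongrightarrow> 0"
    using I unfolding ito_integral_L2_def time_exp_def by blast
  have tk: "t k \<in> {0..T}" if "k \<le> N" for k
    using t monoD[OF t(2), of 0 k] monoD[OF t(2) that] by auto
  have tN: "0 \<le> t N" "0 \<le> T" using tk[of N] by auto
  let ?L = "\<integral>\<^sup>+\<omega>. (SUP k\<in>{..N}. ennreal ((norm (Z (t k) \<omega>))\<^sup>2)) \<partial>M"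
  let ?A = "\<lambda>m. energy K e M T (\<lambda>s \<omega>. elem_process (\<phi> m) s \<omega> - \<Psi> s \<omega>)"
  let ?B = "\<lambda>m k. \<integral>\<^sup>+\<omega>. ennreal ((norm (elem_integral W (\<phi> m) (t k) \<omega> - Z (t k) \<omega>))\<^sup>2) \<partial>M"
  have bound: "?L \<le> 16 * energy K e M (t N) \<Psi> + 16 * ?A m + 2 * (\<Sum>k\<le>N. ?B m k)" for m
  proof -
    let ?I = "\<lambda>k. elem_integral W (\<phi> m) (t k)"
    have [measurable]: "?I k \<in> borel_measurable M" "Z (t k) \<in> borel_measurable M" if "k \<le> N" for k
      using measurable_elem_integral[OF \<phi>, of "t k" m] tk[OF that] Z by auto
    \<comment> \<open>On a finite grid the maximal approximation error is bounded by the sum of the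
      errors, so convergence in mean square at each single time is enough.\<close>
    have pt: "(SUP k\<in>{..N}. ennreal ((norm (Z (t k) \<omega>))\<^sup>2)) \<le>
        2 * (SUP k\<in>{..N}. ennreal ((norm (?I k \<omega>))\<^sup>2)) +
        2 * (\<Sum>k\<le>N. ennreal ((norm (?I k \<omega> - Z (t k) \<omega>))\<^sup>2))" for \<omega>
    proof (rule SUP_least)
      fix k assume k: "k \<in> {..N}"
      have "ennreal ((norm (Z (t k) \<omega>))\<^sup>2) \<le> 2 * ennreal ((norm (?I k \<omega>))\<^sup>2)
          + 2 * ennreal ((norm (?I k \<omega> - Z (t k) \<omega>))\<^sup>2)"
        using norm_diff_sq_le[of "?I k \<omega>" "?I k \<omega> - Z (t k) \<omega>"] by (intro ennreal_le_2_add) auto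
      also have "\<dots> \<le> 2 * (SUP k\<in>{..N}. ennreal ((norm (?I k \<omega>))\<^sup>2)) +
        2 * (\<Sum>k\<le>N. ennreal ((norm (?I k \<omega> - Z (t k) \<omega>))\<^sup>2))"
        using k by (intro add_mono mult_left_mono SUP_upper member_le_sum) auto
      finally show "ennreal ((norm (Z (t k) \<omega>))\<^sup>2) \<le> \<dots>" .
    qed
    have "?L \<le> (\<integral>\<^sup>+\<omega>. 2 * (SUP k\<in>{..N}. ennreal ((norm (?I k \<omega>))\<^sup>2)) +
        2 * (\<Sum>k\<le>N. ennreal ((norm (?I k \<omega> - Z (t k) \<omega>))\<^sup>2)) \<partial>M)"
      by (intro nn_integral_mono pt)
    also have "\<dots> = (\<integral>\<^sup>+\<omega>. 2 * (SUP k\<in>{..N}. ennreal ((norm (?I k \<omega>))\<^sup>2)) \<partial>M) +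
        (\<integral>\<^sup>+\<omega>. 2 * (\<Sum>k\<le>N. ennreal ((norm (?I k \<omega> - Z (t k) \<omega>))\<^sup>2)) \<partial>M)"
      by (rule nn_integral_add) (auto intro!: borel_measurable_times borel_measurable_SUP borel_measurable_sum)
    also have "(\<integral>\<^sup>+\<omega>. 2 * (SUP k\<in>{..N}. ennreal ((norm (?I k \<omega>))\<^sup>2)) \<partial>M) =
        2 * (\<integral>\<^sup>+\<omega>. (SUP k\<in>{..N}. ennreal ((norm (?I k \<omega>))\<^sup>2)) \<partial>M)"
      by (rule nn_integral_cmult) (auto intro!: borel_measurable_SUP)
    also have "(\<integral>\<^sup>+\<omega>. 2 * (\<Sum>k\<le>N. ennreal ((norm (?I k \<omega> - Z (t k) \<omega>))\<^sup>2)) \<partial>M) = 2 * (\<Sum>k\<le>N. ?B m k)"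
      by (subst nn_integral_cmult, (auto intro!: borel_measurable_sum)[1], subst nn_integral_sum) auto
    also have "2 * (\<integral>\<^sup>+\<omega>. (SUP k\<in>{..N}. ennreal ((norm (?I k \<omega>))\<^sup>2)) \<partial>M) \<le>
        2 * (4 * (\<integral>\<^sup>+\<omega>. ennreal ((norm (?I N \<omega>))\<^sup>2) \<partial>M))"
      by (intro mult_left_mono elem_integral_doob \<phi> t) auto
    also have "(\<integral>\<^sup>+\<omega>. ennreal ((norm (?I N \<omega>))\<^sup>2) \<partial>M) = energy K e M (t N) (elem_process (\<phi> m))"
      unfolding time_exp_def by (rule elem_integral_isometry[OF \<phi> tN(1) basis])
    also have "energy K e M (t N) (elem_process (\<phi> m)) \<le>
        2 * energy K e M (t N) \<Psi> + 2 * energy K e M (t N) (\<lambda>s \<omega>. elem_process (\<phi> m) s \<omega> - \<Psi> s \<omega>)"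
    proof (rule time_exp_le_2_add)
      show "hs_sq K e (elem_process (\<phi> m) s \<omega>) \<le>
          2 * hs_sq K e (\<Psi> s \<omega>) + 2 * hs_sq K e (elem_process (\<phi> m) s \<omega> - \<Psi> s \<omega>)" for s \<omega>
        using hs_sq_add_le[of K e "\<Psi> s \<omega>" "elem_process (\<phi> m) s \<omega> - \<Psi> s \<omega>"] by simp
    qed (use tN t in \<open>auto intro!: op_measurable_hs_sq op_measurable_diff op_measurable_elem_process \<phi> \<Psi>\<close>)
    also have "energy K e M (t N) (\<lambda>s \<omega>. elem_process (\<phi> m) s \<omega> - \<Psi> s \<omega>) \<le> ?A m"
      by (rule time_exp_mono_time[OF t(3)])
    finally show ?thesis
      by (simp add: distrib_left mult.assoc[symmetric] mult_left_mono add_mono)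
  qed
  \<comment> \<open>With the grid fixed, both error terms tend to zero as the approximation is
    refined.\<close>
  have "(\<lambda>m. 16 * energy K e M (t N) \<Psi> + 16 * ?A m + 2 * (\<Sum>k\<le>N. ?B m k)) \<longlonglongrightarrow>
      16 * energy K e M (t N) \<Psi> + 16 * 0 + 2 * (\<Sum>k\<le>N. 0)"
    by (intro tendsto_add tendsto_const ennreal_tendsto_cmult lim\<phi> tendsto_sum limI tk) auto
  from LIMSEQ_le_const[OF this, of ?L] bound show ?thesis by simp
qed

text \<open>The two integrals come with unrelated approximating sequences; concatenating the first
  with the negated second approximates the difference. Both convergences follow from splitting the
  squared norm of a difference.\<close>

lemma ito_integral_L2_diff:
  assumes I: "ito_integral_L2 M F W K e T \<Psi> Z" "ito_integral_L2 M F W K e T \<Psi>' Z'"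
    and \<Psi>: "op_measurable T M \<Psi>" "op_measurable T M \<Psi>'" and T: "0 \<le> T"
    and Z: "\<And>s. s \<in> {0..T} \<Longrightarrow> Z s \<in> borel_measurable M" "\<And>s. s \<in> {0..T} \<Longrightarrow> Z' s \<in> borel_measurable M"
  shows "ito_integral_L2 M F W K e T (\<lambda>s \<omega>. \<Psi> s \<omega> - \<Psi>' s \<omega>) (\<lambda>s \<omega>. Z s \<omega> - Z' s \<omega>)"
proof -
  obtain \<phi> where \<phi>: "\<And>m. elementary F (\<phi> m)"
    and lim\<phi>: "(\<lambda>m. energy K e M T (\<lambda>s \<omega>. elem_process (\<phi> m) s \<omega> - \<Psi> s \<omega>)) \<longlonglongrightarrow> 0"
    and limI: "\<And>s. s \<in> {0..T} \<Longrightarrow>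
      (\<lambda>m. \<integral>\<^sup>+\<omega>. ennreal ((norm (elem_integral W (\<phi> m) s \<omega> - Z s \<omega>))\<^sup>2) \<partial>M) \<longlonglongrightarrow> 0"
    using I(1) unfolding ito_integral_L2_def time_exp_def by blast
  obtain \<phi>' where \<phi>': "\<And>m. elementary F (\<phi>' m)"
    and lim\<phi>': "(\<lambda>m. energy K e M T (\<lambda>s \<omega>. elem_process (\<phi>' m) s \<omega> - \<Psi>' s \<omega>)) \<longlonglongrightarrow> 0"
    and limI': "\<And>s. s \<in> {0..T} \<Longrightarrow>
      (\<lambda>m. \<integral>\<^sup>+\<omega>. ennreal ((norm (elem_integral W (\<phi>' m) s \<omega> - Z' s \<omega>))\<^sup>2) \<partial>M) \<longlonglongrightarrow> 0"
    using I(2) unfolding ito_integral_L2_def time_exp_def by blast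
  let ?\<psi> = "\<lambda>m. \<phi> m @ elem_neg (\<phi>' m)"
  have to0: "f \<longlonglongrightarrow> 0" if "\<And>m. f m \<le> 2 * a m + 2 * b m" "a \<longlonglongrightarrow> 0" "b \<longlonglongrightarrow> 0"
    for f a b :: "nat \<Rightarrow> ennreal"
  proof (rule tendsto_sandwich[of "\<lambda>_. 0" f sequentially "\<lambda>m. 2 * a m + 2 * b m"])
    have "(\<lambda>m. 2 * a m + 2 * b m) \<longlonglongrightarrow> 2 * 0 + 2 * 0"
      by (intro tendsto_add ennreal_tendsto_cmult that) auto
    then show "(\<lambda>m. 2 * a m + 2 * b m) \<longlonglongrightarrow> 0" by simp
  qed (use that in auto)
  show ?thesis
    unfolding ito_integral_L2_def
  proof (intro exI[of _ ?\<psi>] conjI allI ballI)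
    show "elementary F (?\<psi> m)" for m using \<phi> \<phi>' by (intro elementary_append elementary_neg)
    show "(\<lambda>m. \<integral>\<^sup>+\<omega>. (\<integral>\<^sup>+r\<in>{0..T}. hs_sq K e (elem_process (?\<psi> m) r \<omega> - (\<Psi> r \<omega> - \<Psi>' r \<omega>)) \<partial>lborel) \<partial>M)
      \<longlonglongrightarrow> 0"
      unfolding time_exp_def[symmetric]
    proof (rule to0[OF _ lim\<phi> lim\<phi>'])
      show "energy K e M T (\<lambda>r \<omega>. elem_process (?\<psi> m) r \<omega> - (\<Psi> r \<omega> - \<Psi>' r \<omega>)) \<le>
        2 * energy K e M T (\<lambda>s \<omega>. elem_process (\<phi> m) s \<omega> - \<Psi> s \<omega>) +
        2 * energy K e M T (\<lambda>s \<omega>. elem_process (\<phi>' m) s \<omega> - \<Psi>' s \<omega>)" for m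
      proof (rule time_exp_le_2_add)
        show "hs_sq K e (elem_process (?\<psi> m) s \<omega> - (\<Psi> s \<omega> - \<Psi>' s \<omega>)) \<le>
          2 * hs_sq K e (elem_process (\<phi> m) s \<omega> - \<Psi> s \<omega>) + 2 * hs_sq K e (elem_process (\<phi>' m) s \<omega> - \<Psi>' s \<omega>)" for s \<omega>
          using hs_sq_diff_le[of K e "elem_process (\<phi> m) s \<omega> - \<Psi> s \<omega>" "elem_process (\<phi>' m) s \<omega> - \<Psi>' s \<omega>"]
          by (simp add: elem_process_append elem_process_neg algebra_simps)
      qed (use T in \<open>auto intro!: op_measurable_hs_sq op_measurable_diff op_measurable_elem_process \<phi> \<phi>' \<Psi>\<close>)
    qed
    fix s assume s: "s \<in> {0..T}"
    note [measurable] = measurable_elem_integral[OF \<phi>, of s] measurable_elem_integral[OF \<phi>', of s] Z[OF s]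
    show "(\<lambda>m. \<integral>\<^sup>+\<omega>. ennreal ((norm (elem_integral W (?\<psi> m) s \<omega> - (Z s \<omega> - Z' s \<omega>)))\<^sup>2) \<partial>M) \<longlonglongrightarrow> 0"
    proof (rule to0[OF _ limI[OF s] limI'[OF s]])
      fix m
      have "(\<integral>\<^sup>+\<omega>. ennreal ((norm (elem_integral W (?\<psi> m) s \<omega> - (Z s \<omega> - Z' s \<omega>)))\<^sup>2) \<partial>M) \<le>
        (\<integral>\<^sup>+\<omega>. 2 * ennreal ((norm (elem_integral W (\<phi> m) s \<omega> - Z s \<omega>))\<^sup>2) +
           2 * ennreal ((norm (elem_integral W (\<phi>' m) s \<omega> - Z' s \<omega>))\<^sup>2) \<partial>M)"
      proof (intro nn_integral_mono ennreal_le_2_add)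
        show "(norm (elem_integral W (?\<psi> m) s \<omega> - (Z s \<omega> - Z' s \<omega>)))\<^sup>2 \<le>
          2 * (norm (elem_integral W (\<phi> m) s \<omega> - Z s \<omega>))\<^sup>2 + 2 * (norm (elem_integral W (\<phi>' m) s \<omega> - Z' s \<omega>))\<^sup>2" for \<omega>
          using norm_diff_sq_le[of "elem_integral W (\<phi> m) s \<omega> - Z s \<omega>" "elem_integral W (\<phi>' m) s \<omega> - Z' s \<omega>"]
          by (simp add: elem_integral_append elem_integral_neg algebra_simps)
      qed auto
      also have "\<dots> = 2 * (\<integral>\<^sup>+\<omega>. ennreal ((norm (elem_integral W (\<phi> m) s \<omega> - Z s \<omega>))\<^sup>2) \<partial>M) +
         2 * (\<integral>\<^sup>+\<omega>. ennreal ((norm (elem_integral W (\<phi>' m) s \<omega> - Z' s \<omega>))\<^sup>2) \<partial>M)"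
        using s by (subst nn_integral_add) (auto simp: nn_integral_cmult)
      finally show "(\<integral>\<^sup>+\<omega>. ennreal ((norm (elem_integral W (?\<psi> m) s \<omega> - (Z s \<omega> - Z' s \<omega>)))\<^sup>2) \<partial>M) \<le> \<dots>" .
    qed
  qed
qed

end

section \<open>Localized integrals and passage to the limit in the localization\<close>

context filtered_prob_space
begin

lemma progressive_jointly_measurable:
  assumes "progressive F T Y" "0 \<le> T"
  shows "jointly_measurable T M Y"
proof -
  have "(\<lambda>\<omega>. \<omega>) \<in> measurable M (F T)"
    by (rule measurable_F_M[of _ T]) simp
  then have "(\<lambda>x. (fst x, snd x)) \<in> measurable (restrict_space borel {0..T} \<Otimes>\<^sub>M M)
      (restrict_space borel {0..T} \<Otimes>\<^sub>M F T)"
    by (intro measurable_Pair measurable_fst) (rule measurable_compose[OF measurable_snd])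
  moreover have "case_prod Y \<in> borel_measurable (restrict_space borel {0..T} \<Otimes>\<^sub>M F T)"
    using assms unfolding progressive_def by auto
  ultimately show ?thesis
    unfolding jointly_measurable_def by (auto dest!: measurable_compose)
qed

lemma
  assumes "ito_integral M F W K e T \<Phi> Y" "0 \<le> T"
  shows ito_integral_op_measurable: "op_measurable T M \<Phi>"
    and ito_integral_jointly_measurable: "jointly_measurable T M Y"
  using assms unfolding ito_integral_def op_measurable_def
  by (auto intro: progressive_jointly_measurable)

text \<open>This extracts what the limit arguments use about the localizing times. Monotonicity in m
  turns passage beyond T for some m into passage for all large m, so two integrals can be handled
  with their own sequences.\<close>

lemma ito_integral_localized:
  assumes "ito_integral M F W K e T \<Phi> Y"
  shows "\<exists>\<tau>. (\<forall>m. \<tau> m \<in> borel_measurable M) \<and> (\<forall>m. \<forall>\<omega>\<in>space M. 0 \<le> \<tau> m \<omega>) \<and>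
    (AE \<omega> in M. eventually (\<lambda>m. T \<le> \<tau> m \<omega>) sequentially) \<and>
    (\<forall>m. ito_integral_L2 M F W K e T
      (\<lambda>s \<omega>. indicator {0..\<tau> m \<omega>} s *\<^sub>R \<Phi> s \<omega>) (\<lambda>t \<omega>. Y (min t (\<tau> m \<omega>)) \<omega>))"
proof -
  from assms obtain \<tau> where st: "\<And>m. stopping_time F (\<tau> m)"
    and inc: "\<And>\<omega>. \<omega> \<in> space M \<Longrightarrow> incseq (\<lambda>m. \<tau> m \<omega>)" "\<And>\<omega>. \<omega> \<in> space M \<Longrightarrow> 0 \<le> \<tau> 0 \<omega>"
    and ex: "AE \<omega> in M. \<exists>m. T \<le> \<tau> m \<omega>"
    and I: "\<And>m. ito_integral_L2 M F W K e T
      (\<lambda>s \<omega>. indicator {0..\<tau> m \<omega>} s *\<^sub>R \<Phi> s \<omega>) (\<lambda>t \<omega>. Y (min t (\<tau> m \<omega>)) \<omega>)"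
    unfolding ito_integral_def by blast
  show ?thesis
  proof (intro exI[of _ \<tau>] conjI allI ballI)
    show "\<tau> m \<in> borel_measurable M" for m
      by (rule measurable_stopping_time[OF st]) (use subalgebra_F in \<open>auto simp: subalgebra_def\<close>)
    show "0 \<le> \<tau> m \<omega>" if "\<omega> \<in> space M" for m \<omega>
      using inc(2)[OF that] incseqD[OF inc(1)[OF that], of 0 m] by simp
    show "AE \<omega> in M. eventually (\<lambda>m. T \<le> \<tau> m \<omega>) sequentially"
      using ex AE_space
    proof eventually_elim
      case (elim \<omega>)
      then obtain m where m: "T \<le> \<tau> m \<omega>" by blast
      have "T \<le> \<tau> k \<omega>" if "m \<le> k" for k
        using m incseqD[OF inc(1)[OF elim(2)] that] by simp
      then show ?case unfolding eventually_sequentially by blast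
    qed
  qed (rule I)
qed

end

lemma jointly_measurable_stopped:
  assumes Y: "jointly_measurable T M Y" and \<tau>: "\<tau> \<in> borel_measurable M"
    "\<And>\<omega>. \<omega> \<in> space M \<Longrightarrow> 0 \<le> \<tau> \<omega>"
  shows "jointly_measurable T M (\<lambda>s \<omega>. Y (min s (\<tau> \<omega>)) \<omega>)"
  unfolding jointly_measurable_def case_prod_unfold
proof (rule jointly_measurable_compose[OF Y])
  have "fst \<in> measurable (restrict_space borel {0..T} \<Otimes>\<^sub>M M) borel"
    by (rule measurable_compose[OF measurable_fst]) (simp add: measurable_restrict_space1)
  then show "(\<lambda>x. min (fst x) (\<tau> (snd x))) \<in> borel_measurable (restrict_space borel {0..T} \<Otimes>\<^sub>M M)"
    by (intro borel_measurable_min measurable_compose[OF measurable_snd \<tau>(1)])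
qed (use \<tau>(2) in \<open>auto simp: space_pair_measure space_restrict_space min_def\<close>)

lemma op_measurable_stopped:
  fixes \<Phi> :: "real \<Rightarrow> 'w \<Rightarrow> ('h::{real_inner, second_countable_topology} \<Rightarrow>\<^sub>L 'h)"
  assumes \<Phi>: "op_measurable T M \<Phi>" and \<tau>: "\<tau> \<in> borel_measurable M"
  shows "op_measurable T M (\<lambda>s \<omega>. indicator {0..\<tau> \<omega>} s *\<^sub>R \<Phi> s \<omega>)"
  unfolding op_measurable_def jointly_measurable_def case_prod_unfold blinfun.scaleR_left
proof (intro allI borel_measurable_scaleR)
  let ?N = "restrict_space borel {0..T} \<Otimes>\<^sub>M M"
  have [measurable]: "fst \<in> measurable ?N borel"
    by (rule measurable_compose[OF measurable_fst]) (simp add: measurable_restrict_space1)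
  have [measurable]: "(\<lambda>x. \<tau> (snd x)) \<in> measurable ?N borel"
    by (rule measurable_compose[OF measurable_snd \<tau>])
  have "(\<lambda>p. indicator {x \<in> space ?N. 0 \<le> fst x \<and> fst x \<le> \<tau> (snd x)} p :: real) \<in> borel_measurable ?N"
    by measurable
  also have "?this \<longleftrightarrow> (\<lambda>p. indicator {0..\<tau> (snd p)} (fst p) :: real) \<in> borel_measurable ?N"
    by (intro measurable_cong) (auto simp: indicator_def)
  finally show "(\<lambda>p. indicator {0..\<tau> (snd p)} (fst p) :: real) \<in> borel_measurable ?N" .
  show "(\<lambda>p. blinfun_apply (\<Phi> (fst p) (snd p)) h) \<in> borel_measurable ?N" for h
    using \<Phi> by (simp add: op_measurable_def jointly_measurable_def case_prod_unfold)
qed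

context wiener_space
begin

text \<open>Each integrand is cut off at its own localizing time, and the square integrable bound is
  applied to the difference of the stopped integrals. As the localization is removed, the left side
  is controlled by Fatou's lemma and the right side converges by dominated convergence, for which
  both energies must be finite.\<close>

lemma ito_integral_diff_doob:
  assumes I: "ito_integral M F W K e T \<Phi> Y" "ito_integral M F W K e T \<Phi>' Y'"
    and basis: "orthonormal_basis K e"
    and fin: "energy K e M T \<Phi> < \<infinity>" "energy K e M T \<Phi>' < \<infinity>"
    and t: "0 \<le> t 0" "mono t" "t N \<le> T"
  shows "(\<integral>\<^sup>+\<omega>. (SUP k\<in>{..N::nat}. ennreal ((norm (Y (t k) \<omega> - Y' (t k) \<omega>))\<^sup>2)) \<partial>M)
    \<le> 16 * energy K e M (t N) (\<lambda>s \<omega>. \<Phi> s \<omega> - \<Phi>' s \<omega>)"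
proof -
  have tk: "t k \<in> {0..T}" if "k \<le> N" for k
    using t monoD[OF t(2), of 0 k] monoD[OF t(2) that] by auto
  have T: "0 \<le> T" "0 \<le> t N" using tk[of N] by auto
  obtain \<tau> where \<tau>: "\<And>m. \<tau> m \<in> borel_measurable M" "\<And>m \<omega>. \<omega> \<in> space M \<Longrightarrow> 0 \<le> \<tau> m \<omega>"
    and ev: "AE \<omega> in M. eventually (\<lambda>m. T \<le> \<tau> m \<omega>) sequentially"
    and L: "\<And>m. ito_integral_L2 M F W K e T
      (\<lambda>s \<omega>. indicator {0..\<tau> m \<omega>} s *\<^sub>R \<Phi> s \<omega>) (\<lambda>t \<omega>. Y (min t (\<tau> m \<omega>)) \<omega>)"
    using ito_integral_localized[OF I(1)] by blast
  note m\<Phi> = ito_integral_op_measurable[OF I(1) T(1)] and mY = ito_integral_jointly_measurable[OF I(1) T(1)]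
  obtain \<tau>' where \<tau>': "\<And>m. \<tau>' m \<in> borel_measurable M" "\<And>m \<omega>. \<omega> \<in> space M \<Longrightarrow> 0 \<le> \<tau>' m \<omega>"
    and ev': "AE \<omega> in M. eventually (\<lambda>m. T \<le> \<tau>' m \<omega>) sequentially"
    and L': "\<And>m. ito_integral_L2 M F W K e T
      (\<lambda>s \<omega>. indicator {0..\<tau>' m \<omega>} s *\<^sub>R \<Phi>' s \<omega>) (\<lambda>t \<omega>. Y' (min t (\<tau>' m \<omega>)) \<omega>)"
    using ito_integral_localized[OF I(2)] by blast
  note m\<Phi>' = ito_integral_op_measurable[OF I(2) T(1)] and mY' = ito_integral_jointly_measurable[OF I(2) T(1)]
  define \<Psi> where "\<Psi> m s \<omega> = indicator {0..\<tau> m \<omega>} s *\<^sub>R \<Phi> s \<omega> - indicator {0..\<tau>' m \<omega>} s *\<^sub>R \<Phi>' s \<omega>" for m s \<omega>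
  define Z where "Z m s \<omega> = Y (min s (\<tau> m \<omega>)) \<omega> - Y' (min s (\<tau>' m \<omega>)) \<omega>" for m s \<omega>
  have m\<Psi>: "op_measurable T M (\<Psi> m)" for m
    unfolding \<Psi>_def[abs_def] by (intro op_measurable_diff op_measurable_stopped m\<Phi> m\<Phi>' \<tau>(1) \<tau>'(1))
  have mYs: "(\<lambda>\<omega>. Y (min s (\<tau> m \<omega>)) \<omega>) \<in> borel_measurable M"
    "(\<lambda>\<omega>. Y' (min s (\<tau>' m \<omega>)) \<omega>) \<in> borel_measurable M" if "s \<in> {0..T}" for s m
    using jointly_measurable_section[OF jointly_measurable_stopped[OF mY \<tau>] that]
      jointly_measurable_section[OF jointly_measurable_stopped[OF mY' \<tau>'] that] by auto
  have mZ: "Z m s \<in> borel_measurable M" if "s \<in> {0..T}" for m s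
    unfolding Z_def[abs_def] using mYs[OF that] by auto
  have LZ: "ito_integral_L2 M F W K e T (\<Psi> m) (Z m)" for m
    unfolding \<Psi>_def[abs_def] Z_def[abs_def]
    by (rule ito_integral_L2_diff[OF L L']) (auto intro!: op_measurable_stopped m\<Phi> m\<Phi>' \<tau>(1) \<tau>'(1) T mYs)
  have bound: "(\<integral>\<^sup>+\<omega>. (SUP k\<in>{..N}. ennreal ((norm (Z m (t k) \<omega>))\<^sup>2)) \<partial>M) \<le> 16 * energy K e M (t N) (\<Psi> m)" for m
    by (rule ito_integral_L2_doob[OF LZ basis m\<Psi> t mZ])
  have lim: "(\<lambda>m. energy K e M (t N) (\<Psi> m)) \<longlonglongrightarrow> energy K e M (t N) (\<lambda>s \<omega>. \<Phi> s \<omega> - \<Phi>' s \<omega>)"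
    unfolding time_exp_def
  \<comment> \<open>The majorant is twice the sum of the squared Hilbert--Schmidt norms of the uncut
    integrands.\<close>
  proof (rule nn_integral_dominated_convergence)
    let ?w = "\<lambda>\<omega>. \<integral>\<^sup>+s\<in>{0..t N}. (2 * hs_sq K e (\<Phi> s \<omega>) + 2 * hs_sq K e (\<Phi>' s \<omega>)) \<partial>lborel"
    show "(\<lambda>\<omega>. \<integral>\<^sup>+s\<in>{0..t N}. hs_sq K e (\<Psi> m s \<omega>) \<partial>lborel) \<in> borel_measurable M" for m
      by (rule measurable_time_integral[OF op_measurable_hs_sq[OF m\<Psi>] T(1) t(3)])
    show "(\<lambda>\<omega>. \<integral>\<^sup>+s\<in>{0..t N}. hs_sq K e (\<Phi> s \<omega> - \<Phi>' s \<omega>) \<partial>lborel) \<in> borel_measurable M"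
      by (rule measurable_time_integral[OF op_measurable_hs_sq[OF op_measurable_diff[OF m\<Phi> m\<Phi>']] T(1) t(3)])
    have jm: "jointly_measurable T M (\<lambda>s \<omega>. 2 * hs_sq K e (\<Phi> s \<omega>) + 2 * hs_sq K e (\<Phi>' s \<omega>))"
      using op_measurable_hs_sq[OF m\<Phi>, of K e] op_measurable_hs_sq[OF m\<Phi>', of K e]
      unfolding jointly_measurable_def case_prod_unfold by measurable
    show "?w \<in> borel_measurable M" by (rule measurable_time_integral[OF jm T(1) t(3)])
    have ind: "hs_sq K e (indicator A s *\<^sub>R B) \<le> hs_sq K e B" for A :: "real set" and s and B :: "'h \<Rightarrow>\<^sub>L 'h"
      by (simp add: indicator_def)
    have "hs_sq K e (\<Psi> m s \<omega>) \<le> 2 * hs_sq K e (\<Phi> s \<omega>) + 2 * hs_sq K e (\<Phi>' s \<omega>)" for m s \<omega>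
      unfolding \<Psi>_def
      by (intro order.trans[OF hs_sq_diff_le] add_mono mult_left_mono ind) auto
    then show "AE \<omega> in M. (\<integral>\<^sup>+s\<in>{0..t N}. hs_sq K e (\<Psi> m s \<omega>) \<partial>lborel) \<le> ?w \<omega>" for m
      by (intro AE_I2 nn_integral_mono mult_right_mono) auto
    have "(\<integral>\<^sup>+\<omega>. ?w \<omega> \<partial>M) \<le> 2 * energy K e M (t N) \<Phi> + 2 * energy K e M (t N) \<Phi>'"
      unfolding time_exp_def[symmetric]
      by (rule time_exp_le_2_add[OF _ op_measurable_hs_sq[OF m\<Phi>] op_measurable_hs_sq[OF m\<Phi>'] T(1) t(3)]) simp
    also have "\<dots> \<le> 2 * energy K e M T \<Phi> + 2 * energy K e M T \<Phi>'"
      by (intro add_mono mult_left_mono time_exp_mono_time t) auto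
    also have "\<dots> < \<infinity>" using fin by (simp add: ennreal_mult_less_top)
    finally show "(\<integral>\<^sup>+\<omega>. ?w \<omega> \<partial>M) < \<infinity>" .
    \<comment> \<open>For almost every path both localizing times eventually exceed T, and from then
      on the sequence is constant.\<close>
    show "AE \<omega> in M. (\<lambda>m. \<integral>\<^sup>+s\<in>{0..t N}. hs_sq K e (\<Psi> m s \<omega>) \<partial>lborel)
      \<longlonglongrightarrow> (\<integral>\<^sup>+s\<in>{0..t N}. hs_sq K e (\<Phi> s \<omega> - \<Phi>' s \<omega>) \<partial>lborel)"
      using ev ev'
    proof eventually_elim
      case (elim \<omega>)
      then have "eventually (\<lambda>m. (\<integral>\<^sup>+s\<in>{0..t N}. hs_sq K e (\<Psi> m s \<omega>) \<partial>lborel)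
        = (\<integral>\<^sup>+s\<in>{0..t N}. hs_sq K e (\<Phi> s \<omega> - \<Phi>' s \<omega>) \<partial>lborel)) sequentially"
      proof eventually_elim
        case (elim m)
        then show ?case
          using t(3) by (intro nn_integral_cong) (auto simp: indicator_def \<Psi>_def)
      qed
      then show ?case by (rule tendsto_eventually)
    qed
  qed
  have "(\<integral>\<^sup>+\<omega>. (SUP k\<in>{..N}. ennreal ((norm (Y (t k) \<omega> - Y' (t k) \<omega>))\<^sup>2)) \<partial>M) \<le>
     (\<integral>\<^sup>+\<omega>. liminf (\<lambda>m. SUP k\<in>{..N}. ennreal ((norm (Z m (t k) \<omega>))\<^sup>2)) \<partial>M)"
  proof (rule nn_integral_mono_AE)
    show "AE \<omega> in M. (SUP k\<in>{..N}. ennreal ((norm (Y (t k) \<omega> - Y' (t k) \<omega>))\<^sup>2)) \<le>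
       liminf (\<lambda>m. SUP k\<in>{..N}. ennreal ((norm (Z m (t k) \<omega>))\<^sup>2))"
      using ev ev'
    proof eventually_elim
      case (elim \<omega>)
      then have "eventually (\<lambda>m. (SUP k\<in>{..N}. ennreal ((norm (Y (t k) \<omega> - Y' (t k) \<omega>))\<^sup>2)) \<le>
        (SUP k\<in>{..N}. ennreal ((norm (Z m (t k) \<omega>))\<^sup>2))) sequentially"
      proof eventually_elim
        case (elim m)
        then have "min (t k) (\<tau> m \<omega>) = t k" "min (t k) (\<tau>' m \<omega>) = t k" if "k \<le> N" for k
          using tk[OF that] by auto
        then have "Z m (t k) \<omega> = Y (t k) \<omega> - Y' (t k) \<omega>" if "k \<le> N" for k
          using that by (simp add: Z_def)
        then show ?case by (intro SUP_mono) auto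
      qed
      then show ?case by (rule Liminf_bounded)
    qed
  qed
  also have "\<dots> \<le> liminf (\<lambda>m. \<integral>\<^sup>+\<omega>. (SUP k\<in>{..N}. ennreal ((norm (Z m (t k) \<omega>))\<^sup>2)) \<partial>M)"
    using mZ tk by (intro nn_integral_liminf borel_measurable_SUP) auto
  also have "\<dots> \<le> liminf (\<lambda>m. 16 * energy K e M (t N) (\<Psi> m))"
    using bound by (intro Liminf_mono) auto
  also have "\<dots> = 16 * energy K e M (t N) (\<lambda>s \<omega>. \<Phi> s \<omega> - \<Phi>' s \<omega>)"
    by (intro lim_imp_Liminf ennreal_tendsto_cmult lim) auto
  finally show ?thesis .
qed

text \<open>The majorant is the lower limit of maxima over equidistant grids. It is measurable,
  Fatou's lemma bounds its integral by the common bound for finite grids, and continuity of the path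
  makes it dominate every time. A lower limit is taken because successive grids are not
  nested.\<close>

lemma sup_over_path:
  fixes U :: "real \<Rightarrow> 'w \<Rightarrow> 'b::real_normed_vector"
  assumes T: "0 < T" and cont: "AE \<omega> in M. continuous_on {0..T} (\<lambda>t. U t \<omega>)"
    and meas: "\<And>s. s \<in> {0..T} \<Longrightarrow> (\<lambda>\<omega>. ennreal ((norm (U s \<omega>))\<^sup>2)) \<in> borel_measurable M"
    and bound: "\<And>t N. 0 \<le> t 0 \<Longrightarrow> mono t \<Longrightarrow> t N \<le> T \<Longrightarrow>
      (\<integral>\<^sup>+\<omega>. (SUP k\<in>{..N::nat}. ennreal ((norm (U (t k) \<omega>))\<^sup>2)) \<partial>M) \<le> C"
  obtains G where "G \<in> borel_measurable M" "(\<integral>\<^sup>+\<omega>. G \<omega> \<partial>M) \<le> C"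
    "AE \<omega> in M. \<forall>s\<in>{0..T}. ennreal ((norm (U s \<omega>))\<^sup>2) \<le> G \<omega>"
proof -
  define t where "t N k = T * real k / real (Suc N)" for N k
  have t_in: "t N k \<in> {0..T}" if "k \<le> Suc N" for N k
  proof -
    have "T * real k \<le> T * real (Suc N)" using T that by (intro mult_left_mono) auto
    then show ?thesis using T by (auto simp: t_def divide_le_eq)
  qed
  \<comment> \<open>The index runs up to \<open>Suc N\<close> so that the grid contains both 0 and
    T.\<close>
  define S where "S N \<omega> = (SUP k\<in>{..Suc N}. ennreal ((norm (U (t N k) \<omega>))\<^sup>2))" for N \<omega>
  have S_meas: "S N \<in> borel_measurable M" for N
    unfolding S_def[abs_def] using t_in by (intro borel_measurable_SUP meas) auto
  have S_int: "(\<integral>\<^sup>+\<omega>. S N \<omega> \<partial>M) \<le> C" for N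
    unfolding S_def
    by (rule bound) (use T t_in[of "Suc N" N] in \<open>auto simp: t_def mono_def intro!: divide_right_mono mult_left_mono\<close>)
  show thesis
  proof (rule that[of "\<lambda>\<omega>. liminf (\<lambda>N. S N \<omega>)"])
    show "(\<lambda>\<omega>. liminf (\<lambda>N. S N \<omega>)) \<in> borel_measurable M"
      using S_meas by measurable
    have "(\<integral>\<^sup>+\<omega>. liminf (\<lambda>N. S N \<omega>) \<partial>M) \<le> liminf (\<lambda>N. \<integral>\<^sup>+\<omega>. S N \<omega> \<partial>M)"
      using S_meas by (rule nn_integral_liminf)
    also have "\<dots> \<le> liminf (\<lambda>N::nat. C)" using S_int by (intro Liminf_mono) auto
    finally show "(\<integral>\<^sup>+\<omega>. liminf (\<lambda>N. S N \<omega>) \<partial>M) \<le> C" by (simp add: Liminf_const)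
    show "AE \<omega> in M. \<forall>s\<in>{0..T}. ennreal ((norm (U s \<omega>))\<^sup>2) \<le> liminf (\<lambda>N. S N \<omega>)"
      using cont
    proof eventually_elim
      case (elim \<omega>)
      show ?case
      proof
        fix s assume s: "s \<in> {0..T}"
        \<comment> \<open>The index of the last grid point at or before s; its distance to s is at
          most the mesh \<open>T / real (Suc N)\<close>.\<close>
        define k where "k N = nat \<lfloor>s * real (Suc N) / T\<rfloor>" for N
        have k_bounds: "real (k N) \<le> s * real (Suc N) / T" "s * real (Suc N) / T < real (k N) + 1" for N
        proof -
          have "0 \<le> s * real (Suc N) / T" using s T by auto
          then show "real (k N) \<le> s * real (Suc N) / T" "s * real (Suc N) / T < real (k N) + 1"
            unfolding k_def by linarith+
        qed
        have kN: "k N \<le> Suc N" for N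
        proof -
          have "s * real (Suc N) / T \<le> real (Suc N)"
            using s T by (simp add: divide_le_eq mult.commute mult_left_mono)
          then show ?thesis using k_bounds(1)[of N] by linarith
        qed
        have up: "t N (k N) \<le> s" for N
          using k_bounds(1)[of N] T by (simp add: t_def field_simps)
        have lo: "s - T / real (Suc N) \<le> t N (k N)" for N
        proof -
          have "s * real (Suc N) < (real (k N) + 1) * T"
            using k_bounds(2)[of N] T by (simp add: divide_less_eq del: of_nat_Suc)
          then have "(s * real (Suc N) - T) / real (Suc N) \<le> T * real (k N) / real (Suc N)"
            by (intro divide_right_mono) (auto simp: algebra_simps)
          then show ?thesis by (simp add: t_def diff_divide_distrib del: of_nat_Suc)
        qed
        have "(\<lambda>N. s - T / real (Suc N)) \<longlonglongrightarrow> s - 0"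
          by (intro tendsto_diff tendsto_const LIMSEQ_Suc lim_const_over_n)
        then have "(\<lambda>N. t N (k N)) \<longlonglongrightarrow> s"
          by (intro tendsto_sandwich[of "\<lambda>N. s - T / real (Suc N)" "\<lambda>N. t N (k N)" sequentially "\<lambda>_. s"])
             (auto simp: up lo simp del: of_nat_Suc)
        then have "(\<lambda>N. U (t N (k N)) \<omega>) \<longlonglongrightarrow> U s \<omega>"
          using continuous_on_tendsto_compose[OF elim, of "\<lambda>N. t N (k N)" s sequentially] s t_in[OF kN] by auto
        then have "(\<lambda>N. ennreal ((norm (U (t N (k N)) \<omega>))\<^sup>2)) \<longlonglongrightarrow> ennreal ((norm (U s \<omega>))\<^sup>2)"
          by (intro tendsto_ennrealI tendsto_power tendsto_norm)
        then have "ennreal ((norm (U s \<omega>))\<^sup>2) = liminf (\<lambda>N. ennreal ((norm (U (t N (k N)) \<omega>))\<^sup>2))"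
          by (intro lim_imp_Liminf[symmetric]) auto
        also have "\<dots> \<le> liminf (\<lambda>N. S N \<omega>)"
          unfolding S_def using kN by (intro Liminf_mono always_eventually allI SUP_upper) auto
        finally show "ennreal ((norm (U s \<omega>))\<^sup>2) \<le> liminf (\<lambda>N. S N \<omega>)" .
      qed
    qed
  qed
qed

end

section \<open>A priori bound for strong solutions\<close>

text \<open>
  Integrating against \<open>exp (- 2 B t)\<close> turns the last term of the hypothesis into at most half of the
  left-hand side, which is finite and can be absorbed.
\<close>

lemma gronwall_integrated:
  fixes v A :: "real \<Rightarrow> ennreal"
  assumes v: "(\<lambda>t. v t * indicator {0..T} t) \<in> borel_measurable lborel"
    and A: "(\<lambda>t. A t * indicator {0..T} t) \<in> borel_measurable lborel"
    and B: "0 < B"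
    and le: "\<And>t. t \<in> {0..T} \<Longrightarrow> v t \<le> A t + ennreal B * (\<integral>\<^sup>+s\<in>{0..t}. v s \<partial>lborel)"
    and fin: "(\<integral>\<^sup>+s\<in>{0..T}. v s \<partial>lborel) < \<infinity>"
  shows "(\<integral>\<^sup>+s\<in>{0..T}. v s \<partial>lborel) \<le> ennreal (2 * exp (2 * B * T)) * (\<integral>\<^sup>+s\<in>{0..T}. A s \<partial>lborel)"
proof -
  define V where "V t = v t * indicator {0..T} t" for t
  define w where "w t = exp (- (2 * B * t))" for t
  define J where "J = (\<integral>\<^sup>+t. ennreal (w t) * V t \<partial>lborel)"
  have V[measurable]: "V \<in> borel_measurable borel" using v by (simp add: V_def[abs_def])
  have A'[measurable]: "(\<lambda>t. A t * indicator {0..T} t) \<in> borel_measurable borel" using A by simp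
  have w[measurable]: "w \<in> borel_measurable borel" unfolding w_def[abs_def] by measurable
  have V_int: "(\<integral>\<^sup>+t. V t \<partial>lborel) = (\<integral>\<^sup>+s\<in>{0..T}. v s \<partial>lborel)" by (simp add: V_def)
  have w_le1: "ennreal (w t) \<le> 1" if "0 \<le> t" for t
    using B that by (simp add: w_def ennreal_le_1)
  have "J \<le> (\<integral>\<^sup>+t. V t \<partial>lborel)"
    unfolding J_def
  proof (rule nn_integral_mono)
    fix t
    show "ennreal (w t) * V t \<le> V t"
      using w_le1[of t] mult_right_mono[of "ennreal (w t)" 1 "V t"] by (auto simp: V_def indicator_def)
  qed
  then have J_fin: "J < \<infinity>" using fin V_int by simp
  let ?a = "\<integral>\<^sup>+s\<in>{0..T}. A s \<partial>lborel"
  let ?k = "\<lambda>t s. ennreal (w t) * indicator {0..T} t * (V s * indicator {0..t} s)"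
  have m: "case_prod ?k \<in> borel_measurable (lborel \<Otimes>\<^sub>M lborel)"
  proof -
    define D where "D = {p :: real \<times> real. 0 \<le> snd p \<and> snd p \<le> fst p}"
    have "{p \<in> space (borel \<Otimes>\<^sub>M borel :: (real \<times> real) measure). 0 \<le> snd p \<and> snd p \<le> fst p}
        \<in> sets (borel \<Otimes>\<^sub>M borel)" by measurable
    then have [measurable]: "D \<in> sets (borel \<Otimes>\<^sub>M borel)" by (simp add: D_def space_pair_measure)
    have "case_prod ?k = (\<lambda>p. ennreal (w (fst p)) * indicator {0..T} (fst p) * (V (snd p) * indicator D p))"
      by (auto simp: fun_eq_iff D_def indicator_def)
    moreover have "\<dots> \<in> borel_measurable (borel \<Otimes>\<^sub>M borel)" by measurable
    ultimately show ?thesis by (simp cong: measurable_cong_sets sets_pair_measure_cong)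
  qed
  \<comment> \<open>The exponent \<open>2 * B\<close> is chosen here: the mass of the weight after s
    is \<open>w s / (2 * B)\<close>, which against the factor B leaves one half.\<close>
  have tail: "(\<integral>\<^sup>+t. ennreal (w t) * indicator {s..} t \<partial>lborel) = ennreal (w s / (2 * B))" for s
  proof -
    have "(\<integral>\<^sup>+t. ennreal (w t) * indicator {s..} t \<partial>lborel) = 0 - (- w s / (2 * B))"
    proof (rule nn_integral_FTC_atLeast)
      show "DERIV (\<lambda>t. - w t / (2 * B)) x :> w x" for x
        unfolding w_def using B by (auto intro!: derivative_eq_intros)
      have "filterlim (\<lambda>t. 2 * B * t) at_top at_top"
        using B by (intro filterlim_tendsto_pos_mult_at_top[OF tendsto_const] filterlim_ident) auto
      then have "(w \<longlongrightarrow> 0) at_top"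
        unfolding w_def[abs_def]
        by (intro filterlim_compose[OF exp_at_bot] filterlim_compose[OF filterlim_uminus_at_bot_at_top])
      from tendsto_divide[OF tendsto_minus[OF this] tendsto_const[of "2 * B"]]
      show "((\<lambda>t. - w t / (2 * B)) \<longlongrightarrow> 0) at_top" using B by simp
    qed (auto simp: w_def)
    then show ?thesis by simp
  qed
  \<comment> \<open>The double integral runs over the triangle \<open>s \<le> t\<close>. Exchanging
    the order leaves the tail of the weight beyond s, cut at T, which is bounded by the full
    tail.\<close>
  have swap: "(\<integral>\<^sup>+t. (\<integral>\<^sup>+s. ?k t s \<partial>lborel) \<partial>lborel) \<le> ennreal (1 / (2 * B)) * J"
  proof -
    have "(\<integral>\<^sup>+t. (\<integral>\<^sup>+s. ?k t s \<partial>lborel) \<partial>lborel) = (\<integral>\<^sup>+s. (\<integral>\<^sup>+t. ?k t s \<partial>lborel) \<partial>lborel)"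
      using lborel_pair.Fubini'[OF m] by simp
    also have "\<dots> \<le> (\<integral>\<^sup>+s. V s * (\<integral>\<^sup>+t. ennreal (w t) * indicator {s..} t \<partial>lborel) \<partial>lborel)"
    proof (rule nn_integral_mono)
      fix s
      have "(\<integral>\<^sup>+t. ?k t s \<partial>lborel) \<le> (\<integral>\<^sup>+t. V s * (ennreal (w t) * indicator {s..} t) \<partial>lborel)"
        by (intro nn_integral_mono) (auto simp: indicator_def mult.commute)
      then show "(\<integral>\<^sup>+t. ?k t s \<partial>lborel) \<le> V s * (\<integral>\<^sup>+t. ennreal (w t) * indicator {s..} t \<partial>lborel)"
        by (simp add: nn_integral_cmult)
    qed
    also have "\<dots> = (\<integral>\<^sup>+s. ennreal (1 / (2 * B)) * (ennreal (w s) * V s) \<partial>lborel)"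
      unfolding tail using B
      by (intro nn_integral_cong) (simp add: w_def ennreal_mult[symmetric] mult_ac flip: ennreal_mult'')
    also have "\<dots> = ennreal (1 / (2 * B)) * J"
      unfolding J_def by (intro nn_integral_cmult) measurable
    finally show ?thesis .
  qed
  have "J \<le> (\<integral>\<^sup>+t. A t * indicator {0..T} t + ennreal B * (\<integral>\<^sup>+s. ?k t s \<partial>lborel) \<partial>lborel)"
    unfolding J_def
  proof (rule nn_integral_mono)
    fix t
    show "ennreal (w t) * V t \<le> A t * indicator {0..T} t + ennreal B * (\<integral>\<^sup>+s. ?k t s \<partial>lborel)"
    proof (cases "t \<in> {0..T}")
      case True
      have "(\<integral>\<^sup>+s. ?k t s \<partial>lborel) = (\<integral>\<^sup>+s. ennreal (w t) * (v s * indicator {0..t} s) \<partial>lborel)"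
        using True by (intro nn_integral_cong) (auto simp: V_def indicator_def)
      also have "\<dots> = ennreal (w t) * (\<integral>\<^sup>+s\<in>{0..t}. v s \<partial>lborel)"
      proof (rule nn_integral_cmult)
        have "(\<lambda>s. V s * indicator {0..t} s) \<in> borel_measurable lborel" by measurable
        also have "(\<lambda>s. V s * indicator {0..t} s) = (\<lambda>s. v s * indicator {0..t} s)"
          using True by (auto simp: V_def indicator_def fun_eq_iff)
        finally show "(\<lambda>s. v s * indicator {0..t} s) \<in> borel_measurable lborel" .
      qed
      finally have k: "(\<integral>\<^sup>+s. ?k t s \<partial>lborel) = ennreal (w t) * (\<integral>\<^sup>+s\<in>{0..t}. v s \<partial>lborel)" .
      have "ennreal (w t) * V t \<le> ennreal (w t) * (A t + ennreal B * (\<integral>\<^sup>+s\<in>{0..t}. v s \<partial>lborel))"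
        using le[OF True] True by (intro mult_left_mono) (auto simp: V_def)
      also have "\<dots> = ennreal (w t) * A t + ennreal B * (\<integral>\<^sup>+s. ?k t s \<partial>lborel)"
        unfolding k by (simp add: distrib_left mult_ac)
      also have "\<dots> \<le> A t + ennreal B * (\<integral>\<^sup>+s. ?k t s \<partial>lborel)"
        using w_le1[of t] True mult_right_mono[of "ennreal (w t)" 1 "A t"] by (intro add_right_mono) auto
      finally show ?thesis using True by simp
    qed (simp add: V_def)
  qed
  also have "\<dots> = ?a + (\<integral>\<^sup>+t. ennreal B * (\<integral>\<^sup>+s. ?k t s \<partial>lborel) \<partial>lborel)"
  proof (rule nn_integral_add)
    from lborel.borel_measurable_nn_integral_fst[OF m]
    show "(\<lambda>t. ennreal B * (\<integral>\<^sup>+s. ?k t s \<partial>lborel)) \<in> borel_measurable lborel" by simp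
  qed (use A in simp)
  also have "(\<integral>\<^sup>+t. ennreal B * (\<integral>\<^sup>+s. ?k t s \<partial>lborel) \<partial>lborel) = ennreal B * (\<integral>\<^sup>+t. (\<integral>\<^sup>+s. ?k t s \<partial>lborel) \<partial>lborel)"
  proof (rule nn_integral_cmult)
    from lborel.borel_measurable_nn_integral_fst[OF m]
    show "(\<lambda>t. (\<integral>\<^sup>+s. ?k t s \<partial>lborel)) \<in> borel_measurable lborel" by simp
  qed
  also have "ennreal B * (\<integral>\<^sup>+t. (\<integral>\<^sup>+s. ?k t s \<partial>lborel) \<partial>lborel) \<le> ennreal B * (ennreal (1 / (2 * B)) * J)"
    by (intro mult_left_mono swap) auto
  also have "ennreal B * (ennreal (1 / (2 * B)) * J) = ennreal (1 / 2) * J"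
    using B by (simp add: mult.assoc[symmetric] ennreal_mult[symmetric])
  finally have J_le: "J \<le> ?a + ennreal (1 / 2) * J" by (simp add: add_left_mono)
  \<comment> \<open>Absorbing half of \<open>J\<close> is legitimate because \<open>J\<close> is
    finite; an infinite right-hand side makes the claim trivial.\<close>
  have J2: "J \<le> 2 * ?a"
  proof (cases "?a = \<infinity>")
    case False
    then obtain a where a: "?a = ennreal a" "0 \<le> a" by (cases ?a) auto
    obtain j where j: "J = ennreal j" "0 \<le> j" using J_fin by (cases J) auto
    have "ennreal (a + 1 / 2 * j) = ennreal a + ennreal (1 / 2 * j)"
      using a j by (intro ennreal_plus) auto
    also have "ennreal (1 / 2 * j) = ennreal (1 / 2) * ennreal j"
      using j by (intro ennreal_mult) auto
    finally have "ennreal j \<le> ennreal (a + 1 / 2 * j)"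
      using J_le unfolding a j by (simp only:)
    then have "j \<le> 2 * a" using a j by (subst (asm) ennreal_le_iff) auto
    then have "ennreal j \<le> ennreal (2 * a)" by (rule ennreal_leI)
    then show ?thesis using a j by (simp add: ennreal_mult)
  qed (simp add: ennreal_mult_top)
  \<comment> \<open>The weight is undone: on \<open>[0, T]\<close> it is at least
    \<open>exp (- (2 * B * T))\<close>.\<close>
  have "(\<integral>\<^sup>+t. V t \<partial>lborel) \<le> (\<integral>\<^sup>+t. ennreal (exp (2 * B * T)) * (ennreal (w t) * V t) \<partial>lborel)"
  proof (rule nn_integral_mono)
    fix t
    show "V t \<le> ennreal (exp (2 * B * T)) * (ennreal (w t) * V t)"
    proof (cases "t \<in> {0..T}")
      case True
      then have "1 \<le> exp (2 * B * T) * w t"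
        using B by (simp add: w_def exp_add[symmetric])
      then have "1 \<le> ennreal (exp (2 * B * T)) * ennreal (w t)"
        by (simp add: ennreal_mult[symmetric] w_def)
      from mult_right_mono[OF this, of "V t"] show ?thesis by (simp add: mult.assoc)
    qed (simp add: V_def)
  qed
  also have "\<dots> = ennreal (exp (2 * B * T)) * J"
    unfolding J_def by (intro nn_integral_cmult) measurable
  also have "\<dots> \<le> ennreal (exp (2 * B * T)) * (2 * ?a)" by (intro mult_left_mono J2) auto
  also have "\<dots> = ennreal (2 * exp (2 * B * T)) * ?a" by (simp add: ennreal_mult mult_ac)
  finally show ?thesis unfolding V_int .
qed

text \<open>Cauchy--Schwarz against the indicator of the interval, whose squared norm is the factor
  t.\<close>

lemma norm_set_integral_sq_le:
  fixes f :: "real \<Rightarrow> 'b::{banach, second_countable_topology}"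
  assumes f: "set_integrable lborel {0..t} f" and t: "0 \<le> t"
  shows "ennreal ((norm (set_lebesgue_integral lborel {0..t} f))\<^sup>2) \<le>
    ennreal t * (\<integral>\<^sup>+s\<in>{0..t}. ennreal ((norm (f s))\<^sup>2) \<partial>lborel)"
proof -
  let ?g = "\<lambda>s. indicator {0..t} s *\<^sub>R f s"
  have i: "integrable lborel ?g" using f by (simp add: set_integrable_def)
  then have [measurable]: "?g \<in> borel_measurable lborel" by simp
  have "ennreal (norm (set_lebesgue_integral lborel {0..t} f)) \<le> (\<integral>\<^sup>+s. ennreal (norm (?g s)) \<partial>lborel)"
    unfolding set_lebesgue_integral_def by (rule integral_norm_bound_ennreal[OF i])
  also have "\<dots> = (\<integral>\<^sup>+s. ennreal (norm (?g s)) * indicator {0..t} s \<partial>lborel)"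
    by (intro nn_integral_cong) (auto simp: indicator_def)
  finally have "(ennreal (norm (set_lebesgue_integral lborel {0..t} f)))\<^sup>2 \<le>
      (\<integral>\<^sup>+s. ennreal (norm (?g s)) * indicator {0..t} s \<partial>lborel)\<^sup>2"
    by (rule power_mono) simp
  also have "\<dots> \<le> (\<integral>\<^sup>+s. (ennreal (norm (?g s)))\<^sup>2 \<partial>lborel) * (\<integral>\<^sup>+s. (indicator {0..t} s)\<^sup>2 \<partial>lborel)"
    by (rule Cauchy_Schwarz_nn_integral) measurable
  also have "(\<integral>\<^sup>+s. (ennreal (norm (?g s)))\<^sup>2 \<partial>lborel) = (\<integral>\<^sup>+s\<in>{0..t}. ennreal ((norm (f s))\<^sup>2) \<partial>lborel)"
    by (intro nn_integral_cong) (auto simp: indicator_def ennreal_power)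
  also have "(\<integral>\<^sup>+s. (indicator {0..t} s)\<^sup>2 \<partial>lborel) = (\<integral>\<^sup>+s. indicator {0..t} s \<partial>lborel)"
    by (intro nn_integral_cong) (auto simp: indicator_def)
  also have "\<dots> = ennreal t" using t by simp
  finally show ?thesis by (simp add: ennreal_power mult.commute)
qed

context wiener_space
begin

text \<open>Some elementary process lies at squared distance less than 1, and elementary processes
  have finite energy by the isometry. This makes the pathwise Gronwall bound integrable before any
  moment of the solution is known.\<close>

lemma ito_integral_L2_energy_finite:
  assumes I: "ito_integral_L2 M F W K e T \<Psi> Z" and basis: "orthonormal_basis K e"
    and \<Psi>: "op_measurable T M \<Psi>" and T: "0 \<le> T"
  shows "energy K e M T \<Psi> < \<infinity>"
proof -
  obtain \<phi> where \<phi>: "\<And>m. elementary F (\<phi> m)"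
    and lim\<phi>: "(\<lambda>m. energy K e M T (\<lambda>s \<omega>. elem_process (\<phi> m) s \<omega> - \<Psi> s \<omega>)) \<longlonglongrightarrow> 0"
    using I unfolding ito_integral_L2_def time_exp_def by blast
  have "eventually (\<lambda>m. energy K e M T (\<lambda>s \<omega>. elem_process (\<phi> m) s \<omega> - \<Psi> s \<omega>) < 1) sequentially"
    using lim\<phi> by (rule order_tendstoD) simp
  then obtain m where m: "energy K e M T (\<lambda>s \<omega>. elem_process (\<phi> m) s \<omega> - \<Psi> s \<omega>) < 1"
    by (auto simp: eventually_sequentially)
  let ?\<phi> = "\<phi> m :: ('w, 'h) elem"
  have "energy K e M T (elem_process ?\<phi>) = (\<integral>\<^sup>+\<omega>. ennreal ((norm (elem_integral W ?\<phi> T \<omega>))\<^sup>2) \<partial>M)"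
    unfolding time_exp_def by (rule elem_integral_isometry[OF \<phi> T basis, symmetric])
  also have "\<dots> < \<infinity>"
    using integrable.intros[OF has_integral_elem_integral_sq[OF \<phi> T]] by (simp add: nn_integral_eq_integral)
  finally have e: "energy K e M T (elem_process ?\<phi>) < \<infinity>" .
  have "energy K e M T \<Psi> \<le> 2 * energy K e M T (elem_process ?\<phi>) +
      2 * energy K e M T (\<lambda>s \<omega>. elem_process ?\<phi> s \<omega> - \<Psi> s \<omega>)"
  proof (rule time_exp_le_2_add)
    show "hs_sq K e (\<Psi> s \<omega>) \<le> 2 * hs_sq K e (elem_process ?\<phi> s \<omega>) +
        2 * hs_sq K e (elem_process ?\<phi> s \<omega> - \<Psi> s \<omega>)" for s \<omega>
      using hs_sq_diff_le[of K e "elem_process ?\<phi> s \<omega>" "elem_process ?\<phi> s \<omega> - \<Psi> s \<omega>"] by simp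
  qed (use T in \<open>auto intro!: op_measurable_hs_sq op_measurable_diff op_measurable_elem_process \<phi> \<Psi>\<close>)
  also have "\<dots> < \<infinity>" using e order.strict_trans[OF m, of \<infinity>] by (simp add: ennreal_mult_less_top)
  finally show ?thesis .
qed

text \<open>The maximal inequality on a grid with a single point.\<close>

lemma ito_integral_L2_second_moment:
  assumes "ito_integral_L2 M F W K e T \<Psi> Z" "orthonormal_basis K e" "op_measurable T M \<Psi>"
    and "t \<in> {0..T}" "\<And>s. s \<in> {0..T} \<Longrightarrow> Z s \<in> borel_measurable M"
  shows "(\<integral>\<^sup>+\<omega>. ennreal ((norm (Z t \<omega>))\<^sup>2) \<partial>M) \<le> 16 * energy K e M t \<Psi>"
  using ito_integral_L2_doob[OF assms(1-3), of "\<lambda>_. t" 0] assms(4,5) by (simp add: mono_def)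

text \<open>
  Gronwall's inequality is used twice for the stopped process: pathwise, to see that its second
  moment is integrable in time, and then in expectation, for a bound independent of the stopping time.
\<close>

lemma strong_solution_second_moment:
  fixes X :: "real \<Rightarrow> 'w \<Rightarrow> 'h"
  assumes sol: "strong_solution M F W K e T f S X0 X" and basis: "orthonormal_basis K e" and T: "0 < T"
    and X0: "X0 \<in> borel_measurable M" "(\<integral>\<^sup>+\<omega>. ennreal ((norm (X0 \<omega>))\<^sup>2) \<partial>M) < \<infinity>"
    and c: "0 < c"
    and f: "\<And>s x. s \<in> {0..T} \<Longrightarrow> (norm (f s x))\<^sup>2 \<le> c * (1 + (norm x)\<^sup>2)"
    and S: "\<And>s x. s \<in> {0..T} \<Longrightarrow> hs_sq K e (S s x) \<le> ennreal (c * (1 + (norm x)\<^sup>2))"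
  shows "\<exists>B<\<infinity>. \<forall>t\<in>{0..T}. (\<integral>\<^sup>+\<omega>. ennreal ((norm (X t \<omega>))\<^sup>2) \<partial>M) \<le> B"
proof -
  have T0: "0 \<le> T" using T by simp
  obtain Y where I: "ito_integral M F W K e T (\<lambda>s \<omega>. S s (X s \<omega>)) Y"
    and eq: "AE \<omega> in M. \<forall>t\<in>{0..T}.
      X t \<omega> = X0 \<omega> + set_lebesgue_integral lborel {0..t} (\<lambda>s. f s (X s \<omega>)) + Y t \<omega>"
    and cont: "AE \<omega> in M. continuous_on {0..T} (\<lambda>t. X t \<omega>)"
    and fint: "AE \<omega> in M. set_integrable lborel {0..T} (\<lambda>s. f s (X s \<omega>))"
    and prog: "progressive F T X"
    using sol unfolding strong_solution_def by blast
  have mX: "jointly_measurable T M X" using prog T0 by (rule progressive_jointly_measurable)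
  have mY: "jointly_measurable T M Y" using I T0 by (rule ito_integral_jointly_measurable)
  have m\<Phi>: "op_measurable T M (\<lambda>s \<omega>. S s (X s \<omega>))" using I T0 by (rule ito_integral_op_measurable)
  obtain \<tau> where \<tau>: "\<And>m. \<tau> m \<in> borel_measurable M" "\<And>m \<omega>. \<omega> \<in> space M \<Longrightarrow> 0 \<le> \<tau> m \<omega>"
    and ev: "AE \<omega> in M. eventually (\<lambda>m. T \<le> \<tau> m \<omega>) sequentially"
    and L: "\<And>m. ito_integral_L2 M F W K e T
      (\<lambda>s \<omega>. indicator {0..\<tau> m \<omega>} s *\<^sub>R S s (X s \<omega>)) (\<lambda>t \<omega>. Y (min t (\<tau> m \<omega>)) \<omega>)"
    using ito_integral_localized[OF I] by blast
  define \<Psi> where "\<Psi> m s \<omega> = indicator {0..\<tau> m \<omega>} s *\<^sub>R S s (X s \<omega>)" for m s \<omega>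
  have m\<Psi>: "op_measurable T M (\<Psi> m)" for m
    unfolding \<Psi>_def[abs_def] by (intro op_measurable_stopped m\<Phi> \<tau>(1))
  define v where "v m s \<omega> = ennreal ((norm (X (min s (\<tau> m \<omega>)) \<omega>))\<^sup>2)" for m s \<omega>
  define y where "y m s \<omega> = ennreal ((norm (Y (min s (\<tau> m \<omega>)) \<omega>))\<^sup>2)" for m s \<omega>
  define x0 where "x0 \<omega> = ennreal ((norm (X0 \<omega>))\<^sup>2)" for \<omega>
  define E0 where "E0 = (\<integral>\<^sup>+\<omega>. x0 \<omega> \<partial>M)"
  have mXs: "jointly_measurable T M (\<lambda>s \<omega>. X (min s (\<tau> m \<omega>)) \<omega>)"
    and mYs: "jointly_measurable T M (\<lambda>s \<omega>. Y (min s (\<tau> m \<omega>)) \<omega>)" for m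
    using jointly_measurable_stopped[OF mX \<tau>] jointly_measurable_stopped[OF mY \<tau>] by auto
  have mv: "jointly_measurable T M (v m)" and my: "jointly_measurable T M (y m)" for m
    using mXs[of m] mYs[of m] unfolding v_def[abs_def] y_def[abs_def] jointly_measurable_def case_prod_unfold
    by measurable
  have mx0[measurable]: "x0 \<in> borel_measurable M" using X0(1) unfolding x0_def[abs_def] by measurable
  note mvt = jointly_measurable_section[OF mv] and myt = jointly_measurable_section[OF my]
  have E0: "E0 < \<infinity>" using X0(2) by (simp add: E0_def x0_def)
  \<comment> \<open>The factor 3 comes from the square of a sum of three terms, T from
    Cauchy--Schwarz in time, and c from the growth of the drift.\<close>
  define B1 where "B1 = 3 * T * c"
  have B1: "0 < B1" using T c by (simp add: B1_def)
  define A where "A m t \<omega> = 3 * x0 \<omega> + ennreal (B1 * T) + 3 * y m t \<omega>" for m t \<omega>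
  have mA: "jointly_measurable T M (A m)" for m
  proof -
    have "jointly_measurable T M (\<lambda>_. x0)" by simp
    then show ?thesis
      using my[of m] unfolding A_def[abs_def] jointly_measurable_def case_prod_unfold by measurable
  qed
  have path: "AE \<omega> in M. \<forall>t\<in>{0..T}. v m t \<omega> \<le> A m t \<omega> + ennreal B1 * (\<integral>\<^sup>+s\<in>{0..t}. v m s \<omega> \<partial>lborel)" for m
    using eq fint AE_space
  proof eventually_elim
    case (elim \<omega>)
    show ?case
    proof
      fix t assume t: "t \<in> {0..T}"
      \<comment> \<open>The equation is read at the stopped time. The drift integral up to
        \<open>t'\<close> sees only times at which the stopped process agrees with \<open>X\<close>,
        so it can be enlarged to \<open>[0, t]\<close> in terms of \<open>v m\<close>.\<close>
      define t' where "t' = min t (\<tau> m \<omega>)"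
      have t': "0 \<le> t'" "t' \<le> t" "t' \<le> T" "t' \<le> \<tau> m \<omega>"
        using t \<tau>(2)[OF elim(3), of m] by (auto simp: t'_def)
      have "set_integrable lborel {0..t'} (\<lambda>s. f s (X s \<omega>))"
        by (rule set_integrable_subset[OF elim(2)]) (use t' in auto)
      from norm_set_integral_sq_le[OF this t'(1)]
      have "ennreal ((norm (set_lebesgue_integral lborel {0..t'} (\<lambda>s. f s (X s \<omega>))))\<^sup>2) \<le>
          ennreal t' * (\<integral>\<^sup>+s\<in>{0..t'}. ennreal ((norm (f s (X s \<omega>)))\<^sup>2) \<partial>lborel)" .
      also have "\<dots> \<le> ennreal T * (\<integral>\<^sup>+s. ennreal c * (indicator {0..t} s + v m s \<omega> * indicator {0..t} s) \<partial>lborel)"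
      proof (rule mult_mono[OF ennreal_leI[OF t'(3)] nn_integral_mono])
        fix s
        show "ennreal ((norm (f s (X s \<omega>)))\<^sup>2) * indicator {0..t'} s \<le>
            ennreal c * (indicator {0..t} s + v m s \<omega> * indicator {0..t} s)"
        proof (cases "s \<in> {0..t'}")
          case True
          then have s: "s \<in> {0..T}" "s \<in> {0..t}" "min s (\<tau> m \<omega>) = s" using t' by auto
          have "ennreal ((norm (f s (X s \<omega>)))\<^sup>2) \<le> ennreal (c * (1 + (norm (X s \<omega>))\<^sup>2))"
            by (intro ennreal_leI f s)
          also have "\<dots> = ennreal c * (1 + v m s \<omega>)"
            using c s by (simp add: v_def ennreal_mult)
          finally show ?thesis using True s by simp
        qed simp
      qed auto
      also have "(\<integral>\<^sup>+s. ennreal c * (indicator {0..t} s + v m s \<omega> * indicator {0..t} s) \<partial>lborel) =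
          ennreal c * (ennreal t + (\<integral>\<^sup>+s\<in>{0..t}. v m s \<omega> \<partial>lborel))"
        using measurable_time_section[OF mv[of m] T0 _ elim(3), of t] t
        by (subst nn_integral_cmult, simp, subst nn_integral_add) auto
      also have "ennreal T * (ennreal c * (ennreal t + (\<integral>\<^sup>+s\<in>{0..t}. v m s \<omega> \<partial>lborel))) \<le>
          ennreal T * (ennreal c * (ennreal T + (\<integral>\<^sup>+s\<in>{0..t}. v m s \<omega> \<partial>lborel)))"
        using t by (intro mult_left_mono add_right_mono ennreal_leI) auto
      finally have drift: "ennreal ((norm (set_lebesgue_integral lborel {0..t'} (\<lambda>s. f s (X s \<omega>))))\<^sup>2) \<le>
          ennreal T * (ennreal c * (ennreal T + (\<integral>\<^sup>+s\<in>{0..t}. v m s \<omega> \<partial>lborel)))" .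
      have Xt: "X t' \<omega> = X0 \<omega> + set_lebesgue_integral lborel {0..t'} (\<lambda>s. f s (X s \<omega>)) + Y t' \<omega>"
        using elim(1) t' by auto
      have "v m t \<omega> \<le> 3 * x0 \<omega> + 3 * ennreal ((norm (set_lebesgue_integral lborel {0..t'} (\<lambda>s. f s (X s \<omega>))))\<^sup>2)
          + 3 * y m t \<omega>"
        unfolding v_def y_def x0_def t'_def[symmetric] Xt
        by (intro ennreal_le_3_add norm_add3_sq_le) auto
      also have "\<dots> \<le> 3 * x0 \<omega> + 3 * (ennreal T * (ennreal c * (ennreal T + (\<integral>\<^sup>+s\<in>{0..t}. v m s \<omega> \<partial>lborel)))) + 3 * y m t \<omega>"
        by (intro add_mono mult_left_mono drift) auto
      also have "\<dots> = A m t \<omega> + ennreal B1 * (\<integral>\<^sup>+s\<in>{0..t}. v m s \<omega> \<partial>lborel)"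
        using T c by (simp add: A_def B1_def ennreal_mult distrib_left mult_ac add_ac)
      finally show "v m t \<omega> \<le> A m t \<omega> + ennreal B1 * (\<integral>\<^sup>+s\<in>{0..t}. v m s \<omega> \<partial>lborel)" .
    qed
  qed
  have Ey: "(\<integral>\<^sup>+\<omega>. y m t \<omega> \<partial>M) \<le> 16 * energy K e M t (\<Psi> m)" if "t \<in> {0..T}" for m t
    unfolding y_def
    by (rule ito_integral_L2_second_moment[OF L[folded \<Psi>_def] basis m\<Psi> that])
       (rule jointly_measurable_section[OF mYs])
  have e\<Psi>: "energy K e M T (\<Psi> m) < \<infinity>" for m
    by (rule ito_integral_L2_energy_finite[OF L[folded \<Psi>_def] basis m\<Psi> T0])
  have EA: "(\<integral>\<^sup>+\<omega>. A m t \<omega> \<partial>M) \<le> 3 * E0 + ennreal (B1 * T) + 3 * (16 * energy K e M t (\<Psi> m))"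
    if t: "t \<in> {0..T}" for m t
  proof -
    have "(\<integral>\<^sup>+\<omega>. A m t \<omega> \<partial>M) = 3 * E0 + ennreal (B1 * T) + 3 * (\<integral>\<^sup>+\<omega>. y m t \<omega> \<partial>M)"
      using myt[OF t, of m] unfolding A_def E0_def
      by (simp add: nn_integral_add nn_integral_cmult emeasure_space_1)
    also have "\<dots> \<le> 3 * E0 + ennreal (B1 * T) + 3 * (16 * energy K e M t (\<Psi> m))"
      by (intro add_left_mono mult_left_mono Ey t) auto
    finally show ?thesis .
  qed
  \<comment> \<open>Continuity on a compact interval bounds each path, by a constant that depends on
    the path. This is the finiteness required by Gronwall's inequality for a fixed \<omega>.\<close>
  have finite_path: "AE \<omega> in M. (\<integral>\<^sup>+s\<in>{0..T}. v m s \<omega> \<partial>lborel) < \<infinity>" for m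
    using cont AE_space
  proof eventually_elim
    case (elim \<omega>)
    have "compact ((\<lambda>t. X t \<omega>) ` {0..T})" by (rule compact_continuous_image[OF elim(1)]) simp
    then have "bounded ((\<lambda>t. X t \<omega>) ` {0..T})" by (rule compact_imp_bounded)
    then obtain b where b: "\<And>t. t \<in> {0..T} \<Longrightarrow> norm (X t \<omega>) \<le> b"
      unfolding bounded_iff by blast
    have "(\<integral>\<^sup>+s\<in>{0..T}. v m s \<omega> \<partial>lborel) \<le> (\<integral>\<^sup>+s. ennreal (b\<^sup>2) * indicator {0..T} s \<partial>lborel)"
    proof (rule nn_integral_mono)
      fix s
      show "v m s \<omega> * indicator {0..T} s \<le> ennreal (b\<^sup>2) * indicator {0..T} s"
        using b[of "min s (\<tau> m \<omega>)"] \<tau>(2)[OF elim(2), of m]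
        by (auto simp: v_def indicator_def intro!: ennreal_leI power_mono)
    qed
    also have "\<dots> < \<infinity>" using T by (simp add: nn_integral_cmult ennreal_mult_less_top)
    finally show ?case .
  qed
  define V where "V m t = (\<integral>\<^sup>+\<omega>. v m t \<omega> \<partial>M)" for m t
  have V_int: "time_exp M t (v m) = (\<integral>\<^sup>+s\<in>{0..t}. V m s \<partial>lborel)" if "t \<in> {0..T}" for m t
    unfolding V_def using that T0 by (intro time_exp_swap[OF mv]) auto
  \<comment> \<open>The bound involves the energy of the stopped integrand and so depends on m; only
    its finiteness is kept.\<close>
  have finite_V: "(\<integral>\<^sup>+s\<in>{0..T}. V m s \<partial>lborel) < \<infinity>" for m
  proof -
    let ?c = "ennreal (2 * exp (2 * B1 * T))"
    let ?d = "3 * E0 + ennreal (B1 * T) + 3 * (16 * energy K e M T (\<Psi> m))"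
    have "AE \<omega> in M. (\<integral>\<^sup>+s\<in>{0..T}. v m s \<omega> \<partial>lborel) \<le> ?c * (\<integral>\<^sup>+s\<in>{0..T}. A m s \<omega> \<partial>lborel)"
      using path[of m] finite_path[of m] AE_space
    proof eventually_elim
      case (elim \<omega>)
      show ?case
        by (rule gronwall_integrated[OF measurable_time_section[OF mv T0 order_refl elim(3)]
            measurable_time_section[OF mA T0 order_refl elim(3)] B1 _ elim(2)])
           (use elim(1) in blast)
    qed
    then have "time_exp M T (v m) \<le> (\<integral>\<^sup>+\<omega>. ?c * (\<integral>\<^sup>+s\<in>{0..T}. A m s \<omega> \<partial>lborel) \<partial>M)"
      unfolding time_exp_def by (rule nn_integral_mono_AE)
    also have "\<dots> = ?c * time_exp M T (A m)"
      unfolding time_exp_def by (intro nn_integral_cmult measurable_time_integral[OF mA T0]) simp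
    also have "time_exp M T (A m) = (\<integral>\<^sup>+s\<in>{0..T}. (\<integral>\<^sup>+\<omega>. A m s \<omega> \<partial>M) \<partial>lborel)"
      by (rule time_exp_swap[OF mA T0 order_refl])
    also have "\<dots> \<le> (\<integral>\<^sup>+s. ?d * indicator {0..T} s \<partial>lborel)"
    proof (rule nn_integral_mono)
      fix s
      show "(\<integral>\<^sup>+\<omega>. A m s \<omega> \<partial>M) * indicator {0..T} s \<le> ?d * indicator {0..T} s"
      proof (cases "s \<in> {0..T}")
        case True
        have "(\<integral>\<^sup>+\<omega>. A m s \<omega> \<partial>M) \<le> ?d"
          using True by (intro order.trans[OF EA[OF True]] add_left_mono mult_left_mono time_exp_mono_time) auto
        then show ?thesis using True by simp
      qed simp
    qed
    also have "\<dots> = ?d * ennreal T" using T by (simp add: nn_integral_cmult)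
    finally have "time_exp M T (v m) \<le> ?c * (?d * ennreal T)" by (simp add: mult_left_mono)
    also have "\<dots> < \<infinity>" using E0 e\<Psi>[of m] by (simp add: ennreal_mult_less_top)
    finally show ?thesis using V_int[of T m] T by simp
  qed
  \<comment> \<open>Now the energy is estimated by linear growth in terms of \<open>V\<close>
    itself, so these constants no longer depend on m. The factor 48 is 3 from the three-term square
    times 16 from the maximal inequality.\<close>
  define A2 where "A2 = 3 * E0 + ennreal (B1 * T) + 48 * ennreal (c * T)"
  define B2 where "B2 = B1 + 48 * c"
  have B2: "0 < B2" using B1 c by (simp add: B2_def)
  have A2: "A2 < \<infinity>" using E0 by (simp add: A2_def ennreal_mult_less_top)
  have V_le: "V m t \<le> A2 + ennreal B2 * (\<integral>\<^sup>+s\<in>{0..t}. V m s \<partial>lborel)" if t: "t \<in> {0..T}" for m t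
  proof -
    have t': "t \<le> T" "0 \<le> t" using t by auto
    have "energy K e M t (\<Psi> m) \<le> time_exp M t (\<lambda>s \<omega>. ennreal c + ennreal c * v m s \<omega>)"
    proof (rule time_exp_mono)
      fix s \<omega> assume s: "s \<in> {0..t}" and \<omega>: "\<omega> \<in> space M"
      show "hs_sq K e (\<Psi> m s \<omega>) \<le> ennreal c + ennreal c * v m s \<omega>"
      proof (cases "s \<le> \<tau> m \<omega>")
        case True
        then have "\<Psi> m s \<omega> = S s (X s \<omega>)" using s by (simp add: \<Psi>_def)
        then have "hs_sq K e (\<Psi> m s \<omega>) \<le> ennreal (c * (1 + (norm (X s \<omega>))\<^sup>2))"
          using S[of s "X s \<omega>"] s t by auto
        also have "\<dots> = ennreal c + ennreal c * v m s \<omega>"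
          using True c by (simp add: v_def min_def distrib_left ennreal_mult)
        finally show ?thesis .
      qed (simp add: \<Psi>_def)
    qed
    also have "\<dots> = time_exp M t (\<lambda>s \<omega>. ennreal c) + time_exp M t (\<lambda>s \<omega>. ennreal c * v m s \<omega>)"
    proof (rule time_exp_add[OF _ _ T0 t'(1)])
      show "jointly_measurable T M (\<lambda>s \<omega>. ennreal c * v m s \<omega>)"
        using mv[of m] unfolding jointly_measurable_def case_prod_unfold by measurable
    qed simp
    also have "time_exp M t (\<lambda>s \<omega>. ennreal c) = ennreal c * ennreal t"
      using t' by (simp add: time_exp_def nn_integral_cmult emeasure_space_1)
    also have "time_exp M t (\<lambda>s \<omega>. ennreal c * v m s \<omega>) = ennreal c * (\<integral>\<^sup>+s\<in>{0..t}. V m s \<partial>lborel)"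
      using time_exp_cmult[OF mv T0 t'(1), of "ennreal c" m] V_int[OF t] by simp
    also have "ennreal c * ennreal t \<le> ennreal (c * T)"
      using t' c by (simp add: ennreal_mult[symmetric] ennreal_leI)
    finally have en: "energy K e M t (\<Psi> m) \<le> ennreal (c * T) + ennreal c * (\<integral>\<^sup>+s\<in>{0..t}. V m s \<partial>lborel)"
      by (simp add: add_right_mono)
    have "V m t \<le> (\<integral>\<^sup>+\<omega>. A m t \<omega> + ennreal B1 * (\<integral>\<^sup>+s\<in>{0..t}. v m s \<omega> \<partial>lborel) \<partial>M)"
      unfolding V_def using path[of m] t by (intro nn_integral_mono_AE) auto
    also have "\<dots> = (\<integral>\<^sup>+\<omega>. A m t \<omega> \<partial>M) + ennreal B1 * time_exp M t (v m)"
      unfolding time_exp_def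
      using measurable_time_integral[OF mv[of m] T0 t'(1)] jointly_measurable_section[OF mA t, of m]
      by (simp add: nn_integral_add nn_integral_cmult)
    also have "\<dots> \<le> (3 * E0 + ennreal (B1 * T) + 3 * (16 * (ennreal (c * T) + ennreal c * (\<integral>\<^sup>+s\<in>{0..t}. V m s \<partial>lborel))))
        + ennreal B1 * (\<integral>\<^sup>+s\<in>{0..t}. V m s \<partial>lborel)"
      unfolding V_int[OF t]
      by (intro add_right_mono order.trans[OF EA[OF t]] add_left_mono mult_left_mono en) auto
    also have "\<dots> = A2 + ennreal B2 * (\<integral>\<^sup>+s\<in>{0..t}. V m s \<partial>lborel)"
      using B1 c by (simp add: A2_def B2_def distrib_left distrib_right mult.assoc[symmetric] ennreal_mult add_ac)
    finally show ?thesis .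
  qed
  define B3 where "B3 = A2 + ennreal B2 * (ennreal (2 * exp (2 * B2 * T)) * (A2 * ennreal T))"
  have B3: "B3 < \<infinity>" using A2 by (simp add: B3_def ennreal_mult_less_top)
  have V_B3: "V m t \<le> B3" if t: "t \<in> {0..T}" for m t
  proof -
    have "(\<integral>\<^sup>+s\<in>{0..t}. V m s \<partial>lborel) \<le> (\<integral>\<^sup>+s\<in>{0..T}. V m s \<partial>lborel)"
      using t by (intro nn_integral_mono) (auto simp: indicator_def)
    also have "\<dots> \<le> ennreal (2 * exp (2 * B2 * T)) * (\<integral>\<^sup>+s\<in>{0..T}. A2 \<partial>lborel)"
      using V_le finite_V
      by (intro gronwall_integrated B2 measurable_expectation_time[OF mv T0 order_refl, folded V_def]) auto
    also have "(\<integral>\<^sup>+s\<in>{0..T}. A2 \<partial>lborel) = A2 * ennreal T" using T by (simp add: nn_integral_cmult)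
    finally show ?thesis
      unfolding B3_def by (intro order.trans[OF V_le[OF t]] add_left_mono mult_left_mono) auto
  qed
  show ?thesis
  proof (intro exI[of _ B3] conjI ballI B3)
    fix t assume t: "t \<in> {0..T}"
    \<comment> \<open>Almost surely the stopped process at time t eventually equals
      \<open>X t\<close>, so Fatou's lemma transfers the bound that is uniform in m.\<close>
    have "(\<integral>\<^sup>+\<omega>. ennreal ((norm (X t \<omega>))\<^sup>2) \<partial>M) \<le> (\<integral>\<^sup>+\<omega>. liminf (\<lambda>m. v m t \<omega>) \<partial>M)"
    proof (rule nn_integral_mono_AE)
      show "AE \<omega> in M. ennreal ((norm (X t \<omega>))\<^sup>2) \<le> liminf (\<lambda>m. v m t \<omega>)"
        using ev
      proof eventually_elim
        case (elim \<omega>)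
        then have "eventually (\<lambda>m. ennreal ((norm (X t \<omega>))\<^sup>2) \<le> v m t \<omega>) sequentially"
          using t by (auto elim!: eventually_mono simp: v_def min_def)
        then show ?case by (rule Liminf_bounded)
      qed
    qed
    also have "\<dots> \<le> liminf (\<lambda>m. V m t)"
      unfolding V_def using mvt[OF t] by (rule nn_integral_liminf)
    also have "\<dots> \<le> liminf (\<lambda>m::nat. B3)" using V_B3[OF t] by (intro Liminf_mono) auto
    finally show "(\<integral>\<^sup>+\<omega>. ennreal ((norm (X t \<omega>))\<^sup>2) \<partial>M) \<le> B3" by (simp add: Liminf_const)
  qed
qed

end

section \<open>Stability of strong solutions\<close>

text \<open>
  \<open>B\<close> is the rate in Gronwall's inequality, and \<open>51 + 3 T\<close> dominates the weights 3, \<open>3 T\<close> and 48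
  of the initial, drift and diffusion errors.
\<close>

definition stability_const :: "real \<Rightarrow> real \<Rightarrow> real" where
  "stability_const T k = (let B = 3 * T * k + 48 * k in (1 + B * (2 * exp (2 * B * T) * T)) * (51 + 3 * T))"

lemma stability_const_nonneg: "0 \<le> T \<Longrightarrow> 0 \<le> k \<Longrightarrow> 0 \<le> stability_const T k"
  by (simp add: stability_const_def Let_def)

context wiener_space
begin

text \<open>Linear growth together with second moments bounded uniformly in time gives finite
  energy, which is the integrability needed to compare two localized integrals.\<close>

lemma energy_finite:
  fixes X :: "real \<Rightarrow> 'w \<Rightarrow> 'h"
  assumes X: "jointly_measurable T M X" and T: "0 \<le> T" and c: "0 \<le> c"
    and B: "B < \<infinity>" "\<And>t. t \<in> {0..T} \<Longrightarrow> (\<integral>\<^sup>+\<omega>. ennreal ((norm (X t \<omega>))\<^sup>2) \<partial>M) \<le> B"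
    and \<Phi>: "\<And>s \<omega>. s \<in> {0..T} \<Longrightarrow> hs_sq K e (\<Phi> s \<omega>) \<le> ennreal (c * (1 + (norm (X s \<omega>))\<^sup>2))"
  shows "energy K e M T \<Phi> < \<infinity>"
proof -
  have m: "jointly_measurable T M (\<lambda>s \<omega>. ennreal (c * (1 + (norm (X s \<omega>))\<^sup>2)))"
    using X unfolding jointly_measurable_def case_prod_unfold by measurable
  have "energy K e M T \<Phi> \<le> time_exp M T (\<lambda>s \<omega>. ennreal (c * (1 + (norm (X s \<omega>))\<^sup>2)))"
    by (rule time_exp_mono) (rule \<Phi>)
  also have "\<dots> = (\<integral>\<^sup>+s\<in>{0..T}. (\<integral>\<^sup>+\<omega>. ennreal (c * (1 + (norm (X s \<omega>))\<^sup>2)) \<partial>M) \<partial>lborel)"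
    by (rule time_exp_swap[OF m T order_refl])
  also have "\<dots> \<le> (\<integral>\<^sup>+s. (ennreal c * (1 + B)) * indicator {0..T} s \<partial>lborel)"
  proof (rule nn_integral_mono)
    fix s
    show "(\<integral>\<^sup>+\<omega>. ennreal (c * (1 + (norm (X s \<omega>))\<^sup>2)) \<partial>M) * indicator {0..T} s \<le>
        ennreal c * (1 + B) * indicator {0..T} s"
    proof (cases "s \<in> {0..T}")
      case True
      have [measurable]: "X s \<in> borel_measurable M" by (rule jointly_measurable_section[OF X True])
      have "(\<integral>\<^sup>+\<omega>. ennreal (c * (1 + (norm (X s \<omega>))\<^sup>2)) \<partial>M) =
          (\<integral>\<^sup>+\<omega>. ennreal c * (1 + ennreal ((norm (X s \<omega>))\<^sup>2)) \<partial>M)"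
        using c by (intro nn_integral_cong) (simp add: ennreal_mult)
      also have "\<dots> = ennreal c * (1 + (\<integral>\<^sup>+\<omega>. ennreal ((norm (X s \<omega>))\<^sup>2) \<partial>M))"
        by (subst nn_integral_cmult, measurable, subst nn_integral_add) (auto simp: emeasure_space_1)
      also have "\<dots> \<le> ennreal c * (1 + B)" by (intro mult_left_mono add_left_mono B(2) True) auto
      finally show ?thesis using True by simp
    qed simp
  qed
  also have "\<dots> = ennreal c * (1 + B) * ennreal T" using T by (simp add: nn_integral_cmult)
  also have "\<dots> < \<infinity>" using B(1) by (simp add: ennreal_mult_less_top)
  finally show ?thesis .
qed

text \<open>The coefficient differences are bounded along the two solutions by a Lipschitz part and
  the error terms \<open>df\<close>, \<open>ds\<close>, which may be random; this admits residuals
  evaluated along one of the solutions. The three errors enter linearly, so their rate is inherited.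
  The conclusion provides a majorant instead of the integral of a possibly nonmeasurable
  supremum.\<close>

lemma strong_solutions_distance:
  fixes X X' :: "real \<Rightarrow> 'w \<Rightarrow> 'h" and df ds :: "real \<Rightarrow> 'w \<Rightarrow> ennreal"
  assumes sol: "strong_solution M F W K e T f S X0 X" "strong_solution M F W K e T f' S' X0' X'"
    and basis: "orthonormal_basis K e" and T: "0 < T"
    and X0: "X0 \<in> borel_measurable M" "(\<integral>\<^sup>+\<omega>. ennreal ((norm (X0 \<omega>))\<^sup>2) \<partial>M) < \<infinity>"
    and X0': "X0' \<in> borel_measurable M" "(\<integral>\<^sup>+\<omega>. ennreal ((norm (X0' \<omega>))\<^sup>2) \<partial>M) < \<infinity>"
    and c: "0 < c" and k: "0 < k"
    and f: "\<And>s x. s \<in> {0..T} \<Longrightarrow> (norm (f s x))\<^sup>2 \<le> c * (1 + (norm x)\<^sup>2)"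
    and S: "\<And>s x. s \<in> {0..T} \<Longrightarrow> hs_sq K e (S s x) \<le> ennreal (c * (1 + (norm x)\<^sup>2))"
    and f': "\<And>s x. s \<in> {0..T} \<Longrightarrow> (norm (f' s x))\<^sup>2 \<le> c * (1 + (norm x)\<^sup>2)"
    and S': "\<And>s x. s \<in> {0..T} \<Longrightarrow> hs_sq K e (S' s x) \<le> ennreal (c * (1 + (norm x)\<^sup>2))"
    and df: "jointly_measurable T M df" and ds: "jointly_measurable T M ds"
    and f_diff: "\<And>s \<omega>. s \<in> {0..T} \<Longrightarrow> \<omega> \<in> space M \<Longrightarrow>
      ennreal ((norm (f' s (X' s \<omega>) - f s (X s \<omega>)))\<^sup>2) \<le> ennreal k * ennreal ((norm (X' s \<omega> - X s \<omega>))\<^sup>2) + df s \<omega>"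
    and S_diff: "\<And>s \<omega>. s \<in> {0..T} \<Longrightarrow> \<omega> \<in> space M \<Longrightarrow>
      hs_sq K e (S' s (X' s \<omega>) - S s (X s \<omega>)) \<le> ennreal k * ennreal ((norm (X' s \<omega> - X s \<omega>))\<^sup>2) + ds s \<omega>"
  shows "\<exists>G. G \<in> borel_measurable M \<and>
    (\<integral>\<^sup>+\<omega>. G \<omega> \<partial>M) \<le> ennreal (stability_const T k) *
      ((\<integral>\<^sup>+\<omega>. ennreal ((norm (X0' \<omega> - X0 \<omega>))\<^sup>2) \<partial>M) + time_exp M T df + time_exp M T ds) \<and>
    (AE \<omega> in M. \<forall>s\<in>{0..T}. ennreal ((norm (X' s \<omega> - X s \<omega>))\<^sup>2) \<le> G \<omega>)"
proof -
  have T0: "0 \<le> T" using T by simp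
  obtain Y where I: "ito_integral M F W K e T (\<lambda>s \<omega>. S s (X s \<omega>)) Y"
    and eq: "AE \<omega> in M. \<forall>t\<in>{0..T}.
      X t \<omega> = X0 \<omega> + set_lebesgue_integral lborel {0..t} (\<lambda>s. f s (X s \<omega>)) + Y t \<omega>"
    and fint: "AE \<omega> in M. set_integrable lborel {0..T} (\<lambda>s. f s (X s \<omega>))"
    and prog: "progressive F T X"
    using sol(1) unfolding strong_solution_def by blast
  obtain Y' where I': "ito_integral M F W K e T (\<lambda>s \<omega>. S' s (X' s \<omega>)) Y'"
    and eq': "AE \<omega> in M. \<forall>t\<in>{0..T}.
      X' t \<omega> = X0' \<omega> + set_lebesgue_integral lborel {0..t} (\<lambda>s. f' s (X' s \<omega>)) + Y' t \<omega>"
    and fint': "AE \<omega> in M. set_integrable lborel {0..T} (\<lambda>s. f' s (X' s \<omega>))"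
    and prog': "progressive F T X'"
    using sol(2) unfolding strong_solution_def by blast
  have mX: "jointly_measurable T M X" using prog T0 by (rule progressive_jointly_measurable)
  have mX': "jointly_measurable T M X'" using prog' T0 by (rule progressive_jointly_measurable)
  have mY: "jointly_measurable T M Y" using I T0 by (rule ito_integral_jointly_measurable)
  have mY': "jointly_measurable T M Y'" using I' T0 by (rule ito_integral_jointly_measurable)
  obtain B where B: "B < \<infinity>" "\<And>t. t \<in> {0..T} \<Longrightarrow> (\<integral>\<^sup>+\<omega>. ennreal ((norm (X t \<omega>))\<^sup>2) \<partial>M) \<le> B"
    using strong_solution_second_moment[OF sol(1) basis T X0 c f S] by blast
  obtain B' where B': "B' < \<infinity>" "\<And>t. t \<in> {0..T} \<Longrightarrow> (\<integral>\<^sup>+\<omega>. ennreal ((norm (X' t \<omega>))\<^sup>2) \<partial>M) \<le> B'"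
    using strong_solution_second_moment[OF sol(2) basis T X0' c f' S'] by blast
  have eS: "energy K e M T (\<lambda>s \<omega>. S s (X s \<omega>)) < \<infinity>"
    by (rule energy_finite[OF mX T0 less_imp_le[OF c] B]) (assumption, rule S)
  have eS': "energy K e M T (\<lambda>s \<omega>. S' s (X' s \<omega>)) < \<infinity>"
    by (rule energy_finite[OF mX' T0 less_imp_le[OF c] B']) (assumption, rule S')
  define v where "v s \<omega> = ennreal ((norm (X' s \<omega> - X s \<omega>))\<^sup>2)" for s \<omega>
  define y where "y s \<omega> = ennreal ((norm (Y' s \<omega> - Y s \<omega>))\<^sup>2)" for s \<omega>
  define x0 where "x0 \<omega> = ennreal ((norm (X0' \<omega> - X0 \<omega>))\<^sup>2)" for \<omega>
  define E0 where "E0 = (\<integral>\<^sup>+\<omega>. x0 \<omega> \<partial>M)"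
  define V where "V t = (\<integral>\<^sup>+\<omega>. v t \<omega> \<partial>M)" for t
  have mv: "jointly_measurable T M v" and my: "jointly_measurable T M y"
    using mX mX' mY mY' unfolding v_def[abs_def] y_def[abs_def] jointly_measurable_def case_prod_unfold
    by measurable
  have mx0[measurable]: "x0 \<in> borel_measurable M"
    using X0(1) X0'(1) unfolding x0_def[abs_def] by measurable
  have mkv: "jointly_measurable T M (\<lambda>s \<omega>. ennreal k * v s \<omega>)"
    using mv unfolding jointly_measurable_def case_prod_unfold by measurable
  have mf: "jointly_measurable T M (\<lambda>s \<omega>. ennreal k * v s \<omega> + df s \<omega>)"
    using mv df unfolding jointly_measurable_def case_prod_unfold by measurable
  have V_int: "time_exp M t v = (\<integral>\<^sup>+s\<in>{0..t}. V s \<partial>lborel)" if "t \<in> {0..T}" for t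
    unfolding V_def using that T0 by (intro time_exp_swap[OF mv]) auto
  \<comment> \<open>The error is integrated up to T at once, so the inhomogeneous term in Gronwall's
    inequality is constant in t.\<close>
  have te: "time_exp M t (\<lambda>s \<omega>. ennreal k * v s \<omega> + d s \<omega>) \<le>
      ennreal k * (\<integral>\<^sup>+s\<in>{0..t}. V s \<partial>lborel) + time_exp M T d"
    if t: "t \<in> {0..T}" and d: "jointly_measurable T M d" for t d
  proof -
    have t': "t \<le> T" using t by simp
    have "time_exp M t (\<lambda>s \<omega>. ennreal k * v s \<omega> + d s \<omega>) =
        ennreal k * (\<integral>\<^sup>+s\<in>{0..t}. V s \<partial>lborel) + time_exp M t d"
      using time_exp_add[OF mkv d T0 t'] time_exp_cmult[OF mv T0 t', of "ennreal k"] V_int[OF t] by simp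
    also have "\<dots> \<le> ennreal k * (\<integral>\<^sup>+s\<in>{0..t}. V s \<partial>lborel) + time_exp M T d"
      by (intro add_left_mono time_exp_mono_time t')
    finally show ?thesis .
  qed
  have path: "AE \<omega> in M. \<forall>t\<in>{0..T}. v t \<omega> \<le>
      3 * x0 \<omega> + 3 * (ennreal T * (\<integral>\<^sup>+s\<in>{0..t}. (ennreal k * v s \<omega> + df s \<omega>) \<partial>lborel)) + 3 * y t \<omega>"
    using eq eq' fint fint' AE_space
  proof eventually_elim
    case (elim \<omega>)
    show ?case
    proof
      fix t assume t: "t \<in> {0..T}"
      have i: "set_integrable lborel {0..t} (\<lambda>s. f s (X s \<omega>))"
        by (rule set_integrable_subset[OF elim(3)]) (use t in auto)
      have i': "set_integrable lborel {0..t} (\<lambda>s. f' s (X' s \<omega>))"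
        by (rule set_integrable_subset[OF elim(4)]) (use t in auto)
      let ?d = "\<lambda>s. f' s (X' s \<omega>) - f s (X s \<omega>)"
      have id: "set_integrable lborel {0..t} ?d" by (rule set_integral_diff(1)[OF i' i])
      have "ennreal ((norm (set_lebesgue_integral lborel {0..t} ?d))\<^sup>2) \<le>
          ennreal t * (\<integral>\<^sup>+s\<in>{0..t}. ennreal ((norm (?d s))\<^sup>2) \<partial>lborel)"
        using norm_set_integral_sq_le[OF id] t by simp
      also have "\<dots> \<le> ennreal T * (\<integral>\<^sup>+s\<in>{0..t}. (ennreal k * v s \<omega> + df s \<omega>) \<partial>lborel)"
      proof (rule mult_mono[OF ennreal_leI nn_integral_mono])
        show "ennreal ((norm (?d s))\<^sup>2) * indicator {0..t} s \<le>
            (ennreal k * v s \<omega> + df s \<omega>) * indicator {0..t} s" for s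
          using f_diff[of s \<omega>] t elim(5) by (cases "s \<in> {0..t}") (auto simp: v_def)
      qed (use t in auto)
      finally have drift: "ennreal ((norm (set_lebesgue_integral lborel {0..t} ?d))\<^sup>2) \<le>
          ennreal T * (\<integral>\<^sup>+s\<in>{0..t}. (ennreal k * v s \<omega> + df s \<omega>) \<partial>lborel)" .
      have Xt: "X' t \<omega> - X t \<omega> = (X0' \<omega> - X0 \<omega>) + set_lebesgue_integral lborel {0..t} ?d + (Y' t \<omega> - Y t \<omega>)"
        using elim(1,2) t unfolding set_integral_diff(2)[OF i' i] by simp
      have "v t \<omega> \<le> 3 * x0 \<omega> + 3 * ennreal ((norm (set_lebesgue_integral lborel {0..t} ?d))\<^sup>2) + 3 * y t \<omega>"
        unfolding v_def y_def x0_def Xt by (intro ennreal_le_3_add norm_add3_sq_le) auto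
      also have "\<dots> \<le> 3 * x0 \<omega> + 3 * (ennreal T * (\<integral>\<^sup>+s\<in>{0..t}. (ennreal k * v s \<omega> + df s \<omega>) \<partial>lborel)) + 3 * y t \<omega>"
        by (intro add_mono mult_left_mono drift) auto
      finally show "v t \<omega> \<le> \<dots>" .
    qed
  qed
  have eD: "energy K e M t (\<lambda>s \<omega>. S' s (X' s \<omega>) - S s (X s \<omega>)) \<le>
      ennreal k * (\<integral>\<^sup>+s\<in>{0..t}. V s \<partial>lborel) + time_exp M T ds" if t: "t \<in> {0..T}" for t
    by (rule order.trans[OF time_exp_mono te[OF t ds]]) (use S_diff t in \<open>auto simp: v_def\<close>)
  define A where "A = 3 * E0 + 3 * (ennreal T * time_exp M T df) + 48 * time_exp M T ds"
  define Bc where "Bc = 3 * T * k + 48 * k"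
  have Bc: "0 < Bc" using T k by (simp add: Bc_def add_pos_pos)
  \<comment> \<open>Regrouping: \<open>A\<close> collects the three errors and \<open>Bc\<close> the
    Lipschitz contributions of drift and diffusion, the latter with weight 3 times 16.\<close>
  have combine: "3 * E0 + 3 * (ennreal T * (ennreal k * x + time_exp M T df)) + 3 * (16 * (ennreal k * x + time_exp M T ds))
      = A + ennreal Bc * x" for x
    using T k by (simp add: A_def Bc_def distrib_left distrib_right mult.assoc[symmetric] ennreal_mult add_ac)
  have V_le: "V t \<le> A + ennreal Bc * (\<integral>\<^sup>+s\<in>{0..t}. V s \<partial>lborel)" if t: "t \<in> {0..T}" for t
  proof -
    have t': "t \<le> T" using t by simp
    have Ey: "(\<integral>\<^sup>+\<omega>. y t \<omega> \<partial>M) \<le> 16 * energy K e M t (\<lambda>s \<omega>. S' s (X' s \<omega>) - S s (X s \<omega>))"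
      using ito_integral_diff_doob[OF I' I basis eS' eS, of "\<lambda>_. t" 0] t by (simp add: y_def mono_def)
    have "V t \<le> (\<integral>\<^sup>+\<omega>. 3 * x0 \<omega> + 3 * (ennreal T * (\<integral>\<^sup>+s\<in>{0..t}. (ennreal k * v s \<omega> + df s \<omega>) \<partial>lborel)) + 3 * y t \<omega> \<partial>M)"
      unfolding V_def using path t by (intro nn_integral_mono_AE) auto
    also have "\<dots> = 3 * E0 + 3 * (ennreal T * time_exp M t (\<lambda>s \<omega>. ennreal k * v s \<omega> + df s \<omega>)) + 3 * (\<integral>\<^sup>+\<omega>. y t \<omega> \<partial>M)"
      unfolding time_exp_def E0_def
      using measurable_time_integral[OF mf T0 t'] jointly_measurable_section[OF my t]
      by (simp add: nn_integral_add nn_integral_cmult)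
    also have "\<dots> \<le> 3 * E0 + 3 * (ennreal T * (ennreal k * (\<integral>\<^sup>+s\<in>{0..t}. V s \<partial>lborel) + time_exp M T df))
        + 3 * (16 * (ennreal k * (\<integral>\<^sup>+s\<in>{0..t}. V s \<partial>lborel) + time_exp M T ds))"
      by (intro add_mono mult_left_mono te[OF t df] order_refl order.trans[OF Ey] eD[OF t]) auto
    also have "\<dots> = A + ennreal Bc * (\<integral>\<^sup>+s\<in>{0..t}. V s \<partial>lborel)" by (rule combine)
    finally show ?thesis .
  qed
  \<comment> \<open>Here the a priori bounds enter: the distance is at most the sum of two finite
    second moments, up to the factor 2.\<close>
  have V_fin: "(\<integral>\<^sup>+s\<in>{0..T}. V s \<partial>lborel) < \<infinity>"
  proof -
    have "V t \<le> 2 * B' + 2 * B" if t: "t \<in> {0..T}" for t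
    proof -
      have [measurable]: "X t \<in> borel_measurable M" "X' t \<in> borel_measurable M"
        using jointly_measurable_section[OF mX t] jointly_measurable_section[OF mX' t] by auto
      have "V t \<le> (\<integral>\<^sup>+\<omega>. 2 * ennreal ((norm (X' t \<omega>))\<^sup>2) + 2 * ennreal ((norm (X t \<omega>))\<^sup>2) \<partial>M)"
        unfolding V_def v_def by (intro nn_integral_mono ennreal_le_2_add norm_diff_sq_le) auto
      also have "\<dots> = 2 * (\<integral>\<^sup>+\<omega>. ennreal ((norm (X' t \<omega>))\<^sup>2) \<partial>M) + 2 * (\<integral>\<^sup>+\<omega>. ennreal ((norm (X t \<omega>))\<^sup>2) \<partial>M)"
        by (simp add: nn_integral_add nn_integral_cmult)
      also have "\<dots> \<le> 2 * B' + 2 * B" by (intro add_mono mult_left_mono B B' t) auto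
      finally show ?thesis .
    qed
    then have "(\<integral>\<^sup>+s\<in>{0..T}. V s \<partial>lborel) \<le> (\<integral>\<^sup>+s. (2 * B' + 2 * B) * indicator {0..T} s \<partial>lborel)"
      by (intro nn_integral_mono) (simp add: indicator_def)
    also have "\<dots> = (2 * B' + 2 * B) * ennreal T" using T by (simp add: nn_integral_cmult)
    also have "\<dots> < \<infinity>" using B(1) B'(1) by (simp add: ennreal_mult_less_top)
    finally show ?thesis .
  qed
  have "(\<integral>\<^sup>+s\<in>{0..T}. V s \<partial>lborel) \<le> ennreal (2 * exp (2 * Bc * T)) * (\<integral>\<^sup>+s\<in>{0..T}. A \<partial>lborel)"
    using V_le V_fin
    by (intro gronwall_integrated Bc measurable_expectation_time[OF mv T0 order_refl, folded V_def]) auto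
  also have "(\<integral>\<^sup>+s\<in>{0..T}. A \<partial>lborel) = A * ennreal T" using T by (simp add: nn_integral_cmult)
  also have "ennreal (2 * exp (2 * Bc * T)) * (A * ennreal T) = ennreal (2 * exp (2 * Bc * T) * T) * A"
    using T by (simp add: ennreal_mult mult_ac)
  finally have V_A: "(\<integral>\<^sup>+s\<in>{0..T}. V s \<partial>lborel) \<le> ennreal (2 * exp (2 * Bc * T) * T) * A" .
  \<comment> \<open>Of the three contributions, only the stochastic integral requires a maximal
    inequality; the initial error is constant in time and the integral bounding the drift is
    increasing.\<close>
  obtain Gy where Gy: "Gy \<in> borel_measurable M"
    "(\<integral>\<^sup>+\<omega>. Gy \<omega> \<partial>M) \<le> 16 * energy K e M T (\<lambda>s \<omega>. S' s (X' s \<omega>) - S s (X s \<omega>))"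
    "AE \<omega> in M. \<forall>s\<in>{0..T}. ennreal ((norm (Y' s \<omega> - Y s \<omega>))\<^sup>2) \<le> Gy \<omega>"
  proof (rule sup_over_path[OF T])
    have "AE \<omega> in M. continuous_on {0..T} (\<lambda>t. Y t \<omega>)" "AE \<omega> in M. continuous_on {0..T} (\<lambda>t. Y' t \<omega>)"
      using I I' unfolding ito_integral_def by auto
    then show "AE \<omega> in M. continuous_on {0..T} (\<lambda>t. Y' t \<omega> - Y t \<omega>)"
      by eventually_elim (intro continuous_on_diff)
    show "(\<lambda>\<omega>. ennreal ((norm (Y' s \<omega> - Y s \<omega>))\<^sup>2)) \<in> borel_measurable M" if "s \<in> {0..T}" for s
      using jointly_measurable_section[OF my that] by (simp add: y_def[abs_def])
    show "(\<integral>\<^sup>+\<omega>. (SUP k\<in>{..N::nat}. ennreal ((norm (Y' (t k) \<omega> - Y (t k) \<omega>))\<^sup>2)) \<partial>M) \<le>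
        16 * energy K e M T (\<lambda>s \<omega>. S' s (X' s \<omega>) - S s (X s \<omega>))"
      if t: "0 \<le> t 0" "mono t" "t N \<le> T" for t N
      by (rule order.trans[OF ito_integral_diff_doob[OF I' I basis eS' eS t]])
         (intro mult_left_mono time_exp_mono_time t(3), simp)
  qed blast
  define G where "G \<omega> = 3 * x0 \<omega> + 3 * (ennreal T * (\<integral>\<^sup>+s\<in>{0..T}. (ennreal k * v s \<omega> + df s \<omega>) \<partial>lborel)) + 3 * Gy \<omega>" for \<omega>
  have mI: "(\<lambda>\<omega>. \<integral>\<^sup>+s\<in>{0..T}. (ennreal k * v s \<omega> + df s \<omega>) \<partial>lborel) \<in> borel_measurable M"
    by (rule measurable_time_integral[OF mf T0 order_refl])
  show ?thesis
  proof (intro exI[of _ G] conjI)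
    show "G \<in> borel_measurable M" unfolding G_def[abs_def] using mI Gy(1) by measurable
    have "(\<integral>\<^sup>+\<omega>. G \<omega> \<partial>M) = 3 * E0 + 3 * (ennreal T * time_exp M T (\<lambda>s \<omega>. ennreal k * v s \<omega> + df s \<omega>)) + 3 * (\<integral>\<^sup>+\<omega>. Gy \<omega> \<partial>M)"
      unfolding time_exp_def E0_def G_def using mI Gy(1)
      by (simp add: nn_integral_add nn_integral_cmult)
    also have "\<dots> \<le> 3 * E0 + 3 * (ennreal T * (ennreal k * (\<integral>\<^sup>+s\<in>{0..T}. V s \<partial>lborel) + time_exp M T df))
        + 3 * (16 * (ennreal k * (\<integral>\<^sup>+s\<in>{0..T}. V s \<partial>lborel) + time_exp M T ds))"
      using T0 by (intro add_mono mult_left_mono te df order_refl order.trans[OF Gy(2)] eD) auto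
    also have "\<dots> = A + ennreal Bc * (\<integral>\<^sup>+s\<in>{0..T}. V s \<partial>lborel)" by (rule combine)
    also have "\<dots> \<le> A + ennreal Bc * (ennreal (2 * exp (2 * Bc * T) * T) * A)"
      by (intro add_left_mono mult_left_mono V_A) auto
    \<comment> \<open>Feeding the Gronwall bound for the time integral of \<open>V\<close> back into
      the estimate of \<open>G\<close> produces the first factor of
      \<open>stability_const\<close>.\<close>
    also have "\<dots> = ennreal (1 + Bc * (2 * exp (2 * Bc * T) * T)) * A"
      using T Bc by (simp add: ennreal_mult distrib_right mult.assoc)
    also have "A \<le> ennreal (51 + 3 * T) * (E0 + time_exp M T df + time_exp M T ds)"
    proof -
      have "3 * E0 \<le> ennreal (51 + 3 * T) * E0"
        using ennreal_leI[of 3 "51 + 3 * T"] T by (intro mult_right_mono) (simp_all del: ennreal_plus)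
      moreover have "3 * (ennreal T * time_exp M T df) \<le> ennreal (51 + 3 * T) * time_exp M T df"
      proof -
        have "ennreal (3 * T) \<le> ennreal (51 + 3 * T)" by (intro ennreal_leI) simp
        from mult_right_mono[OF this, of "time_exp M T df"] T show ?thesis
          by (simp add: ennreal_mult mult.assoc)
      qed
      moreover have "48 * time_exp M T ds \<le> ennreal (51 + 3 * T) * time_exp M T ds"
        using ennreal_leI[of 48 "51 + 3 * T"] T by (intro mult_right_mono) (simp_all del: ennreal_plus)
      ultimately show ?thesis unfolding A_def distrib_left by (intro add_mono)
    qed
    finally show "(\<integral>\<^sup>+\<omega>. G \<omega> \<partial>M) \<le> ennreal (stability_const T k) *
      ((\<integral>\<^sup>+\<omega>. ennreal ((norm (X0' \<omega> - X0 \<omega>))\<^sup>2) \<partial>M) + time_exp M T df + time_exp M T ds)"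
      using T Bc unfolding stability_const_def Let_def Bc_def[symmetric] E0_def x0_def
      by (simp add: ennreal_mult mult.assoc mult_left_mono)
    show "AE \<omega> in M. \<forall>s\<in>{0..T}. ennreal ((norm (X' s \<omega> - X s \<omega>))\<^sup>2) \<le> G \<omega>"
      using path Gy(3)
    proof eventually_elim
      case (elim \<omega>)
      show ?case
      proof
        fix t assume t: "t \<in> {0..T}"
        have "v t \<omega> \<le> 3 * x0 \<omega> + 3 * (ennreal T * (\<integral>\<^sup>+s\<in>{0..t}. (ennreal k * v s \<omega> + df s \<omega>) \<partial>lborel)) + 3 * y t \<omega>"
          using elim(1) t by blast
        also have "\<dots> \<le> G \<omega>"
          unfolding G_def using elim(2) t
          by (intro add_mono mult_left_mono nn_integral_mono) (auto simp: indicator_def y_def)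
        finally show "ennreal ((norm (X' t \<omega> - X t \<omega>))\<^sup>2) \<le> G \<omega>" by (simp add: v_def)
      qed
    qed
  qed
qed

end

section \<open>The Wasserstein distance of two laws\<close>

lemma (in prob_space) wasserstein2_law_le:
  fixes X Y :: "'a \<Rightarrow> 'b::{real_normed_vector, second_countable_topology}"
  assumes [measurable]: "X \<in> borel_measurable M" "Y \<in> borel_measurable M"
    and le: "(\<integral>\<^sup>+\<omega>. ennreal ((norm (X \<omega> - Y \<omega>))\<^sup>2) \<partial>M) \<le> ennreal r" and r: "0 \<le> r"
  shows "wasserstein2 (law M X) (law M Y) \<le> sqrt r"
proof -
  let ?\<pi> = "distr M (borel \<Otimes>\<^sub>M borel) (\<lambda>\<omega>. (X \<omega>, Y \<omega>))"
  have "?\<pi> \<in> couplings (law M X) (law M Y)"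
    unfolding couplings_def law_def by (auto simp: distr_distr o_def intro!: prob_space_distr)
  then have "(INF \<pi>\<in>couplings (law M X) (law M Y). \<integral>\<^sup>+(x, y). ennreal ((dist x y)\<^sup>2) \<partial>\<pi>) \<le>
      (\<integral>\<^sup>+(x, y). ennreal ((dist x y)\<^sup>2) \<partial>?\<pi>)" by (rule INF_lower)
  also have "\<dots> = (\<integral>\<^sup>+\<omega>. ennreal ((norm (X \<omega> - Y \<omega>))\<^sup>2) \<partial>M)"
    by (subst nn_integral_distr) (auto simp: case_prod_unfold dist_norm)
  finally have "(INF \<pi>\<in>couplings (law M X) (law M Y). \<integral>\<^sup>+(x, y). ennreal ((dist x y)\<^sup>2) \<partial>\<pi>) \<le> ennreal r"
    using le by (rule order.trans)
  \<comment> \<open>The bound \<open>ennreal r\<close> is finite, which is what makes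
    \<open>enn2real\<close> preserve the inequality.\<close>
  from enn2real_mono[OF this] r show ?thesis unfolding wasserstein2_def by simp
qed

lemma finite_second_moment_law:
  fixes X :: "'a \<Rightarrow> 'b::{real_normed_vector, second_countable_topology}"
  assumes [measurable]: "X \<in> borel_measurable M"
    and "(\<integral>\<^sup>+\<omega>. ennreal ((norm (X \<omega>))\<^sup>2) \<partial>M) < \<infinity>"
  shows "finite_second_moment (law M X)"
  using assms(2) unfolding finite_second_moment_def law_def by (subst nn_integral_distr) auto

section \<open>The Galerkin approximation\<close>

theorem theorem4p4:
  fixes M :: "'w measure" and F :: "real \<Rightarrow> 'w measure"
    and K :: "nat set"
    and e :: "nat \<Rightarrow> 'h::{real_inner, banach, second_countable_topology}"
    and q :: "nat \<Rightarrow> real" and Q :: "'h \<Rightarrow>\<^sub>L 'h"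
    and D :: "'h \<Rightarrow> ('h \<Rightarrow>\<^sub>L 'h)" and d_lo d_hi :: real
    and P :: "nat \<Rightarrow> ('h \<Rightarrow>\<^sub>L 'h)"
    and W :: "real \<Rightarrow> 'h \<Rightarrow> 'w \<Rightarrow> real"
    and T :: real and b :: "real \<Rightarrow> 'h \<Rightarrow> 'h"
    and \<beta> :: "real \<Rightarrow> real" and \<beta>_lo \<beta>_hi :: real
    and \<sigma> :: "'h \<Rightarrow> ('h \<Rightarrow>\<^sub>L 'h)"
    and X0 :: "'w \<Rightarrow> 'h" and X :: "real \<Rightarrow> 'w \<Rightarrow> 'h"
    and Xn :: "nat \<Rightarrow> real \<Rightarrow> 'w \<Rightarrow> 'h"
    and C \<gamma> :: real
  assumes K: "K = {1..} \<or> (\<exists>N. K = {1..N})"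
    and basis: "orthonormal_basis K e"
    and Q: "self_adjoint Q" "trace_class Q" "\<And>k. k \<in> K \<Longrightarrow> Q (e k) = q k *\<^sub>R e k"
    and q: "\<And>k. k \<in> K \<Longrightarrow> q k > 0" "q summable_on K"
    and D: "\<And>x. self_adjoint (D x)" "\<And>x. positive_op (D x)"
    and d: "0 < d_lo" "d_lo \<le> d_hi"
    and D_bounds: "\<And>x h. d_lo * (norm h)\<^sup>2 \<le> D x h \<bullet> h" "\<And>x h. D x h \<bullet> h \<le> d_hi * (norm h)\<^sup>2"
    and D_lipschitz: "\<exists>L. L-lipschitz_on UNIV (\<lambda>x. op_sqrt (D x))"
    and P: "\<And>n. is_orth_proj (span (e ` (K \<inter> {1..n}))) (P n)"
    and space: "filtered_prob_space M F"
    and W: "cylindrical_wiener M F W"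
    and T: "T > 0"
    and b_measurable: "case_prod b \<in> borel_measurable (restrict_space borel {0..T} \<Otimes>\<^sub>M borel)"
    and b_lipschitz: "\<exists>L. \<forall>t\<in>{0..T}. L-lipschitz_on UNIV (b t)"
    and b_zero: "bdd_above ((\<lambda>t. norm (b t 0)) ` {0..T})"
    and \<beta>_cont: "continuous_on {0..T} \<beta>"
    and \<beta>_bounds: "0 < \<beta>_lo" "\<And>t. t \<in> {0..T} \<Longrightarrow> \<beta>_lo \<le> \<beta> t \<and> \<beta> t \<le> \<beta>_hi"
    and \<sigma>: "\<And>x. \<sigma> x = op_sqrt (D x) o\<^sub>L op_sqrt Q"
    and \<sigma>_hs: "\<And>x. hilbert_schmidt K e (\<sigma> x)"
    and \<sigma>_lipschitz: "\<exists>L. \<forall>x y. hs_norm K e (\<sigma> x - \<sigma> y) \<le> L * dist x y"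
    and X0_measurable: "X0 \<in> borel_measurable (F 0)"
    and X0_L2: "integrable M (\<lambda>\<omega>. (norm (X0 \<omega>))\<^sup>2)"
    and X: "strong_solution M F W K e T b (\<lambda>t x. sqrt (\<beta> t) *\<^sub>R \<sigma> x) X0 X"
    and Xn: "\<And>n. n \<ge> 1 \<Longrightarrow>
      strong_solution M F W K e T (\<lambda>t x. P n (b t x)) (\<lambda>t x. sqrt (\<beta> t) *\<^sub>R (P n o\<^sub>L \<sigma> x))
        (\<lambda>\<omega>. P n (X0 \<omega>)) (Xn n)"
    and C: "C > 0" and \<gamma>: "\<gamma> > 0"
    and tail: "\<And>n. n \<ge> 1 \<Longrightarrow>
      (\<integral>\<^sup>+\<omega>. ennreal ((norm (X0 \<omega> - P n (X0 \<omega>)))\<^sup>2) \<partial>M)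
      + (\<integral>\<^sup>+\<omega>. (\<integral>\<^sup>+t\<in>{0..T}. ennreal ((norm (b t (X t \<omega>) - P n (b t (X t \<omega>))))\<^sup>2) \<partial>lborel) \<partial>M)
      + (\<integral>\<^sup>+\<omega>. (\<integral>\<^sup>+t\<in>{0..T}. hs_sq K e ((id_blinfun - P n) o\<^sub>L \<sigma> (X t \<omega>)) \<partial>lborel) \<partial>M)
      \<le> ennreal (C * real n powr (- \<gamma>))"
  shows "(\<exists>C\<^sub>T. \<forall>n\<ge>1.
            (\<integral>\<^sup>+\<omega>. (SUP t\<in>{0..T}. ennreal ((norm (Xn n t \<omega> - X t \<omega>))\<^sup>2)) \<partial>M)
              \<le> ennreal (C\<^sub>T * real n powr (- \<gamma>)))
       \<and> (\<exists>C\<^sub>T. \<forall>t\<in>{0..T}. \<forall>n\<ge>1.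
            finite_second_moment (law M (Xn n t)) \<and> finite_second_moment (law M (X t)) \<and>
            wasserstein2 (law M (Xn n t)) (law M (X t)) \<le> C\<^sub>T * real n powr (- \<gamma> / 2))"
proof -
  interpret filtered_prob_space M F by (rule space)
  interpret wiener_space M F W by standard (rule W)
  have T0: "0 \<le> T" "0 \<in> {0..T}" using T by auto
  obtain Lb where Lb: "\<And>t. t \<in> {0..T} \<Longrightarrow> Lb-lipschitz_on UNIV (b t)" using b_lipschitz by blast
  have Lb_dist: "norm (b t x - b t y) \<le> Lb * norm (x - y)" if "t \<in> {0..T}" for t x y
    using lipschitz_onD[OF Lb[OF that], of x y] by (simp add: dist_norm)
  obtain m where m: "\<And>t. t \<in> {0..T} \<Longrightarrow> norm (b t 0) \<le> m" using b_zero unfolding bdd_above_def by blast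
  obtain Ls where Ls: "\<And>x y. hs_norm K e (\<sigma> x - \<sigma> y) \<le> Ls * dist x y" using \<sigma>_lipschitz by blast
  note \<sigma>_dist = hs_sq_le_dist[OF Ls \<sigma>_hs]
  obtain s0 where s0: "hs_sq K e (\<sigma> 0) = ennreal s0" "0 \<le> s0"
    using \<sigma>_hs[of 0] unfolding hilbert_schmidt_def by (cases "hs_sq K e (\<sigma> 0)") auto
  have \<beta>: "0 \<le> \<beta> t" "\<beta> t \<le> \<beta>_hi" if "t \<in> {0..T}" for t using \<beta>_bounds(1) \<beta>_bounds(2)[OF that] by auto
  have \<beta>hi: "0 \<le> \<beta>_hi" using \<beta>[OF T0(2)] by linarith
  have P_le: "norm (P n x) \<le> norm x" for n x by (rule orth_proj_norm_le[OF P])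
  have PA_le: "hs_sq K e (P n o\<^sub>L A) \<le> hs_sq K e A" for n A by (rule hs_sq_mono) (simp add: P_le)
  \<comment> \<open>The constant c bounds the growth of drift and diffusion, found by comparison
    with their values at 0, and k bounds their squared Lipschitz constants, doubled by the splitting
    of squares. The summand 1 makes both positive; by contraction of the projections they serve
    every n.\<close>
  define c where "c = 1 + 2 * m\<^sup>2 + 2 * Lb\<^sup>2 + \<beta>_hi * (2 * s0 + 2 * Ls\<^sup>2)"
  define k where "k = 1 + 2 * Lb\<^sup>2 + \<beta>_hi * (2 * Ls\<^sup>2)"
  have c: "0 < c" unfolding c_def using \<beta>hi s0 by (intro add_pos_nonneg mult_nonneg_nonneg) auto
  have k: "0 < k" unfolding k_def using \<beta>hi by (intro add_pos_nonneg mult_nonneg_nonneg) auto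
  have b_growth: "(norm (b t x))\<^sup>2 \<le> c * (1 + (norm x)\<^sup>2)" if t: "t \<in> {0..T}" for t x
  proof -
    have "(norm (b t x))\<^sup>2 \<le> 2 * (norm (b t x - b t 0))\<^sup>2 + 2 * (norm (b t 0))\<^sup>2"
      using norm_add_sq_le[of "b t x - b t 0" "b t 0"] by simp
    also have "\<dots> \<le> 2 * (Lb * norm x)\<^sup>2 + 2 * m\<^sup>2"
      using Lb_dist[OF t, of x 0] m[OF t] by (intro add_mono mult_left_mono power_mono) auto
    also have "\<dots> \<le> c * (norm x)\<^sup>2 + c * 1"
      unfolding power_mult_distrib mult.assoc[symmetric] using \<beta>hi s0
      by (intro add_mono mult_right_mono) (auto simp: c_def intro!: add_increasing2 mult_nonneg_nonneg)
    finally show ?thesis by (simp add: distrib_left)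
  qed
  have \<sigma>_growth: "hs_sq K e (sqrt (\<beta> t) *\<^sub>R \<sigma> x) \<le> ennreal (c * (1 + (norm x)\<^sup>2))" if t: "t \<in> {0..T}" for t x
  proof -
    have "hs_sq K e (\<sigma> x) \<le> 2 * hs_sq K e (\<sigma> x - \<sigma> 0) + 2 * hs_sq K e (\<sigma> 0)"
      using hs_sq_add_le[of K e "\<sigma> x - \<sigma> 0" "\<sigma> 0"] by simp
    also have "\<dots> \<le> 2 * ennreal (Ls\<^sup>2 * (norm (x - 0))\<^sup>2) + 2 * ennreal s0"
      unfolding s0(1) by (intro add_mono mult_left_mono \<sigma>_dist) auto
    also have "\<dots> = ennreal (2 * (Ls\<^sup>2 * (norm x)\<^sup>2) + 2 * s0)" using s0(2) by (simp add: ennreal_mult)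
    finally have "hs_sq K e (\<sigma> x) \<le> ennreal (2 * (Ls\<^sup>2 * (norm x)\<^sup>2) + 2 * s0)" .
    then have "ennreal (\<beta> t) * hs_sq K e (\<sigma> x) \<le> ennreal \<beta>_hi * ennreal (2 * (Ls\<^sup>2 * (norm x)\<^sup>2) + 2 * s0)"
      using \<beta>[OF t] by (intro mult_mono ennreal_leI) auto
    also have "\<dots> = ennreal (\<beta>_hi * (2 * (Ls\<^sup>2 * (norm x)\<^sup>2) + 2 * s0))"
      using \<beta>hi s0(2) by (intro ennreal_mult[symmetric]) auto
    also have "\<dots> \<le> ennreal (c * (1 + (norm x)\<^sup>2))"
    proof (rule ennreal_leI)
      have "0 \<le> \<beta>_hi * (2 * Ls\<^sup>2)" "0 \<le> \<beta>_hi * (2 * s0)" using \<beta>hi s0(2) by auto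
      moreover have "0 \<le> 1 + 2 * m\<^sup>2 + 2 * Lb\<^sup>2" by simp
      ultimately have "\<beta>_hi * (2 * Ls\<^sup>2) \<le> c" and s0c: "\<beta>_hi * (2 * s0) \<le> c"
        unfolding c_def distrib_left[of \<beta>_hi] by linarith+
      then have "\<beta>_hi * (2 * Ls\<^sup>2) * (norm x)\<^sup>2 \<le> c * (norm x)\<^sup>2" by (intro mult_right_mono) auto
      with s0c show "\<beta>_hi * (2 * (Ls\<^sup>2 * (norm x)\<^sup>2) + 2 * s0) \<le> c * (1 + (norm x)\<^sup>2)"
        by (simp add: distrib_left mult.assoc)
    qed
    finally show ?thesis using \<beta>[OF t] by (simp add: hs_sq_scaleR)
  qed
  have Pb_growth: "(norm (P n (b t x)))\<^sup>2 \<le> c * (1 + (norm x)\<^sup>2)" if t: "t \<in> {0..T}" for n t x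
    by (rule order.trans[OF power_mono[OF P_le norm_ge_zero] b_growth[OF t]])
  have P\<sigma>_growth: "hs_sq K e (sqrt (\<beta> t) *\<^sub>R (P n o\<^sub>L \<sigma> x)) \<le> ennreal (c * (1 + (norm x)\<^sup>2))"
    if t: "t \<in> {0..T}" for n t x
  proof -
    have "hs_sq K e (sqrt (\<beta> t) *\<^sub>R (P n o\<^sub>L \<sigma> x)) \<le> hs_sq K e (sqrt (\<beta> t) *\<^sub>R \<sigma> x)"
      unfolding hs_sq_scaleR by (intro mult_left_mono PA_le) auto
    then show ?thesis using \<sigma>_growth[OF t] by (rule order.trans)
  qed
  have X0m: "X0 \<in> borel_measurable M" using X0_measurable by (rule measurable_F_M)
  have X0f: "(\<integral>\<^sup>+\<omega>. ennreal ((norm (X0 \<omega>))\<^sup>2) \<partial>M) < \<infinity>"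
    using X0_L2 by (simp add: nn_integral_eq_integral)
  have PX0m: "(\<lambda>\<omega>. P n (X0 \<omega>)) \<in> borel_measurable M" for n
    by (rule measurable_compose[OF X0m]) (simp add: borel_measurable_continuous_onI linear_continuous_on blinfun.bounded_linear_right)
  have PX0f: "(\<integral>\<^sup>+\<omega>. ennreal ((norm (P n (X0 \<omega>)))\<^sup>2) \<partial>M) < \<infinity>" for n
    by (rule order.strict_trans1[OF nn_integral_mono X0f]) (intro ennreal_leI power_mono P_le norm_ge_zero)
  have mX: "jointly_measurable T M X"
    using X T0(1) unfolding strong_solution_def by (auto intro: progressive_jointly_measurable)
  have mXn: "jointly_measurable T M (Xn n)" if "n \<ge> 1" for n
    using Xn[OF that] T0(1) unfolding strong_solution_def by (auto intro: progressive_jointly_measurable)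
  let ?r = "\<lambda>n s \<omega>. ennreal ((norm (b s (X s \<omega>) - P n (b s (X s \<omega>))))\<^sup>2)"
  let ?h = "\<lambda>n s \<omega>. hs_sq K e ((id_blinfun - P n) o\<^sub>L \<sigma> (X s \<omega>))"
  have mbX: "jointly_measurable T M (\<lambda>s \<omega>. b s (X s \<omega>))"
  proof -
    have "(\<lambda>p. (fst p, X (fst p) (snd p))) \<in>
        measurable (restrict_space borel {0..T} \<Otimes>\<^sub>M M) (restrict_space borel {0..T} \<Otimes>\<^sub>M borel)"
      using mX unfolding jointly_measurable_def case_prod_unfold by (intro measurable_Pair measurable_fst)
    from measurable_compose[OF this b_measurable] show ?thesis
      by (simp add: jointly_measurable_def case_prod_unfold)
  qed
  have mr: "jointly_measurable T M (?r n)" for n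
  proof -
    have [measurable]: "blinfun_apply (P n) \<in> borel_measurable borel"
      by (simp add: borel_measurable_continuous_onI linear_continuous_on blinfun.bounded_linear_right)
    show ?thesis
      using mbX unfolding jointly_measurable_def case_prod_unfold by measurable
  qed
  \<comment> \<open>A single term of the Hilbert--Schmidt sum is below the whole, so each map
    \<open>x \<mapsto> \<sigma> x (e j)\<close> is Lipschitz and hence Borel. The absolute value of
    \<open>Ls\<close> appears because its sign is not prescribed.\<close>
  have mh: "jointly_measurable T M (?h n)" for n
    unfolding jointly_measurable_def case_prod_unfold
  proof (rule measurable_hs_sq)
    fix j assume j: "j \<in> K"
    have "norm (\<sigma> x (e j) - \<sigma> y (e j)) \<le> \<bar>Ls\<bar> * norm (x - y)" for x y
    proof -
      have "ennreal ((norm ((\<sigma> x - \<sigma> y) (e j)))\<^sup>2) \<le> ennreal (Ls\<^sup>2 * (norm (x - y))\<^sup>2)"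
        by (rule order.trans[OF hs_sq_term_le[OF j] \<sigma>_dist])
      then have "(norm ((\<sigma> x - \<sigma> y) (e j)))\<^sup>2 \<le> (\<bar>Ls\<bar> * norm (x - y))\<^sup>2"
        by (simp add: power_mult_distrib)
      then have "norm ((\<sigma> x - \<sigma> y) (e j)) \<le> \<bar>Ls\<bar> * norm (x - y)"
        by (rule power2_le_imp_le) simp
      then show ?thesis by (simp add: blinfun.diff_left)
    qed
    then have "\<bar>Ls\<bar>-lipschitz_on UNIV (\<lambda>x. \<sigma> x (e j))" by (intro lipschitz_onI) (auto simp: dist_norm)
    then have "(\<lambda>x. \<sigma> x (e j)) \<in> borel_measurable borel"
      by (intro borel_measurable_continuous_onI) (rule lipschitz_on_continuous_on)
    moreover have "blinfun_apply (id_blinfun - P n) \<in> borel_measurable borel"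
      by (simp add: borel_measurable_continuous_onI linear_continuous_on blinfun.bounded_linear_right)
    moreover have "(\<lambda>p. X (fst p) (snd p)) \<in> borel_measurable (restrict_space borel {0..T} \<Otimes>\<^sub>M M)"
      using mX by (simp add: jointly_measurable_def case_prod_unfold)
    ultimately show "(\<lambda>p. blinfun_apply ((id_blinfun - P n) o\<^sub>L \<sigma> (X (fst p) (snd p))) (e j))
        \<in> borel_measurable (restrict_space borel {0..T} \<Otimes>\<^sub>M M)"
      by (simp only: blinfun_apply_blinfun_compose) (rule measurable_compose[OF measurable_compose])
  qed
  \<comment> \<open>The three parts of the tail hypothesis get weights 1, 2 and
    \<open>2 * \<beta>_hi\<close>, all dominated by \<open>2 + 2 * \<beta>_hi\<close>. Each 2 comes
    from splitting a square, and \<open>\<beta>_hi\<close> from the squared factor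
    \<open>sqrt (\<beta> t)\<close> of the diffusion.\<close>
  define C1 where "C1 = stability_const T k * ((2 + 2 * \<beta>_hi) * C)"
  have C1: "0 \<le> C1"
    unfolding C1_def using C \<beta>hi T0(1) k by (intro mult_nonneg_nonneg stability_const_nonneg) auto
  have main: "\<exists>G. (\<integral>\<^sup>+\<omega>. G \<omega> \<partial>M) \<le> ennreal (C1 * real n powr (- \<gamma>)) \<and>
      (AE \<omega> in M. \<forall>t\<in>{0..T}. ennreal ((norm (Xn n t \<omega> - X t \<omega>))\<^sup>2) \<le> G \<omega>)" if n: "n \<ge> 1" for n
  proof -
    let ?df = "\<lambda>s \<omega>. 2 * ?r n s \<omega>" and ?ds = "\<lambda>s \<omega>. ennreal (2 * \<beta>_hi) * ?h n s \<omega>"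
    have mdf: "jointly_measurable T M ?df" and mds: "jointly_measurable T M ?ds"
      using mr[of n] mh[of n] unfolding jointly_measurable_def case_prod_unfold by measurable
    have f_diff: "ennreal ((norm (P n (b s (Xn n s \<omega>)) - b s (X s \<omega>)))\<^sup>2) \<le>
        ennreal k * ennreal ((norm (Xn n s \<omega> - X s \<omega>))\<^sup>2) + ?df s \<omega>" if s: "s \<in> {0..T}" for s \<omega>
    proof -
      let ?x = "X s \<omega>" and ?x' = "Xn n s \<omega>"
      \<comment> \<open>Projecting the difference leaves a residual at the exact solution, which the
        tail hypothesis controls.\<close>
      have "P n (b s ?x') - b s ?x = P n (b s ?x' - b s ?x) - (b s ?x - P n (b s ?x))"
        by (simp add: blinfun.diff_right)
      then have "(norm (P n (b s ?x') - b s ?x))\<^sup>2 \<le>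
          2 * (norm (P n (b s ?x' - b s ?x)))\<^sup>2 + 2 * (norm (b s ?x - P n (b s ?x)))\<^sup>2"
        by (metis norm_diff_sq_le)
      also have "(norm (P n (b s ?x' - b s ?x)))\<^sup>2 \<le> (Lb * norm (?x' - ?x))\<^sup>2"
        by (intro power_mono order.trans[OF P_le Lb_dist[OF s]]) auto
      finally have "(norm (P n (b s ?x') - b s ?x))\<^sup>2 \<le>
          2 * Lb\<^sup>2 * (norm (?x' - ?x))\<^sup>2 + 2 * (norm (b s ?x - P n (b s ?x)))\<^sup>2"
        by (simp add: power_mult_distrib)
      also have "\<dots> \<le> k * (norm (?x' - ?x))\<^sup>2 + 2 * (norm (b s ?x - P n (b s ?x)))\<^sup>2"
        using \<beta>hi by (intro add_right_mono mult_right_mono) (auto simp: k_def)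
      finally have "ennreal ((norm (P n (b s ?x') - b s ?x))\<^sup>2) \<le>
          ennreal (k * (norm (?x' - ?x))\<^sup>2 + 2 * (norm (b s ?x - P n (b s ?x)))\<^sup>2)" by (rule ennreal_leI)
      then show ?thesis using k by (simp add: ennreal_mult)
    qed
    have S_diff: "hs_sq K e (sqrt (\<beta> s) *\<^sub>R (P n o\<^sub>L \<sigma> (Xn n s \<omega>)) - sqrt (\<beta> s) *\<^sub>R \<sigma> (X s \<omega>)) \<le>
        ennreal k * ennreal ((norm (Xn n s \<omega> - X s \<omega>))\<^sup>2) + ?ds s \<omega>" if s: "s \<in> {0..T}" for s \<omega>
    proof -
      let ?x = "X s \<omega>" and ?x' = "Xn n s \<omega>"
      have "sqrt (\<beta> s) *\<^sub>R (P n o\<^sub>L \<sigma> ?x') - sqrt (\<beta> s) *\<^sub>R \<sigma> ?x =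
          sqrt (\<beta> s) *\<^sub>R ((P n o\<^sub>L (\<sigma> ?x' - \<sigma> ?x)) - ((id_blinfun - P n) o\<^sub>L \<sigma> ?x))"
        by (rule blinfun_eqI) (simp add: blinfun.diff_left blinfun.diff_right blinfun.scaleR_left algebra_simps)
      then have "hs_sq K e (sqrt (\<beta> s) *\<^sub>R (P n o\<^sub>L \<sigma> ?x') - sqrt (\<beta> s) *\<^sub>R \<sigma> ?x) =
          ennreal (\<beta> s) * hs_sq K e ((P n o\<^sub>L (\<sigma> ?x' - \<sigma> ?x)) - ((id_blinfun - P n) o\<^sub>L \<sigma> ?x))"
        using \<beta>[OF s] by (simp add: hs_sq_scaleR)
      also have "\<dots> \<le> ennreal \<beta>_hi * (2 * ennreal (Ls\<^sup>2 * (norm (?x' - ?x))\<^sup>2) + 2 * ?h n s \<omega>)"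
        using \<beta>[OF s]
        by (intro mult_mono ennreal_leI order.trans[OF hs_sq_diff_le] add_mono mult_left_mono
            order.trans[OF PA_le \<sigma>_dist]) auto
      also have "\<dots> = ennreal (\<beta>_hi * (2 * Ls\<^sup>2)) * ennreal ((norm (?x' - ?x))\<^sup>2) + ?ds s \<omega>"
        using \<beta>hi by (simp add: ennreal_mult distrib_left mult_ac)
      also have "\<dots> \<le> ennreal k * ennreal ((norm (?x' - ?x))\<^sup>2) + ?ds s \<omega>"
        by (intro add_right_mono mult_right_mono ennreal_leI) (auto simp: k_def)
      finally show ?thesis .
    qed
    obtain G where G: "(\<integral>\<^sup>+\<omega>. G \<omega> \<partial>M) \<le> ennreal (stability_const T k) *
        ((\<integral>\<^sup>+\<omega>. ennreal ((norm (P n (X0 \<omega>) - X0 \<omega>))\<^sup>2) \<partial>M) + time_exp M T ?df + time_exp M T ?ds)"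
      "AE \<omega> in M. \<forall>s\<in>{0..T}. ennreal ((norm (Xn n s \<omega> - X s \<omega>))\<^sup>2) \<le> G \<omega>"
      using strong_solutions_distance[OF X Xn[OF n] basis T X0m X0f PX0m PX0f c k b_growth \<sigma>_growth
        Pb_growth P\<sigma>_growth mdf mds f_diff S_diff] by blast
    let ?I = "\<integral>\<^sup>+\<omega>. ennreal ((norm (X0 \<omega> - P n (X0 \<omega>)))\<^sup>2) \<partial>M"
    have two: "2 \<le> ennreal (2 + 2 * \<beta>_hi)" "1 \<le> ennreal (2 + 2 * \<beta>_hi)"
      using ennreal_leI[of 2 "2 + 2 * \<beta>_hi"] ennreal_leI[of 1 "2 + 2 * \<beta>_hi"] \<beta>hi by auto
    have "?I + time_exp M T ?df + time_exp M T ?ds = 1 * ?I + 2 * time_exp M T (?r n) + ennreal (2 * \<beta>_hi) * time_exp M T (?h n)"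
      using time_exp_cmult[OF mr[of n] T0(1) order_refl, of 2]
        time_exp_cmult[OF mh[of n] T0(1) order_refl, of "ennreal (2 * \<beta>_hi)"] by simp
    also have "\<dots> \<le> ennreal (2 + 2 * \<beta>_hi) * ?I + ennreal (2 + 2 * \<beta>_hi) * time_exp M T (?r n)
        + ennreal (2 + 2 * \<beta>_hi) * time_exp M T (?h n)"
      by (intro add_mono mult_right_mono two ennreal_leI) auto
    also have "\<dots> = ennreal (2 + 2 * \<beta>_hi) * (?I + time_exp M T (?r n) + time_exp M T (?h n))"
      by (simp add: distrib_left)
    also have "\<dots> \<le> ennreal (2 + 2 * \<beta>_hi) * ennreal (C * real n powr (- \<gamma>))"
      unfolding time_exp_def by (intro mult_left_mono tail n) auto
    finally have D: "?I + time_exp M T ?df + time_exp M T ?ds \<le>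
        ennreal (2 + 2 * \<beta>_hi) * ennreal (C * real n powr (- \<gamma>))" .
    have "(\<integral>\<^sup>+\<omega>. G \<omega> \<partial>M) \<le> ennreal (stability_const T k) *
        (ennreal (2 + 2 * \<beta>_hi) * ennreal (C * real n powr (- \<gamma>)))"
      using G(1) unfolding norm_minus_commute[of "P n _"]
      by (rule order.trans) (intro mult_left_mono D, simp)
    also have "\<dots> = ennreal (C1 * real n powr (- \<gamma>))"
      using C \<beta>hi stability_const_nonneg[OF T0(1), of k] k
      by (simp add: C1_def ennreal_mult[symmetric] mult.assoc del: ennreal_plus)
    finally show ?thesis using G(2) by blast
  qed
  \<comment> \<open>\<open>nn_integral\<close> is a supremum over simple functions below the
    integrand, hence monotone for arbitrary functions; the supremum over all times can be integrated
    here even if it is not measurable.\<close>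
  have sup_le: "(\<integral>\<^sup>+\<omega>. (SUP t\<in>{0..T}. ennreal ((norm (Xn n t \<omega> - X t \<omega>))\<^sup>2)) \<partial>M)
      \<le> ennreal (C1 * real n powr (- \<gamma>))" if n: "n \<ge> 1" for n
  proof -
    obtain G where G: "(\<integral>\<^sup>+\<omega>. G \<omega> \<partial>M) \<le> ennreal (C1 * real n powr (- \<gamma>))"
      "AE \<omega> in M. \<forall>t\<in>{0..T}. ennreal ((norm (Xn n t \<omega> - X t \<omega>))\<^sup>2) \<le> G \<omega>"
      using main[OF n] by blast
    have "(\<integral>\<^sup>+\<omega>. (SUP t\<in>{0..T}. ennreal ((norm (Xn n t \<omega> - X t \<omega>))\<^sup>2)) \<partial>M) \<le> (\<integral>\<^sup>+\<omega>. G \<omega> \<partial>M)"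
      using G(2) by (intro nn_integral_mono_AE) (auto elim!: eventually_mono intro!: SUP_least)
    then show ?thesis using G(1) by (rule order.trans)
  qed
  have W2: "finite_second_moment (law M (Xn n t)) \<and> finite_second_moment (law M (X t)) \<and>
      wasserstein2 (law M (Xn n t)) (law M (X t)) \<le> sqrt C1 * real n powr (- \<gamma> / 2)"
    if t: "t \<in> {0..T}" and n: "n \<ge> 1" for t n
  proof (intro conjI)
    have meas: "X t \<in> borel_measurable M" "Xn n t \<in> borel_measurable M"
      using jointly_measurable_section[OF mX t] jointly_measurable_section[OF mXn[OF n] t] by auto
    show "finite_second_moment (law M (X t))"
      using strong_solution_second_moment[OF X basis T X0m X0f c b_growth \<sigma>_growth] t
      by (intro finite_second_moment_law meas) (auto intro: order.strict_trans1)
    show "finite_second_moment (law M (Xn n t))"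
      using strong_solution_second_moment[OF Xn[OF n] basis T PX0m PX0f c Pb_growth P\<sigma>_growth] t
      by (intro finite_second_moment_law meas) (auto intro: order.strict_trans1)
    \<comment> \<open>A single time lies below the supremum, so the constant is the same for all t;
      taking the root halves the exponent.\<close>
    have "(\<integral>\<^sup>+\<omega>. ennreal ((norm (Xn n t \<omega> - X t \<omega>))\<^sup>2) \<partial>M) \<le> ennreal (C1 * real n powr (- \<gamma>))"
      by (rule order.trans[OF nn_integral_mono sup_le[OF n]]) (rule SUP_upper[OF t])
    then have "wasserstein2 (law M (Xn n t)) (law M (X t)) \<le> sqrt (C1 * real n powr (- \<gamma>))"
      using C1 by (intro wasserstein2_law_le meas) auto
    also have "\<dots> = sqrt C1 * real n powr (- \<gamma> / 2)"
      using n by (simp add: real_sqrt_mult powr_half_sqrt[symmetric] powr_powr)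
    finally show "wasserstein2 (law M (Xn n t)) (law M (X t)) \<le> sqrt C1 * real n powr (- \<gamma> / 2)" .
  qed
  show ?thesis using sup_le W2 by blast
qed

end
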